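(* Let $\varepsilon > 0$, let $q$ be a prime power, and let $P\in\mathbb{F}_q[x,y,z]$ be a polynomial of the form $$P(x,y,z) = F(x,G(y,z))+H(y,z)+J(x),$$ where $F,G,H$ are polynomials in two variables over $\mathbb{F}_q$ and $J\in \mathbb{F}_q[x]$ are such that: (i) $F$ is non-diagonal and symmetric with $\deg(F)<\mathrm{char}(\mathbb{F}_q)$, and (ii) $G$ and $H$ are algebraically independent. Let $X,Y,Z\subseteq\mathbb{F}_q$ be such that $|X|,|Y|,|Z|\gg q^{8/9+\varepsilon}$. Then $$|P(X,Y,Z)|=q-O_{\varepsilon,\deg(P)}(q^{1-3\varepsilon}).$$
   Context: For $X,Y,Z \subseteq \mathbb{F}_q$, $P(X,Y,Z) := \{P(x,y,z) : x\in X, y \in Y, z \in Z\}$. A polynomial $F$ in two variables is symmetric if $F(a,x) = F(x,a)$. It is diagonal if it has the form $f(a)+g(x)$ for single-variable polynomials $f,g$ (i.e. no monomial involving both variables occurs with non-zero coefficient), and non-diagonal otherwise. $\deg$ denotes total degree. The hypothesis $|X|,|Y|,|Z| \gg q^{8/9+\varepsilon}$ means that $|X|,|Y|,|Z| \ge c\, q^{8/9+\varepsilon}$ for some fixed constant $c>0$. The notation $A = q - O_{\varepsilon,\deg(P)}(E)$ means $|A-q| \le C E$ for some constant $C>0$ depending only on $\varepsilon$, $\deg(P)$ (and the implied constant $c$ in the hypothesis), but not on $q$, $X$, $Y$, $Z$. *)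

theory Defs
  imports Complex_Main "HOL-Algebra.UnivPoly" "HOL-Algebra.Multiplicative_Group"
begin

text \<open>
  The implied constant in the theorem is uniform over all finite fields, so the fields have to be
  quantified inside the formula and are therefore records of HOL-Algebra, not instances of the type
  class of fields. Instantiating the type of the elements with an infinite type such as \<open>nat\<close> covers
  every finite field up to isomorphism with a single constant.

  Polynomials in two and three variables are iterated univariate polynomials, the first variable
  being the outermost one: \<open>coeff (UP R) (coeff (UP (UP R)) F i) j\<close> is the coefficient of
  $x^i y^j$ in $F(x,y)$, and the coefficients of $P(x,y,z)$ as an element of
  \<open>UP (UP (UP R))\<close> are polynomials in $(y,z)$.
\<close>

abbreviation Poly2 :: "('a, 'm) ring_scheme \<Rightarrow> (nat \<Rightarrow> 'a, nat \<Rightarrow> nat \<Rightarrow> 'a) up_ring"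
  where "Poly2 R \<equiv> UP (UP R)"

abbreviation Poly3 ::
  "('a, 'm) ring_scheme \<Rightarrow> (nat \<Rightarrow> nat \<Rightarrow> 'a, nat \<Rightarrow> nat \<Rightarrow> nat \<Rightarrow> 'a) up_ring"
  where "Poly3 R \<equiv> UP (UP (UP R))"

definition const2 :: "('a, 'm) ring_scheme \<Rightarrow> 'a \<Rightarrow> nat \<Rightarrow> nat \<Rightarrow> 'a"
  where "const2 R a = monom (Poly2 R) (monom (UP R) a 0) 0"

definition fst_var2 :: "('a, 'm) ring_scheme \<Rightarrow> nat \<Rightarrow> nat \<Rightarrow> 'a"
  where "fst_var2 R = monom (Poly2 R) \<one>\<^bsub>UP R\<^esub> 1"

definition snd_var2 :: "('a, 'm) ring_scheme \<Rightarrow> nat \<Rightarrow> nat \<Rightarrow> 'a"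
  where "snd_var2 R = monom (Poly2 R) (monom (UP R) \<one>\<^bsub>R\<^esub> 1) 0"

text \<open>The embedding of $R[y,z]$ into $R[x,y,z]$.\<close>

definition lift_yz :: "('a, 'm) ring_scheme \<Rightarrow> (nat \<Rightarrow> nat \<Rightarrow> 'a) \<Rightarrow> nat \<Rightarrow> nat \<Rightarrow> nat \<Rightarrow> 'a"
  where "lift_yz R G = monom (Poly3 R) G 0"

definition const3 :: "('a, 'm) ring_scheme \<Rightarrow> 'a \<Rightarrow> nat \<Rightarrow> nat \<Rightarrow> nat \<Rightarrow> 'a"
  where "const3 R a = lift_yz R (const2 R a)"

definition x_var3 :: "('a, 'm) ring_scheme \<Rightarrow> nat \<Rightarrow> nat \<Rightarrow> nat \<Rightarrow> 'a"
  where "x_var3 R = monom (Poly3 R) \<one>\<^bsub>Poly2 R\<^esub> 1"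

text \<open>
  Substitution of elements of a commutative ring \<open>S\<close> for the variables, the coefficients being
  mapped by a homomorphism \<open>h\<close> from \<open>R\<close> to \<open>S\<close>. With \<open>S = R\<close> this is the value at a point, with
  \<open>S\<close> a polynomial ring it is the composition of polynomials.
\<close>

definition eval2 ::
  "('a, 'm) ring_scheme \<Rightarrow> ('b, 'n) ring_scheme \<Rightarrow> ('a \<Rightarrow> 'b) \<Rightarrow> 'b \<Rightarrow> 'b
    \<Rightarrow> (nat \<Rightarrow> nat \<Rightarrow> 'a) \<Rightarrow> 'b"
  where "eval2 R S h s t = eval (UP R) S (eval R S h t) s"

definition eval3 ::
  "('a, 'm) ring_scheme \<Rightarrow> ('b, 'n) ring_scheme \<Rightarrow> ('a \<Rightarrow> 'b) \<Rightarrow> 'b \<Rightarrow> 'b \<Rightarrow> 'b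
    \<Rightarrow> (nat \<Rightarrow> nat \<Rightarrow> nat \<Rightarrow> 'a) \<Rightarrow> 'b"
  where "eval3 R S h s t u = eval (Poly2 R) S (eval2 R S h t u) s"

definition image3 ::
  "('a, 'm) ring_scheme \<Rightarrow> (nat \<Rightarrow> nat \<Rightarrow> nat \<Rightarrow> 'a) \<Rightarrow> 'a set \<Rightarrow> 'a set \<Rightarrow> 'a set \<Rightarrow> 'a set"
  where "image3 R P X Y Z = {eval3 R R (\<lambda>a. a) x y z P | x y z. x \<in> X \<and> y \<in> Y \<and> z \<in> Z}"

text \<open>Total degrees; the zero polynomial gets degree 0.\<close>

definition total_deg2 :: "('a, 'm) ring_scheme \<Rightarrow> (nat \<Rightarrow> nat \<Rightarrow> 'a) \<Rightarrow> nat"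
  where "total_deg2 R F =
    Max (insert 0 {i + j | i j. coeff (UP R) (coeff (Poly2 R) F i) j \<noteq> \<zero>\<^bsub>R\<^esub>})"

definition total_deg3 :: "('a, 'm) ring_scheme \<Rightarrow> (nat \<Rightarrow> nat \<Rightarrow> nat \<Rightarrow> 'a) \<Rightarrow> nat"
  where "total_deg3 R P =
    Max (insert 0 {i + j + k | i j k.
      coeff (UP R) (coeff (Poly2 R) (coeff (Poly3 R) P i) j) k \<noteq> \<zero>\<^bsub>R\<^esub>})"

definition symmetric2 :: "('a, 'm) ring_scheme \<Rightarrow> (nat \<Rightarrow> nat \<Rightarrow> 'a) \<Rightarrow> bool"
  where "symmetric2 R F \<longleftrightarrow> eval2 R (Poly2 R) (const2 R) (snd_var2 R) (fst_var2 R) F = F"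

definition diagonal2 :: "('a, 'm) ring_scheme \<Rightarrow> (nat \<Rightarrow> nat \<Rightarrow> 'a) \<Rightarrow> bool"
  where "diagonal2 R F \<longleftrightarrow> (\<exists>f \<in> carrier (UP R). \<exists>g \<in> carrier (UP R).
    F = eval R (Poly2 R) (const2 R) (fst_var2 R) f
        \<oplus>\<^bsub>Poly2 R\<^esub> eval R (Poly2 R) (const2 R) (snd_var2 R) g)"

definition alg_independent2 ::
  "('a, 'm) ring_scheme \<Rightarrow> (nat \<Rightarrow> nat \<Rightarrow> 'a) \<Rightarrow> (nat \<Rightarrow> nat \<Rightarrow> 'a) \<Rightarrow> bool"
  where "alg_independent2 R G H \<longleftrightarrow> (\<forall>Q \<in> carrier (Poly2 R).
    eval2 R (Poly2 R) (const2 R) G H Q = \<zero>\<^bsub>Poly2 R\<^esub> \<longrightarrow> Q = \<zero>\<^bsub>Poly2 R\<^esub>)"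

text \<open>The additive order of 1; \<open>group.ord\<close> is 0 for elements of infinite order.\<close>

definition ring_characteristic :: "('a, 'm) ring_scheme \<Rightarrow> nat"
  where "ring_characteristic R = group.ord (add_monoid R) \<one>\<^bsub>R\<^esub>"

end

theory Submission
  imports "HOL-Analysis.FPS_Convergence" "HOL-Computational_Algebra.Fundamental_Theorem_Algebra"
    "HOL-Number_Theory.Cong" Defs
begin

text \<open>
  The terms of $F$ in one variable alone are absorbed into $H$ and $J$; then the degrees of $F$, $G$, $H$
  are bounded by that of $P$. Since $G$ and $H$ are algebraically independent, $(G,H)$ has bounded fibres
  outside $O(q)$ points, so the set $B$ of its values on $Y \times Z$ has size $\gg |Y||Z|$. If $W$ is the
  complement of the image, then $F(x,u) + v + J(x) \notin W$ for $x \in X$, $(u,v) \in B$. Expanding this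
  in additive characters $\psi$ and using Parseval leaves the norm of the matrices $\psi(F(x,u))$, which
  Schur's test bounds by $O(q^{3/4})$ in terms of complete sums $\sum_x \psi(f(x))$. The outcome is
  $|X||B||W| \ll q^{7/2}$, which is stronger than needed.

  Weil's bound for these sums: with $\chi(h) = \psi(\sum f(\alpha))$ over the roots $\alpha$ of $h$, the
  $L$-function of $\chi$ is a polynomial of degree less than $\deg f$, because $\deg f$ is prime to the
  characteristic. It suffices to bound its roots, hence to bound the sums $S_n$ over the extension of
  degree $n$ by $O(q^{n/2})$ with a constant that may depend on $q$. This is done by Stepanov's method
  in the form of Bombieri, with polynomials in one variable and congruences modulo irreducible
  polynomials in place of points of extension fields.
\<close>

section \<open>Polynomials over a finite field sitting as an ideal in a ring\<close>

text \<open>Origin of q^(7/2): for fixed u the polynomial F(x,u) - F(x,u') in x is constant for only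
  O(1) values u'. Each of these costs q, every other one q^(1/2) by Weil, so the Gram matrix of the
  columns has row sums O(q^(3/2)). With Parseval, |X||B||W| is at most O((|X| q^(3/2))^(1/2)) times
  q (|B||W|)^(1/2), and a factor (|X||B||W|)^(1/2) cancels. For sets of size q^(8/9+eps) this leaves
  |W| = O(q^(5/6-3 eps)). The condition deg F < char makes the degree d of every slice prime to the
  characteristic. This enters twice: a power sum can be shifted freely, whence the higher
  coefficients of the L-function vanish, and leading degrees are separated in Stepanov's
  construction. A constant depending on q is harmless in the bound for S_n because only the growth
  rate decides where the logarithmic derivative of the L-function converges. Both auxiliary
  polynomials, Stepanov's and the algebraic relation between G, H and a coordinate, come from the
  pigeonhole principle for coefficient vectors over the finite field: q^a vectors and at most q^b
  values with a > b.\<close>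

lemma monic_degree_mult:
  fixes f g :: "'w::comm_ring_1 poly"
  assumes "lead_coeff f = 1" "g \<noteq> 0"
  shows "degree (f * g) = degree f + degree g" "lead_coeff (f * g) = lead_coeff g" "f * g \<noteq> 0"
proof -
  \<comment> \<open>The ring may have zero divisors; degrees add only because the leading
    coefficient 1 of \<open>f\<close> cannot annihilate that of \<open>g\<close>.\<close>
  have c: "poly.coeff (f * g) (degree f + degree g) = lead_coeff g"
    using assms by (simp add: coeff_mult_degree_sum)
  moreover have "lead_coeff g \<noteq> 0" using assms by simp
  ultimately have "degree f + degree g \<le> degree (f * g)" by (intro le_degree) simp
  then show d: "degree (f * g) = degree f + degree g" using degree_mult_le[of f g] by simp
  show "lead_coeff (f * g) = lead_coeff g" using c d by simp
  show "f * g \<noteq> 0" using c assms by auto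
qed

text \<open>The type class library on polynomials is available for a single ring only, whereas fields of all
  characteristics occur. So a finite field is an ideal \<open>k\<close> of an ambient ring with a unit \<open>e\<close> of its
  own, in general different from \<open>1\<close>.\<close>

locale field_ideal =
  fixes k :: "'w::comm_ring_1 set" and e :: 'w
  assumes finite_k: "finite k" and e_in: "e \<in> k" and e_nz: "e \<noteq> 0"
    and add_k: "a \<in> k \<Longrightarrow> b \<in> k \<Longrightarrow> a + b \<in> k"
    and mult_k: "a \<in> k \<Longrightarrow> w * a \<in> k"
    and e_mult: "a \<in> k \<Longrightarrow> e * a = a"
    and inv_k: "a \<in> k \<Longrightarrow> a \<noteq> 0 \<Longrightarrow> \<exists>b. a * b = e"
begin

lemma zero_k: "0 \<in> k" using mult_k[OF e_in, of 0] by simp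

lemma mult_k': "a \<in> k \<Longrightarrow> a * w \<in> k" using mult_k[of a w] by (simp add: mult.commute)

lemma minus_k: "a \<in> k \<Longrightarrow> - a \<in> k" using mult_k[of a "-1"] by simp

lemma diff_k: "a \<in> k \<Longrightarrow> b \<in> k \<Longrightarrow> a - b \<in> k" using add_k[of a "-b"] minus_k[of b] by simp

lemma sum_k: "(\<And>i. i \<in> A \<Longrightarrow> f i \<in> k) \<Longrightarrow> sum f A \<in> k"
  by (induction A rule: infinite_finite_induct) (auto simp: zero_k add_k)

lemma power_k: "a \<in> k \<Longrightarrow> n > 0 \<Longrightarrow> a ^ n \<in> k"
  by (cases n) (auto simp: mult_k')

lemma e_idem: "e * e = e" by (rule e_mult[OF e_in])

lemma inv_in_k: assumes "a \<in> k" "a \<noteq> 0" shows "\<exists>b\<in>k. a * b = e"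
proof -
  obtain b where "a * b = e" using inv_k[OF assms] by blast
  then have "a * (e * b) = e" using e_idem by (metis mult.left_commute)
  then show ?thesis using mult_k'[OF e_in] by blast
qed

lemma mult_zero_k: assumes "a \<in> k" "b \<in> k" "a * b = 0" shows "a = 0 \<or> b = 0"
proof (rule ccontr)
  assume H: "\<not> ?thesis"
  obtain c where "a * c = e" using inv_k assms H by blast
  then have "b = c * (a * b)" using e_mult[OF assms(2)] by (metis mult.assoc mult.commute)
  then show False using assms H by simp
qed

lemma power_nz_k: "a \<in> k \<Longrightarrow> a \<noteq> 0 \<Longrightarrow> a ^ n \<noteq> 0"
proof (induction n)
  case (Suc n)
  then show ?case using mult_zero_k[of a "a ^ n"] power_k[of a n]
    by (cases n) auto
qed auto

definition q :: nat where "q = card k"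

lemma q_ge_2: "q \<ge> 2"
proof -
  have "{0, e} \<subseteq> k" using zero_k e_in by auto
  then have "card {0, e} \<le> card k" using finite_k by (intro card_mono)
  then show ?thesis using e_nz unfolding q_def by simp
qed

definition kpoly :: "'w poly set" where "kpoly = {f. \<forall>i. poly.coeff f i \<in> k}"

lemma kpoly_0: "0 \<in> kpoly" by (simp add: kpoly_def zero_k)
lemma kpoly_add: "f \<in> kpoly \<Longrightarrow> g \<in> kpoly \<Longrightarrow> f + g \<in> kpoly" by (simp add: kpoly_def add_k)
lemma kpoly_diff: "f \<in> kpoly \<Longrightarrow> g \<in> kpoly \<Longrightarrow> f - g \<in> kpoly" by (simp add: kpoly_def diff_k)
lemma kpoly_mult: "f \<in> kpoly \<Longrightarrow> g * f \<in> kpoly"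
  by (auto simp: kpoly_def coeff_mult intro!: sum_k mult_k)
lemma kpoly_mult': "f \<in> kpoly \<Longrightarrow> f * g \<in> kpoly" using kpoly_mult[of f g] by (simp add: mult.commute)
lemma kpoly_smult: "f \<in> kpoly \<Longrightarrow> Polynomial.smult c f \<in> kpoly" by (simp add: kpoly_def mult_k)
lemma kpoly_smult_k: "c \<in> k \<Longrightarrow> Polynomial.smult c f \<in> kpoly" by (simp add: kpoly_def mult_k')
lemma kpoly_monom: "c \<in> k \<Longrightarrow> Polynomial.monom c n \<in> kpoly" by (simp add: kpoly_def zero_k)
lemma kpoly_const: "c \<in> k \<Longrightarrow> [:c:] \<in> kpoly" by (simp add: kpoly_def zero_k coeff_pCons split: nat.split)
lemma kpoly_sum: "(\<And>i. i \<in> A \<Longrightarrow> f i \<in> kpoly) \<Longrightarrow> sum f A \<in> kpoly"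
  by (induction A rule: infinite_finite_induct) (auto simp: kpoly_0 kpoly_add)
lemma kpoly_power: "f \<in> kpoly \<Longrightarrow> n > 0 \<Longrightarrow> f ^ n \<in> kpoly"
  by (cases n) (auto simp: kpoly_mult')
lemma kpoly_e: "f \<in> kpoly \<Longrightarrow> Polynomial.smult e f = f"
  by (rule poly_eqI) (simp add: kpoly_def e_mult)
lemma kpoly_e': "f \<in> kpoly \<Longrightarrow> [:e:] * f = f" using kpoly_e by simp

text \<open>A condition on coefficients instead of \<open>degree\<close> keeps 0 in the set and
  gives \<open>q ^ n\<close> elements for every \<open>n\<close>, including \<open>n = 0\<close>.
  These are the residues modulo a monic polynomial of degree \<open>n\<close>.\<close>

definition kpoly_lt :: "nat \<Rightarrow> 'w poly set"
  where "kpoly_lt n = {f \<in> kpoly. \<forall>i\<ge>n. poly.coeff f i = 0}"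

lemma kpoly_ltD: "f \<in> kpoly_lt n \<Longrightarrow> f \<in> kpoly" by (simp add: kpoly_lt_def)

lemma kpoly_lt_degree: "f \<in> kpoly_lt n \<Longrightarrow> f \<noteq> 0 \<Longrightarrow> degree f < n"
  unfolding kpoly_lt_def using leading_coeff_0_iff[of f] not_less[of "degree f" n] by auto

lemma bij_kpoly_lt:
  "bij_betw (\<lambda>c. \<Sum>i<n. Polynomial.monom (c i) i) ({..<n} \<rightarrow>\<^sub>E k) (kpoly_lt n)"
proof (rule bij_betw_byWitness[where f' = "\<lambda>f. restrict (poly.coeff f) {..<n}"])
  have co: "poly.coeff (\<Sum>i<n. Polynomial.monom (c i) i) j = (if j < n then c j else 0)" for c :: "nat \<Rightarrow> 'w" and j
    by (simp add: coeff_sum)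
  show "\<forall>c\<in>{..<n} \<rightarrow>\<^sub>E k. restrict (poly.coeff (\<Sum>i<n. Polynomial.monom (c i) i)) {..<n} = c"
    unfolding co by (auto simp: fun_eq_iff PiE_def extensional_def)
  show "\<forall>f\<in>kpoly_lt n. (\<Sum>i<n. Polynomial.monom (restrict (poly.coeff f) {..<n} i) i) = f"
  proof
    fix f assume f: "f \<in> kpoly_lt n"
    show "(\<Sum>i<n. Polynomial.monom (restrict (poly.coeff f) {..<n} i) i) = f"
      using f unfolding kpoly_lt_def by (intro poly_eqI) (simp add: co)
  qed
  show "(\<lambda>c. \<Sum>i<n. Polynomial.monom (c i) i) ` ({..<n} \<rightarrow>\<^sub>E k) \<subseteq> kpoly_lt n"
    by (auto simp: kpoly_lt_def kpoly_def co zero_k PiE_def)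
  show "(\<lambda>f. restrict (poly.coeff f) {..<n}) ` kpoly_lt n \<subseteq> {..<n} \<rightarrow>\<^sub>E k"
    by (auto simp: kpoly_lt_def kpoly_def PiE_def extensional_def)
qed

lemma card_kpoly_lt: "card (kpoly_lt n) = q ^ n" and finite_kpoly_lt: "finite (kpoly_lt n)"
proof -
  show "card (kpoly_lt n) = q ^ n"
    using bij_betw_same_card[OF bij_kpoly_lt[of n]] by (simp add: card_PiE q_def)
  show "finite (kpoly_lt n)"
    using bij_betw_finite[OF bij_kpoly_lt[of n]] finite_k by (simp add: finite_PiE)
qed

text \<open>The leading coefficient is the unit of the ambient ring, not \<open>e\<close>: these polynomials are monic
  for the library and still closed under products, because \<open>k\<close> is an ideal.\<close>

definition kmonic :: "nat \<Rightarrow> 'w poly set"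
  where "kmonic n = {f. degree f = n \<and> poly.coeff f n = 1 \<and> (\<forall>i<n. poly.coeff f i \<in> k)}"

lemma kmonicI:
  assumes "\<And>i. i > n \<Longrightarrow> poly.coeff f i = 0" "poly.coeff f n = 1" "\<And>i. i < n \<Longrightarrow> poly.coeff f i \<in> k"
  shows "f \<in> kmonic n"
proof -
  have "degree f \<le> n" using assms(1) by (intro degree_le) auto
  moreover have "n \<le> degree f" using assms(2) by (intro le_degree) simp
  ultimately have "degree f = n" by simp
  then show ?thesis using assms unfolding kmonic_def by auto
qed

lemma kmonic_degree: "f \<in> kmonic n \<Longrightarrow> degree f = n"
  and kmonic_lead: "f \<in> kmonic n \<Longrightarrow> lead_coeff f = 1"
  and kmonic_nz: "f \<in> kmonic n \<Longrightarrow> f \<noteq> 0"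
  by (auto simp: kmonic_def)

lemma kmonic_0: "kmonic 0 = {1}"
proof -
  have "f = 1" if "f \<in> kmonic 0" for f
    using that by (auto simp: kmonic_def elim!: degree_eq_zeroE)
  moreover have "1 \<in> kmonic 0" by (auto simp: kmonic_def)
  ultimately show ?thesis by auto
qed

lemma kmonic_iff: "f \<in> kmonic n \<longleftrightarrow> f - Polynomial.monom 1 n \<in> kpoly_lt n"
proof
  assume "f \<in> kmonic n"
  then show "f - Polynomial.monom 1 n \<in> kpoly_lt n"
    by (auto simp: kmonic_def kpoly_lt_def kpoly_def zero_k coeff_eq_0 intro!: coeff_eq_0)
      (metis coeff_eq_0 linorder_neqE_nat zero_k)
next
  assume "f - Polynomial.monom 1 n \<in> kpoly_lt n"
  then have "poly.coeff f i - (if i = n then 1 else 0) \<in> k" "i \<ge> n \<Longrightarrow> poly.coeff f i - (if i = n then 1 else 0) = 0" for i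
    by (auto simp: kpoly_lt_def kpoly_def split: if_splits)
  note * = this
  show "f \<in> kmonic n"
  proof (rule kmonicI)
    show "poly.coeff f n = 1" using *(2)[of n] by simp
    show "poly.coeff f i = 0" if "i > n" for i using *(2)[of i] that by simp
    show "poly.coeff f i \<in> k" if "i < n" for i using *(1)[of i] that by simp
  qed
qed

lemma kmonic_image: "kmonic n = (\<lambda>a. Polynomial.monom 1 n + a) ` kpoly_lt n"
proof (intro equalityI subsetI)
  fix f assume "f \<in> kmonic n"
  then have "f - Polynomial.monom 1 n \<in> kpoly_lt n" by (simp add: kmonic_iff)
  moreover have "f = Polynomial.monom 1 n + (f - Polynomial.monom 1 n)" by simp
  ultimately show "f \<in> (\<lambda>a. Polynomial.monom 1 n + a) ` kpoly_lt n" by blast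
next
  fix f assume "f \<in> (\<lambda>a. Polynomial.monom 1 n + a) ` kpoly_lt n"
  then show "f \<in> kmonic n" by (auto simp: kmonic_iff)
qed

lemma card_kmonic: "card (kmonic n) = q ^ n" and finite_kmonic: "finite (kmonic n)"
  unfolding kmonic_image by (auto simp: card_image inj_on_def card_kpoly_lt finite_kpoly_lt)

lemma kmonic_mult:
  assumes "f \<in> kmonic n" "g \<in> kmonic m" shows "f * g \<in> kmonic (n + m)"
proof -
  define a where "a = f - Polynomial.monom 1 n"
  define b where "b = g - Polynomial.monom 1 m"
  have ab: "a \<in> kpoly" "b \<in> kpoly" using assms by (auto simp: kmonic_iff a_def b_def kpoly_lt_def)
  have "f * g - Polynomial.monom 1 (n + m) = a * Polynomial.monom 1 m + b * Polynomial.monom 1 n + a * b"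
    by (simp add: a_def b_def algebra_simps mult_monom)
  also have "\<dots> \<in> kpoly" by (intro kpoly_add kpoly_mult' ab)
  finally have in_k: "f * g - Polynomial.monom 1 (n + m) \<in> kpoly" .
  have d: "degree (f * g) = n + m" "lead_coeff (f * g) = 1"
    using monic_degree_mult[of f g] kmonic_lead[OF assms(1)] kmonic_nz[OF assms(2)]
      kmonic_lead[OF assms(2)] kmonic_degree[OF assms(2)] kmonic_degree[OF assms(1)] by auto
  show ?thesis
  proof (rule kmonicI)
    show "poly.coeff (f * g) i = 0" if "i > n + m" for i using that d by (simp add: coeff_eq_0)
    show "poly.coeff (f * g) (n + m) = 1" using d by simp
    fix i assume "i < n + m"
    moreover have "poly.coeff (f * g - Polynomial.monom 1 (n + m)) i \<in> k" using in_k by (simp only: kpoly_def) blast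
    ultimately show "poly.coeff (f * g) i \<in> k" by simp
  qed
qed

lemma kmonic_power: "f \<in> kmonic n \<Longrightarrow> f ^ r \<in> kmonic (r * n)"
  by (induction r) (auto simp: kmonic_0 kmonic_mult)

lemma kmonic_e: "f \<in> kmonic n \<Longrightarrow> Polynomial.smult e f \<in> kpoly" 
  by (intro kpoly_smult_k e_in)

text \<open>The coefficients below the leading one lie in \<open>k\<close>, hence are annihilated by
  \<open>1 - e\<close>. So outside the component of \<open>k\<close> a monic polynomial is just a
  power of the variable, known from its degree.\<close>

lemma kmonic_1e: assumes "f \<in> kmonic n"
  shows "Polynomial.smult (1 - e) f = Polynomial.monom (1 - e) n"
proof (rule poly_eqI)
  fix i
  consider "i < n" | "i = n" | "i > n" by linarith
  then show "poly.coeff (Polynomial.smult (1 - e) f) i = poly.coeff (Polynomial.monom (1 - e) n) i"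
  proof cases
    case 1
    then have "poly.coeff f i \<in> k" using assms by (auto simp: kmonic_def)
    then have "e * poly.coeff f i = poly.coeff f i" by (rule e_mult)
    then show ?thesis using 1 by (simp add: left_diff_distrib)
  next
    case 2 then show ?thesis using assms by (simp add: kmonic_def)
  next
    case 3
    then have "poly.coeff f i = 0" using assms by (auto simp: kmonic_def coeff_eq_0)
    then show ?thesis using 3 by simp
  qed
qed

lemma kmonic_dvd_obtain:
  assumes "P \<in> kmonic m" "h \<in> kmonic n" "P dvd h"
  obtains g where "m \<le> n" "g \<in> kmonic (n - m)" "h = P * g"
proof -
  obtain g where g: "h = P * g" using assms(3) by blast
  have "g \<noteq> 0" using g kmonic_nz[OF assms(2)] by auto
  then have d: "degree h = m + degree g" "lead_coeff h = lead_coeff g"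
    using monic_degree_mult[of P g] kmonic_lead[OF assms(1)] kmonic_degree[OF assms(1)] g by auto
  have mn: "m \<le> n" "degree g = n - m" "lead_coeff g = 1"
    using d kmonic_degree[OF assms(2)] kmonic_lead[OF assms(2)] by auto
  have "g \<in> kmonic (n - m)"
  proof (rule kmonicI)
    show "poly.coeff g i = 0" if "i > n - m" for i using that mn by (simp add: coeff_eq_0)
    show "poly.coeff g (n - m) = 1" using mn by metis
    fix i assume i: "i < n - m"
    \<comment> \<open>In the component complementary to \<open>k\<close> both \<open>P\<close> and
      \<open>h\<close> are monomials, so \<open>1 - e\<close> annihilates the lower coefficients of
      the quotient, which therefore lie in \<open>k\<close>.\<close>
    have "Polynomial.monom (1 - e) n = Polynomial.monom (1 - e) m * g"
      using kmonic_1e[OF assms(1)] kmonic_1e[OF assms(2)] g by (metis mult_smult_left)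
    then have "poly.coeff (Polynomial.monom (1 - e) n) (m + i) = poly.coeff (Polynomial.monom (1 - e) m * g) (m + i)" by simp
    then have "(1 - e) * poly.coeff g i = 0" using i by (auto simp: coeff_monom_mult split: if_splits)
    then have "poly.coeff g i = e * poly.coeff g i" by (simp add: left_diff_distrib)
    then show "poly.coeff g i \<in> k" using mult_k'[OF e_in] by metis
  qed
  then show ?thesis using that mn g by blast
qed

lemma kmonic_dvd_degree:
  assumes "P \<in> kmonic m" "P dvd f" "f \<noteq> 0" shows "m \<le> degree f"
proof -
  obtain g where g: "f = P * g" using assms(2) by blast
  then have "g \<noteq> 0" using assms(3) by auto
  then show ?thesis
    using monic_degree_mult(1)[OF kmonic_lead[OF assms(1)], of g] kmonic_degree[OF assms(1)] g by simp
qed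

text \<open>The leading coefficient 1 in general keeps a monic polynomial out of
  \<open>kpoly\<close>. This passes to its projection by \<open>e\<close>, to which the arithmetic
  over \<open>k\<close> applies; in the complementary component divisibility of monomials only asks
  for \<open>m \<le> n\<close>.\<close>

lemma kmonic_dvd_smult_e:
  assumes "P \<in> kmonic m" "h \<in> kmonic n" shows "P dvd Polynomial.smult e h \<longleftrightarrow> P dvd h"
proof
  assume d: "P dvd Polynomial.smult e h"
  have "poly.coeff (Polynomial.smult e h) n = e" using assms(2) by (simp add: kmonic_def)
  then have nz: "Polynomial.smult e h \<noteq> 0" using e_nz by (metis coeff_0)
  have "degree (Polynomial.smult e h) \<le> n" using degree_smult_le[of e h] kmonic_degree[OF assms(2)] by simp
  then have mn: "m \<le> n" using kmonic_dvd_degree[OF assms(1) d nz] by simp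
  have "Polynomial.smult (1 - e) h = Polynomial.smult (1 - e) P * Polynomial.monom 1 (n - m)"
    using mn by (simp only: kmonic_1e[OF assms(1)] kmonic_1e[OF assms(2)]) (simp add: mult_monom)
  then have "P dvd Polynomial.smult (1 - e) h" by (simp add: dvd_smult)
  then have "P dvd Polynomial.smult e h + Polynomial.smult (1 - e) h" using d by (rule dvd_add[rotated])
  then show "P dvd h" by (simp add: smult_add_left[symmetric])
qed (simp add: dvd_smult)

lemma kmonic_division:
  assumes "P \<in> kmonic m" "f \<in> kpoly"
  obtains g r where "f = P * g + r" "g \<in> kpoly" "r \<in> kpoly_lt m"
proof -
  \<comment> \<open>For a divisor with leading coefficient 1, pseudo-division is honest division
    with remainder; projecting by \<open>e\<close> afterwards brings both parts into
    \<open>kpoly\<close>.\<close>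
  obtain g r where gr: "pseudo_divmod f P = (g, r)" by fastforce
  have 1: "f = P * g + r" "r = 0 \<or> degree r < degree P"
    using pseudo_divmod[OF kmonic_nz[OF assms(1)] gr] kmonic_lead[OF assms(1)] by auto
  have "f = Polynomial.smult e (P * g + r)" using kpoly_e[OF assms(2)] 1(1) by simp
  then have "f = P * Polynomial.smult e g + Polynomial.smult e r" by (simp add: smult_add_right)
  moreover have "Polynomial.smult e r \<in> kpoly_lt m"
    using 1(2) kmonic_degree[OF assms(1)] by (auto simp: kpoly_lt_def kpoly_smult_k e_in kpoly_0 coeff_eq_0)
  ultimately show ?thesis using that kpoly_smult_k[OF e_in] by blast
qed

section \<open>Irreducible polynomials over the field and their residue fields\<close>

definition kirr :: "nat \<Rightarrow> 'w poly set"
  where "kirr m = {P \<in> kmonic m. m > 0 \<and> (\<forall>d g. 0 < d \<longrightarrow> d < m \<longrightarrow> g \<in> kmonic d \<longrightarrow> \<not> g dvd P)}"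

lemma kirr_kmonic: "P \<in> kirr m \<Longrightarrow> P \<in> kmonic m" and kirr_pos: "P \<in> kirr m \<Longrightarrow> m > 0"
  by (auto simp: kirr_def)

lemma kirr_not_dvd_e: assumes "P \<in> kirr m" shows "\<not> P dvd [:e:]"
  using kmonic_dvd_degree[OF kirr_kmonic[OF assms], of "[:e:]"] kirr_pos[OF assms] e_nz by auto

text \<open>Bezout: the elements of \<open>kpoly\<close> congruent to a multiple of \<open>f\<close>
  modulo \<open>P\<close> form an ideal \<open>S\<close>. A nonzero element of least degree, made
  monic, divides all of \<open>S\<close> and \<open>P\<close>, so its degree is 0 or
  \<open>m\<close>; degree \<open>m\<close> would make \<open>P\<close> divide
  \<open>f\<close>.\<close>

lemma kirr_inverse:
  assumes P: "P \<in> kirr m" and f: "f \<in> kpoly" and nd: "\<not> P dvd f"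
  obtains u where "u \<in> kpoly" "P dvd u * f - [:e:]"
proof -
  have PV: "P \<in> kmonic m" using P by (rule kirr_kmonic)
  define S where "S = {g \<in> kpoly. \<exists>u\<in>kpoly. P dvd u * f - g}"
  have "f \<in> S" using f kpoly_e'[OF f] kpoly_const[OF e_in] unfolding S_def by (auto intro!: bexI[of _ "[:e:]"])
  moreover have "f \<noteq> 0" using nd by auto
  ultimately obtain g where g: "g \<in> S" "g \<noteq> 0" and mn: "\<And>h. h \<in> S \<Longrightarrow> h \<noteq> 0 \<Longrightarrow> degree g \<le> degree h"
    using ex_has_least_nat[of "\<lambda>h. h \<in> S \<and> h \<noteq> 0" f degree] by blast
  define D where "D = degree g"
  obtain ug where ug: "ug \<in> kpoly" "P dvd ug * f - g" using g unfolding S_def by blast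
  have gk: "g \<in> kpoly" using g unfolding S_def by blast
  define a where "a = lead_coeff g"
  have a: "a \<in> k" "a \<noteq> 0" using gk g(2) by (auto simp: a_def kpoly_def)
  obtain b where b: "b \<in> k" "a * b = e" using inv_in_k[OF a] by blast
  \<comment> \<open>\<open>b\<close> turns the leading coefficient into \<open>e\<close>, and the
    added monomial completes it to 1. Thus \<open>g1\<close> is monic for the ambient ring and
    agrees with \<open>b\<close> times \<open>g\<close> after projection by
    \<open>e\<close>.\<close>
  define g1 where "g1 = Polynomial.smult b g + Polynomial.monom (1 - e) D"
  have g1: "g1 \<in> kmonic D"
  proof (rule kmonicI)
    show "poly.coeff g1 i = 0" if "i > D" for i using that by (simp add: g1_def D_def coeff_eq_0)
    have "b * poly.coeff g D = e" using b by (simp add: a_def D_def mult.commute)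
    then show "poly.coeff g1 D = 1" by (simp add: g1_def)
    show "poly.coeff g1 i \<in> k" if "i < D" for i using that b by (simp add: g1_def mult_k')
  qed
  have e0: "e * (1 - e) = 0" by (simp add: right_diff_distrib e_idem)
  have eg1: "Polynomial.smult e g1 = Polynomial.smult b g"
    unfolding g1_def using kpoly_e[OF kpoly_smult[OF gk, of b]] e0 by (simp add: smult_add_right smult_monom)
  have dv: "g1 dvd h" if h: "h \<in> S" for h
  proof -
    have hk: "h \<in> kpoly" using h unfolding S_def by blast
    obtain uh where uh: "uh \<in> kpoly" "P dvd uh * f - h" using h unfolding S_def by blast
    obtain s r where sr: "h = g1 * s + r" "s \<in> kpoly" "r \<in> kpoly_lt D" using kmonic_division[OF g1 hk] .
    have "g1 * s = Polynomial.smult e g1 * s" using kpoly_e[OF sr(2)]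
      by (metis mult_smult_left mult_smult_right)
    then have r: "r = h - Polynomial.smult b s * g" using sr(1) eg1 by (simp add: mult.commute)
    have "(uh - Polynomial.smult b s * ug) * f - r
      = (uh * f - h) - Polynomial.smult b s * (ug * f - g)" by (simp add: r algebra_simps)
    moreover have "P dvd (uh * f - h) - Polynomial.smult b s * (ug * f - g)"
      by (rule dvd_diff[OF uh(2) dvd_mult[OF ug(2)]])
    ultimately have "r \<in> S" unfolding S_def using kpoly_ltD[OF sr(3)]
      by (auto intro!: bexI[of _ "uh - Polynomial.smult b s * ug"] kpoly_diff uh kpoly_mult ug)
    then have "r = 0" using mn[of r] kpoly_lt_degree[OF sr(3)] by (fastforce simp: D_def)
    then show ?thesis using sr(1) by simp
  qed
  \<comment> \<open>\<open>P\<close> belongs to the ideal with multiplier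
    \<open>u = 0\<close>.\<close>
  have "Polynomial.smult e P \<in> S" unfolding S_def using kmonic_e[OF PV]
    by (auto intro!: bexI[of _ 0] kpoly_0 dvd_smult)
  then have g1P: "g1 dvd P" using dv kmonic_dvd_smult_e[OF g1 PV] by blast
  obtain h where h: "D \<le> m" "h \<in> kmonic (m - D)" "P = g1 * h" using kmonic_dvd_obtain[OF g1 PV g1P] .
  have "D = 0 \<or> D = m" using P g1 g1P h(1) unfolding kirr_def by fastforce
  moreover have "D \<noteq> m"
  proof
    assume "D = m"
    then have "h = 1" using h(2) kmonic_0 by simp
    then have "P dvd f" using dv[OF \<open>f \<in> S\<close>] h(3) by simp
    then show False using nd by blast
  qed
  ultimately have "D = 0" by blast
  then have "g = [:a:]" unfolding a_def D_def by (metis degree_eq_zeroE lead_coeff_pCons(2))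
  then have "(Polynomial.smult b ug) * f - [:e:] = Polynomial.smult b (ug * f - g)"
    using b by (simp add: smult_diff_right mult.commute)
  then have "P dvd (Polynomial.smult b ug) * f - [:e:]" using ug by (simp add: dvd_smult)
  then show ?thesis using that kpoly_smult[OF ug(1)] by blast
qed

lemma kirr_prime:
  assumes P: "P \<in> kirr m" and f: "f \<in> kpoly" and g: "g \<in> kpoly" and d: "P dvd f * g"
  shows "P dvd f \<or> P dvd g"
proof (rule ccontr)
  assume H: "\<not> ?thesis"
  obtain u where u: "u \<in> kpoly" "P dvd u * f - [:e:]" using kirr_inverse[OF P f] H by blast
  have "g = u * (f * g) - (u * f - [:e:]) * g" using kpoly_e'[OF g] by (simp add: algebra_simps)
  moreover have "P dvd u * (f * g) - (u * f - [:e:]) * g" using dvd_diff[OF dvd_mult[OF d, of u] dvd_mult2[OF u(2), of g]] .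
  ultimately show False using H by auto
qed

lemma kirr_prime_power:
  assumes P: "P \<in> kirr m" and f: "f \<in> kpoly" and d: "P dvd f ^ n"
  shows "P dvd f"
  using d
proof (induction n)
  case 0
  then have "P dvd [:e:]" by simp (metis dvd_trans one_dvd)
  then show ?case using kirr_not_dvd_e[OF P] by simp
next
  case (Suc n)
  show ?case
  proof (cases "n = 0")
    case False
    then show ?thesis using Suc kirr_prime[OF P f kpoly_power[OF f]] by auto
  qed (use Suc in simp)
qed

lemma kirr_prime_kmonic:
  assumes P: "P \<in> kirr m" and f: "f \<in> kmonic a" and g: "g \<in> kmonic b" and d: "P dvd f * g"
  shows "P dvd f \<or> P dvd g"
proof -
  have "P dvd Polynomial.smult e f * Polynomial.smult e g" using d by (simp add: dvd_smult)
  then show ?thesis using kirr_prime[OF P kmonic_e[OF f] kmonic_e[OF g]]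
      kmonic_dvd_smult_e[OF kirr_kmonic[OF P]] f g by blast
qed

lemma kirr_factor_exists:
  assumes "h \<in> kmonic n" "n > 0"
  obtains m P where "P \<in> kirr m" "P dvd h"
proof -
  define Q where "Q = (\<lambda>m. m > 0 \<and> (\<exists>P\<in>kmonic m. P dvd h))"
  define m where "m = (LEAST m. Q m)"
  have "Q n" using assms by (auto simp: Q_def intro!: bexI[of _ h])
  then have m: "Q m" unfolding m_def by (rule LeastI)
  have mn: "\<not> Q d" if "d < m" for d using not_less_Least that unfolding m_def by blast
  obtain P where P: "P \<in> kmonic m" "P dvd h" "m > 0" using m unfolding Q_def by blast
  have "\<not> g dvd P" if "0 < d" "d < m" "g \<in> kmonic d" for d g
    using mn[OF that(2)] that(1,3) dvd_trans[of g P h] P(2) unfolding Q_def by blast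
  then have "P \<in> kirr m" using P unfolding kirr_def by blast
  then show ?thesis using that P by blast
qed

lemma kirr_dvd_kirr:
  assumes "P \<in> kirr m" "P' \<in> kirr m'" "P dvd P'" shows "P = P'" "m = m'"
proof -
  obtain g where g: "m \<le> m'" "g \<in> kmonic (m' - m)" "P' = P * g"
    using kmonic_dvd_obtain[OF kirr_kmonic[OF assms(1)] kirr_kmonic[OF assms(2)] assms(3)] .
  have "\<not> m < m'" using assms unfolding kirr_def by blast
  then show "m = m'" using g by simp
  then show "P = P'" using g kmonic_0 by simp
qed

end

section \<open>Prime factorisation, the von Mangoldt sum and Frobenius\<close>

text \<open>Modulo a prime ideal, a polynomial of degree below \<open>n\<close> with
  \<open>n\<close> distinct roots vanishes; one root is split off at a time. Membership in
  \<open>I\<close> replaces passing to the quotient ring. It serves for the annihilator of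
  \<open>e\<close> and for the residue field of an irreducible polynomial.\<close>

lemma coeffs_in_prime_ideal_of_roots:
  fixes I :: "'b::comm_ring_1 set" and g :: "'b poly"
  assumes I0: "0 \<in> I" and Iadd: "\<And>a b. a \<in> I \<Longrightarrow> b \<in> I \<Longrightarrow> a + b \<in> I"
    and Imult: "\<And>a c. a \<in> I \<Longrightarrow> c * a \<in> I"
    and Iprime: "\<And>a b. a * b \<in> I \<Longrightarrow> a \<in> I \<or> b \<in> I"
    and hi: "\<And>i. i \<ge> n \<Longrightarrow> poly.coeff g i \<in> I"
    and A: "finite A" "card A \<ge> n" "\<And>x y. x \<in> A \<Longrightarrow> y \<in> A \<Longrightarrow> x \<noteq> y \<Longrightarrow> x - y \<notin> I"
    and roots: "\<And>x. x \<in> A \<Longrightarrow> poly g x \<in> I"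
  shows "poly.coeff g i \<in> I"
  using hi A roots
proof (induction n arbitrary: g A i)
  case (Suc n)
  obtain x where x: "x \<in> A" using Suc.prems(2,3) by fastforce
  define h where "h = synthetic_div g x"
  have g: "g = [:-x, 1:] * h + [:poly g x:]" using synthetic_div_correct'[of x g] by (simp add: h_def)
  have neg: "- a \<in> I" if "a \<in> I" for a using Imult[OF that, of "-1"] by simp
  have c: "poly.coeff g (Suc i) = poly.coeff h i - x * poly.coeff h (Suc i)" for i
    by (subst g) (simp add: coeff_pCons)
  \<comment> \<open>Descending induction from \<open>degree h + 1\<close>, where the coefficient is
    0: modulo \<open>I\<close> each coefficient of \<open>h\<close> is determined by the next one
    through \<open>c\<close>.\<close>
  have hn: "poly.coeff h i \<in> I" if "i \<ge> n" for i
  proof (cases "i > degree h")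
    case True then show ?thesis using I0 by (simp add: coeff_eq_0)
  next
    case False
    then have "i \<le> Suc (degree h)" by simp
    then show ?thesis using that
    proof (induction rule: inc_induct)
      case base then show ?case using I0 by (simp add: coeff_eq_0)
    next
      case (step j)
      have "poly.coeff g (Suc j) + x * poly.coeff h (Suc j) \<in> I"
        using step Suc.prems(1)[of "Suc j"] by (intro Iadd Imult) auto
      then show ?case using c[of j] by simp
    qed
  qed
  have hr: "poly h y \<in> I" if "y \<in> A - {x}" for y
  proof -
    have "poly g y = (y - x) * poly h y + poly g x" by (subst g) (simp add: algebra_simps)
    then have "(y - x) * poly h y = poly g y + - poly g x" by simp
    then have "(y - x) * poly h y \<in> I" using that x Suc.prems(5) neg Iadd by (metis DiffD1)
    then show ?thesis using Iprime Suc.prems(4)[of y x] that x by blast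
  qed
  have hc: "poly.coeff h i \<in> I" for i
    by (rule Suc.IH[of h "A - {x}"]) (use hn hr Suc.prems x in auto)
  show ?case
  proof (cases i)
    case 0
    have "poly.coeff g 0 = - (x * poly.coeff h 0) + poly g x" by (subst g) simp
    then show ?thesis using 0 hc Imult neg Iadd Suc.prems(5)[OF x] by metis
  next
    case (Suc j)
    have "poly.coeff g (Suc j) = poly.coeff h j + - (x * poly.coeff h (Suc j))" using c by simp
    then show ?thesis using Suc hc Imult neg Iadd by metis
  qed
qed auto

lemma prod_dvd_diff:
  fixes f g :: "'c \<Rightarrow> 'b::comm_ring_1"
  assumes "\<And>x. x \<in> A \<Longrightarrow> p dvd f x - g x"
  shows "p dvd prod f A - prod g A"
  using assms
proof (induction A rule: infinite_finite_induct)
  case (insert x A)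
  have "prod f (insert x A) - prod g (insert x A) = (f x - g x) * prod f A + g x * (prod f A - prod g A)"
    using insert by (simp add: algebra_simps)
  then show ?case using insert by simp
qed auto

lemma power_dvd_diff:
  fixes a b :: "'b::comm_ring_1"
  assumes "p dvd a - b" shows "p dvd a ^ n - b ^ n"
  using prod_dvd_diff[of "{..<n}" p "\<lambda>_. a" "\<lambda>_. b"] assms by simp

context field_ideal
begin

section \<open>Unique factorisation of monic polynomials\<close>

definition kirrs :: "'w poly set" where "kirrs = (\<Union>m. kirr m)"

lemma kirrs_iff: "P \<in> kirrs \<longleftrightarrow> P \<in> kirr (degree P)"
  unfolding kirrs_def using kirr_kmonic kmonic_degree by blast

lemma kmonic_cancel:
  assumes "P \<in> kmonic m" "P * a = P * b" shows "a = b"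
proof -
  have "P * (a - b) = 0" using assms(2) by (simp add: right_diff_distrib)
  then show ?thesis using monic_degree_mult(3)[of P "a - b"] kmonic_lead[OF assms(1)] by auto
qed

lemma kmonic_cancel_dvd:
  assumes "P \<in> kmonic m" shows "P * a dvd P * b \<longleftrightarrow> a dvd b"
proof
  assume "P * a dvd P * b"
  then obtain c where "P * b = P * (a * c)" by (auto simp: mult.assoc)
  then have "b = a * c" by (rule kmonic_cancel[OF assms])
  then show "a dvd b" by simp
qed (simp add: mult_dvd_mono)

lemma kirr_power_dvd_cancel:
  assumes "P \<in> kirrs" "P0 \<in> kirrs" "P \<noteq> P0" "g \<in> kmonic n" "P ^ r dvd P0 * g"
  shows "P ^ r dvd g"
  using assms(4,5)
proof (induction r arbitrary: g n)
  case (Suc r)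
  have P: "P \<in> kirr (degree P)" "P0 \<in> kirr (degree P0)" using assms by (auto simp: kirrs_iff)
  have "P dvd P0 * g" using Suc.prems(2) by (metis dvd_trans dvd_triv_left power_Suc)
  moreover have "\<not> P dvd P0" using kirr_dvd_kirr[OF P] assms(3) by blast
  ultimately have "P dvd g" using kirr_prime_kmonic[OF P(1) kirr_kmonic[OF P(2)] Suc.prems(1)] by blast
  then obtain g' where g': "g' \<in> kmonic (n - degree P)" "g = P * g'"
    using kmonic_dvd_obtain[OF kirr_kmonic[OF P(1)] Suc.prems(1)] by blast
  have "P * P ^ r dvd P * (P0 * g')" using Suc.prems(2) g' by (simp add: mult.left_commute)
  then have "P ^ r dvd g'" using Suc.IH[OF g'(1)] kmonic_cancel_dvd[OF kirr_kmonic[OF P(1)]] by blast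
  then show ?case using g' by (simp add: mult_dvd_mono)
qed simp

definition prime_power_divisors :: "'w poly \<Rightarrow> ('w poly \<times> nat) set"
  where "prime_power_divisors h = {(P, r). P \<in> kirrs \<and> r > 0 \<and> P ^ r dvd h}"

lemma power_dvd_kmonic_bound:
  assumes "P \<in> kirrs" "h \<in> kmonic n" "P ^ r dvd h" shows "r * degree P \<le> n" "r \<le> n" 
proof -
  have P: "P \<in> kirr (degree P)" using assms by (auto simp: kirrs_iff)
  show 1: "r * degree P \<le> n"
    using kmonic_dvd_degree[OF kmonic_power[OF kirr_kmonic[OF P]] assms(3) kmonic_nz[OF assms(2)]]
      kmonic_degree[OF assms(2)] by simp
  have "r * 1 \<le> r * degree P" using kirr_pos[OF P] by (intro mult_le_mono) auto
  then show "r \<le> n" using 1 by linarith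
qed

text \<open>Unique factorisation in additive form. If \<open>h = P * g\<close> with \<open>P\<close>
  irreducible of multiplicity \<open>v\<close> in \<open>g\<close>, then \<open>h\<close> has
  exactly one prime power divisor more than \<open>g\<close>, namely the pair
  \<open>(P, Suc v)\<close>.\<close>

lemma sum_prime_power_divisors:
  assumes "h \<in> kmonic n"
  shows "finite (prime_power_divisors h) \<and> (\<Sum>(P, r)\<in>prime_power_divisors h. degree P) = n"
  using assms
proof (induction n arbitrary: h rule: less_induct)
  case (less n)
  show ?case
  proof (cases "n = 0")
    case True
    have "prime_power_divisors h = {}"
      using power_dvd_kmonic_bound(2)[OF _ less.prems] True by (force simp: prime_power_divisors_def)
    then show ?thesis using True by simp
  next
    case False
    have "n > 0" using False by simp
    then have "\<exists>m. \<exists>P\<in>kirr m. P dvd h" using kirr_factor_exists[OF less.prems] by metis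
    then obtain m P where P: "P \<in> kirr m" "P dvd h" by blast
    have PV: "P \<in> kmonic m" "m > 0" "degree P = m" using P kirr_kmonic kirr_pos kmonic_degree by blast+
    have Pk: "P \<in> kirrs" using P by (auto simp: kirrs_def)
    obtain g where g: "m \<le> n" "g \<in> kmonic (n - m)" "h = P * g"
      using kmonic_dvd_obtain[OF PV(1) less.prems P(2)] .
    have IH: "finite (prime_power_divisors g)" "(\<Sum>(P, r)\<in>prime_power_divisors g. degree P) = n - m"
      using less.IH[OF _ g(2)] PV False by auto
    define v where "v = (GREATEST r. P ^ r dvd g)"
    have bnd: "r \<le> n - m" if "P ^ r dvd g" for r using power_dvd_kmonic_bound(2)[OF Pk g(2) that] .
    have v: "P ^ v dvd g" unfolding v_def by (rule GreatestI_nat[of _ 0]) (use bnd in auto)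
    have vmax: "r \<le> v" if "P ^ r dvd g" for r unfolding v_def by (rule Greatest_le_nat) (use bnd that in auto)
    have viff: "P ^ r dvd g \<longleftrightarrow> r \<le> v" for r using v vmax by (meson dvd_trans le_imp_power_dvd)
    have Piff: "P ^ Suc r dvd h \<longleftrightarrow> r \<le> v" for r
      using kmonic_cancel_dvd[OF PV(1), of "P ^ r" g] viff g(3) by simp
    have eq: "prime_power_divisors h = insert (P, Suc v) (prime_power_divisors g)"
    proof (intro Set.set_eqI)
      fix x :: "'w poly \<times> nat"
      obtain P' r where x: "x = (P', r)" by (cases x)
      show "x \<in> prime_power_divisors h \<longleftrightarrow> x \<in> insert (P, Suc v) (prime_power_divisors g)"
      proof (cases "P' = P")
        case True
        then show ?thesis using x viff Piff Pk by (cases r) (auto simp: prime_power_divisors_def simp del: power_Suc)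
      next
        case ne: False
        have "P' ^ r dvd h \<longleftrightarrow> P' ^ r dvd g" if "P' \<in> kirrs"
          using kirr_power_dvd_cancel[OF that Pk ne g(2)] g(3) by auto
        then show ?thesis using x ne by (auto simp: prime_power_divisors_def)
      qed
    qed
    have "(P, Suc v) \<notin> prime_power_divisors g" using viff by (auto simp: prime_power_divisors_def simp del: power_Suc)
    then show ?thesis using eq IH PV g(1) by simp
  qed
qed

text \<open>Counted with weight \<open>degree P\<close>, these pairs stand for the points of the
  extension of degree \<open>n\<close>: an irreducible polynomial of degree \<open>m\<close>
  dividing \<open>n\<close> represents \<open>m\<close> conjugate points, and
  \<open>r = n / m\<close>.\<close>

definition prime_powers :: "nat \<Rightarrow> ('w poly \<times> nat) set"
  where "prime_powers n = {(P, r). P \<in> kirrs \<and> r > 0 \<and> r * degree P = n}"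

lemma finite_prime_powers: "finite (prime_powers n)"
proof (rule finite_subset)
  show "prime_powers n \<subseteq> (\<Union>m\<le>n. kmonic m) \<times> {..n}"
  proof
    fix x assume "x \<in> prime_powers n"
    then obtain P r where x: "x = (P, r)" "P \<in> kirr (degree P)" "r > 0" "r * degree P = n"
      by (auto simp: prime_powers_def kirrs_iff)
    have "degree P > 0" using kirr_pos x by blast
    then have "r \<le> n" "degree P \<le> n" using x by auto
    then show "x \<in> (\<Union>m\<le>n. kmonic m) \<times> {..n}" using x kirr_kmonic by auto
  qed
  show "finite ((\<Union>m\<le>n. kmonic m) \<times> {..n})" using finite_kmonic by auto
qed

section \<open>L-series of multiplicative functions and their von Mangoldt sums\<close>

definition char_sum :: "('w poly \<Rightarrow> complex) \<Rightarrow> nat \<Rightarrow> complex"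
  where "char_sum \<theta> n = (\<Sum>h\<in>kmonic n. \<theta> h)"

definition mangoldt_sum :: "('w poly \<Rightarrow> complex) \<Rightarrow> nat \<Rightarrow> complex"
  where "mangoldt_sum \<theta> n = (\<Sum>(P, r)\<in>prime_powers n. of_nat (degree P) * \<theta> (P ^ r))"

text \<open>The coefficient form of T L'(T) = L(T) S(T), where S is the series of von Mangoldt sums.
  The factor \<open>n\<close> is written as the sum of the degrees over the prime power divisors of
  \<open>h\<close>; then the summations are exchanged and \<open>h\<close> becomes
  \<open>P ^ r * g\<close>.\<close>

lemma mangoldt_convolution:
  assumes mult: "\<And>f g n m. f \<in> kmonic n \<Longrightarrow> g \<in> kmonic m \<Longrightarrow> \<theta> (f * g) = \<theta> f * \<theta> g"
  shows "of_nat n * char_sum \<theta> n = (\<Sum>j=1..n. mangoldt_sum \<theta> j * char_sum \<theta> (n - j))"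
proof -
  define I where "I = (\<Union>j\<in>{1..n}. prime_powers j)"
  have finI: "finite I" unfolding I_def using finite_prime_powers by auto
  have "of_nat n * char_sum \<theta> n = (\<Sum>h\<in>kmonic n. \<Sum>(P, r)\<in>prime_power_divisors h. of_nat (degree P) * \<theta> h)"
  proof -
    have "of_nat n * \<theta> h = (\<Sum>(P, r)\<in>prime_power_divisors h. of_nat (degree P) * \<theta> h)" if "h \<in> kmonic n" for h
    proof -
      have "of_nat n = (of_nat (\<Sum>(P, r)\<in>prime_power_divisors h. degree P) :: complex)"
        using sum_prime_power_divisors[OF that] by simp
      then show ?thesis by (simp add: sum_distrib_right case_prod_beta)
    qed
    then show ?thesis by (simp add: char_sum_def sum_distrib_left)
  qed
  also have "\<dots> = (\<Sum>h\<in>kmonic n. \<Sum>x\<in>I. if fst x ^ snd x dvd h then of_nat (degree (fst x)) * \<theta> h else 0)"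
  proof (rule sum.cong[OF refl])
    fix h assume h: "h \<in> kmonic n"
    have "x \<in> prime_power_divisors h \<longleftrightarrow> x \<in> {x \<in> I. fst x ^ snd x dvd h}" for x
    proof -
      obtain P r where x: "x = (P, r)" by (cases x)
      have "1 \<le> r * degree P \<and> r * degree P \<le> n" if "P \<in> kirrs" "r > 0" "P ^ r dvd h"
        using power_dvd_kmonic_bound(1)[OF that(1) h that(3)] that kirr_pos[of P "degree P"]
        by (auto simp: kirrs_iff Suc_le_eq)
      then show ?thesis
        by (auto simp: x prime_power_divisors_def I_def prime_powers_def)
    qed
    then have "prime_power_divisors h = {x \<in> I. fst x ^ snd x dvd h}" by blast
    then show "(\<Sum>(P, r)\<in>prime_power_divisors h. of_nat (degree P) * \<theta> h)
      = (\<Sum>x\<in>I. if fst x ^ snd x dvd h then of_nat (degree (fst x)) * \<theta> h else 0)"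
      by (simp add: sum.If_cases[OF finI] Int_def case_prod_beta)
  qed
  also have "\<dots> = (\<Sum>x\<in>I. \<Sum>h\<in>kmonic n. if fst x ^ snd x dvd h then of_nat (degree (fst x)) * \<theta> h else 0)"
    by (rule sum.swap)
  also have "\<dots> = (\<Sum>x\<in>I. of_nat (degree (fst x)) * \<theta> (fst x ^ snd x) * char_sum \<theta> (n - snd x * degree (fst x)))"
  proof (rule sum.cong[OF refl])
    fix x assume "x \<in> I"
    then obtain P r where x: "x = (P, r)" "P \<in> kirrs" "r > 0" "r * degree P \<le> n"
      by (auto simp: I_def prime_powers_def)
    have PV: "P ^ r \<in> kmonic (r * degree P)" using x kirr_kmonic kmonic_power by (auto simp: kirrs_iff)
    have eq: "{h \<in> kmonic n. P ^ r dvd h} = (\<lambda>g. P ^ r * g) ` kmonic (n - r * degree P)"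
    proof (intro equalityI subsetI)
      fix h assume "h \<in> {h \<in> kmonic n. P ^ r dvd h}"
      then show "h \<in> (\<lambda>g. P ^ r * g) ` kmonic (n - r * degree P)"
        using kmonic_dvd_obtain[OF PV, of h n] by blast
    next
      fix h assume "h \<in> (\<lambda>g. P ^ r * g) ` kmonic (n - r * degree P)"
      then show "h \<in> {h \<in> kmonic n. P ^ r dvd h}" using kmonic_mult[OF PV] x(4) by fastforce
    qed
    have inj: "inj_on (\<lambda>g. P ^ r * g) (kmonic (n - r * degree P))"
      using kmonic_cancel[OF PV] by (auto simp: inj_on_def)
    have "(\<Sum>h\<in>kmonic n. if P ^ r dvd h then of_nat (degree P) * \<theta> h else 0)
       = (\<Sum>h\<in>{h \<in> kmonic n. P ^ r dvd h}. of_nat (degree P) * \<theta> h)"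
      by (simp add: sum.If_cases[OF finite_kmonic] Int_def)
    also have "\<dots> = (\<Sum>g\<in>kmonic (n - r * degree P). of_nat (degree P) * \<theta> (P ^ r * g))"
      unfolding eq using sum.reindex[OF inj] by simp
    also have "\<dots> = (\<Sum>g\<in>kmonic (n - r * degree P). of_nat (degree P) * (\<theta> (P ^ r) * \<theta> g))"
      using mult[OF PV] by (intro sum.cong) auto
    finally show "(\<Sum>h\<in>kmonic n. if fst x ^ snd x dvd h then of_nat (degree (fst x)) * \<theta> h else 0)
      = of_nat (degree (fst x)) * \<theta> (fst x ^ snd x) * char_sum \<theta> (n - snd x * degree (fst x))"
      unfolding x(1) fst_conv snd_conv char_sum_def sum_distrib_left mult.assoc .
  qed
  also have "\<dots> = (\<Sum>j=1..n. \<Sum>x\<in>prime_powers j. of_nat (degree (fst x)) * \<theta> (fst x ^ snd x) * char_sum \<theta> (n - snd x * degree (fst x)))"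
    unfolding I_def by (rule sum.UNION_disjoint) (auto simp: finite_prime_powers, auto simp: prime_powers_def)
  also have "\<dots> = (\<Sum>j=1..n. mangoldt_sum \<theta> j * char_sum \<theta> (n - j))"
    by (intro sum.cong refl) (auto simp: mangoldt_sum_def sum_distrib_right prime_powers_def intro!: sum.cong)
  finally show ?thesis .
qed

text \<open>The convolution identity for the constant function 1, where L is the geometric series of
  q T. By induction the first \<open>n - 1\<close> terms contribute \<open>q ^ n\<close> each, which
  leaves \<open>q ^ n\<close> for the last.\<close>

lemma sum_degree_prime_powers: "n > 0 \<Longrightarrow> (\<Sum>(P, r)\<in>prime_powers n. degree P) = q ^ n"
proof (induction n rule: less_induct)
  case (less n)
  have M: "mangoldt_sum (\<lambda>_. 1) j = of_nat (\<Sum>(P, r)\<in>prime_powers j. degree P)" for j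
    by (simp add: mangoldt_sum_def case_prod_beta)
  have a: "char_sum (\<lambda>_. 1) j = of_nat q ^ j" for j by (simp add: char_sum_def card_kmonic)
  have "of_nat n * (of_nat q :: complex) ^ n = (\<Sum>j=1..n. mangoldt_sum (\<lambda>_. 1) j * of_nat q ^ (n - j))"
    using mangoldt_convolution[of "\<lambda>_. 1" n] by (simp add: a)
  also have "\<dots> = (\<Sum>j\<in>{1..n} - {n}. mangoldt_sum (\<lambda>_. 1) j * of_nat q ^ (n - j)) + mangoldt_sum (\<lambda>_. 1) n"
    using less.prems by (subst sum.remove[of _ n]) auto
  also have "(\<Sum>j\<in>{1..n} - {n}. mangoldt_sum (\<lambda>_. 1) j * of_nat q ^ (n - j)) = (\<Sum>j\<in>{1..n} - {n}. (of_nat q :: complex) ^ n)"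
    using less.IH by (intro sum.cong refl) (auto simp: M power_add[symmetric])
  also have "\<dots> = (of_nat n - 1) * of_nat q ^ n" using less.prems by (simp add: of_nat_diff)
  finally have "mangoldt_sum (\<lambda>_. 1) n = of_nat q ^ n" by (simp add: algebra_simps)
  then have "of_nat (\<Sum>(P, r)\<in>prime_powers n. degree P) = (of_nat (q ^ n) :: complex)" by (simp only: M) simp
  then show ?case by (simp only: of_nat_eq_iff)
qed

section \<open>Fermat's theorem and the Frobenius map\<close>

lemma kirr_dvd_prod:
  assumes "P \<in> kirr m" "finite A" "\<And>x. x \<in> A \<Longrightarrow> f x \<in> kpoly" "A \<noteq> {}" "P dvd prod f A"
  shows "\<exists>x\<in>A. P dvd f x"
  using assms(2,4,3,5)
proof (induction A rule: finite_ne_induct)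
  case (insert x A)
  have "prod f A \<in> kpoly"
  proof -
    obtain y where "y \<in> A" using insert by blast
    then have "prod f A = f y * prod f (A - {y})" using insert by (simp add: prod.remove)
    then show ?thesis using insert \<open>y \<in> A\<close> by (simp add: kpoly_mult')
  qed
  then have "P dvd f x \<or> P dvd prod f A" using kirr_prime[OF assms(1)] insert by simp
  then show ?case using insert by blast
qed auto

lemma kpoly_lt_dvd_zero:
  assumes "P \<in> kmonic m" "r \<in> kpoly_lt m" "P dvd r" shows "r = 0"
  using kmonic_dvd_degree[OF assms(1,3)] kpoly_lt_degree[OF assms(2)] by fastforce

text \<open>Multiplication by \<open>f\<close> permutes the nonzero residues modulo
  \<open>P\<close>, represented by \<open>A\<close>. Comparing the products over all residues and
  cancelling \<open>\<Prod>A\<close>, which is prime to \<open>P\<close>, gives the exponent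
  \<open>q ^ m - 1\<close>.\<close>

lemma kirr_fermat:
  assumes P: "P \<in> kirr m" and f: "f \<in> kpoly"
  shows "P dvd f ^ (q ^ m) - f"
proof (cases "P dvd f")
  case True
  have "q ^ m > 0" using q_ge_2 by simp
  then show ?thesis using True by (intro dvd_diff) (auto intro: dvd_trans[OF _ dvd_power])
next
  case False
  have PV: "P \<in> kmonic m" using P by (rule kirr_kmonic)
  define A where "A = kpoly_lt m - {0}"
  have finA: "finite A" and cA: "card A = q ^ m - 1"
    using finite_kpoly_lt card_kpoly_lt unfolding A_def by (auto simp: card_Diff_singleton kpoly_lt_def kpoly_0)
  have "\<exists>s\<in>kpoly_lt m. P dvd f * r - s" for r
    using kmonic_division[OF PV kpoly_mult'[OF f, of r]] by (metis add_diff_cancel_right' dvd_triv_left)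
  then obtain \<phi> where \<phi>: "\<And>r. \<phi> r \<in> kpoly_lt m" "\<And>r. P dvd f * r - \<phi> r" by metis
  have nz: "\<phi> r \<noteq> 0" if "r \<in> A" for r
  proof
    assume "\<phi> r = 0"
    then have "P dvd f * r" using \<phi>(2)[of r] by simp
    then have "P dvd r" using kirr_prime[OF P f] that False by (auto simp: A_def kpoly_lt_def)
    then show False using kpoly_lt_dvd_zero[OF PV] that by (auto simp: A_def)
  qed
  have inj: "inj_on \<phi> A"
  proof (rule inj_onI)
    fix r s assume rs: "r \<in> A" "s \<in> A" "\<phi> r = \<phi> s"
    have "f * (r - s) = (f * r - \<phi> r) - (f * s - \<phi> s)" using rs by (simp add: algebra_simps)
    then have "P dvd f * (r - s)" using \<phi> by simp
    moreover have "r - s \<in> kpoly_lt m" using rs by (auto simp: A_def kpoly_lt_def kpoly_diff)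
    ultimately have "r - s = 0" using kirr_prime[OF P f] False kpoly_lt_dvd_zero[OF PV] kpoly_ltD by blast
    then show "r = s" by simp
  qed
  have "\<phi> ` A = A" by (rule endo_inj_surj[OF finA _ inj]) (use \<phi> nz in \<open>auto simp: A_def\<close>)
  then have "(\<Prod>r\<in>A. \<phi> r) = \<Prod>A" using prod.reindex[OF inj, of "\<lambda>x. x"] by simp
  moreover have "P dvd (\<Prod>r\<in>A. f * r) - (\<Prod>r\<in>A. \<phi> r)" by (rule prod_dvd_diff) (rule \<phi>)
  moreover have "(\<Prod>r\<in>A. f * r) = f ^ (q ^ m - 1) * \<Prod>A" by (simp add: prod.distrib cA)
  ultimately have d: "P dvd f ^ (q ^ m - 1) * \<Prod>A - \<Prod>A" by simp
  have eA: "[:e:] \<in> A" using kirr_pos[OF P] e_nz by (auto simp: A_def kpoly_lt_def kpoly_const e_in coeff_pCons split: nat.split)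
  have "\<Prod>A = [:e:] * \<Prod>(A - {[:e:]})" using eA finA by (simp add: prod.remove)
  then have Ak: "\<Prod>A \<in> kpoly" using kpoly_mult'[OF kpoly_const[OF e_in]] by metis
  have N: "q ^ m - 1 > 0" using cA eA finA by (metis card_gt_0_iff empty_iff)
  have "f ^ (q ^ m - 1) * \<Prod>A - \<Prod>A = (f ^ (q ^ m - 1) - [:e:]) * \<Prod>A" using kpoly_e[OF Ak] by (simp add: left_diff_distrib)
  then have "P dvd (f ^ (q ^ m - 1) - [:e:]) \<or> P dvd \<Prod>A"
    using d kirr_prime[OF P _ Ak] kpoly_diff[OF kpoly_power[OF f N] kpoly_const[OF e_in]] by metis
  moreover have "\<not> P dvd \<Prod>A"
  proof
    assume "P dvd \<Prod>A"
    then obtain x where "x \<in> A" "P dvd x"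
      using kirr_dvd_prod[OF P finA, of "\<lambda>x. x"] eA kpoly_ltD unfolding A_def by blast
    then show False using kpoly_lt_dvd_zero[OF PV, of x] by (auto simp: A_def)
  qed
  ultimately have "P dvd f * (f ^ (q ^ m - 1) - [:e:])" by simp
  moreover have "Suc (q ^ m - 1) = q ^ m" using N by linarith
  then have "f * f ^ (q ^ m - 1) = f ^ (q ^ m)" by (metis power_Suc)
  moreover have "f * [:e:] = f" using kpoly_e[OF f] by simp
  ultimately show ?thesis by (simp only: right_diff_distrib)
qed

lemma kirr_fermat_iter:
  assumes P: "P \<in> kirr m" and f: "f \<in> kpoly"
  shows "P dvd f ^ (q ^ (m * r)) - f"
proof (induction r)
  case (Suc r)
  have "P dvd (f ^ (q ^ (m * r))) ^ (q ^ m) - f ^ (q ^ m)" using Suc by (rule power_dvd_diff)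
  then have "P dvd ((f ^ (q ^ (m * r))) ^ (q ^ m) - f ^ (q ^ m)) + (f ^ (q ^ m) - f)"
    using kirr_fermat[OF P f] by (rule dvd_add)
  then show ?case by (simp add: power_mult[symmetric] power_add[symmetric] add.commute)
qed simp

lemma X_kirr: "[:0, 1:] \<in> kirr 1"
proof -
  have "[:0, 1:] \<in> kmonic 1" by (rule kmonicI) (auto simp: zero_k coeff_pCons split: nat.split)
  then show ?thesis by (auto simp: kirr_def)
qed

text \<open>Fermat modulo the irreducible polynomial T, whose residue field is \<open>k\<close>; the
  congruence is evaluated at 0.\<close>

lemma k_fermat: assumes "a \<in> k" shows "a ^ q = a"
proof -
  have "[:0, 1:] dvd [:a:] ^ (q ^ 1) - [:a:]" using kirr_fermat[OF X_kirr kpoly_const[OF assms]] .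
  then obtain g where "[:a:] ^ q - [:a:] = [:0, 1:] * g" by auto
  then have "poly ([:a:] ^ q - [:a:]) 0 = 0" by (metis mult_zero_left poly_mult poly_pCons poly_0 add_0)
  then show ?thesis by simp
qed

lemma k_fermat_iter: "a \<in> k \<Longrightarrow> a ^ (q ^ r) = a"
  by (induction r) (simp_all add: k_fermat power_mult mult.commute)

text \<open>The annihilator of \<open>e\<close> is a prime ideal, and distinct elements of
  \<open>k\<close> stay distinct modulo it.\<close>

lemma k_roots_zero:
  assumes "\<And>i. i \<ge> n \<Longrightarrow> poly.coeff g i = 0" "A \<subseteq> k" "card A \<ge> n" "\<And>x. x \<in> A \<Longrightarrow> poly g x = 0"
    and "g \<in> kpoly"
  shows "g = 0"
proof -
  have "poly.coeff g i \<in> {w. e * w = 0}" for i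
  proof (rule coeffs_in_prime_ideal_of_roots[where n = n and A = A])
    show "a \<in> {w. e * w = 0} \<or> b \<in> {w. e * w = 0}" if "a * b \<in> {w. e * w = 0}" for a b
    proof -
      have "(e * a) * (e * b) = e * (a * b)" using e_idem by (metis mult.assoc mult.left_commute)
      then show ?thesis using that mult_zero_k[of "e * a" "e * b"] mult_k'[OF e_in] by auto
    qed
    show "finite A" using assms(2) finite_k finite_subset by blast
    show "x - y \<notin> {w. e * w = 0}" if "x \<in> A" "y \<in> A" "x \<noteq> y" for x y
    proof -
      have "e * (x - y) = x - y" using that assms(2) by (intro e_mult diff_k) auto
      then show ?thesis using that by simp
    qed
    show "c * a \<in> {w. e * w = 0}" if "a \<in> {w. e * w = 0}" for a c
      using that by (simp add: mult.left_commute[of e c a])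
  qed (use assms in \<open>auto simp: distrib_left\<close>)
  then show ?thesis using kpoly_e[OF assms(5)] by (metis (mono_tags, lifting) coeff_0 coeff_smult mem_Collect_eq poly_eqI)
qed

text \<open>The polynomial (x + e)^q - x^q - e^q has degree below \<open>q\<close> and vanishes at
  all \<open>q\<close> elements of \<open>k\<close> by Fermat, so its coefficients vanish. In this
  way the additivity of Frobenius precedes the fact that \<open>q\<close> is a prime power.\<close>

lemma binomial_q_zero: assumes "0 < i" "i < q" shows "of_nat (q choose i) * e = 0"
proof -
  define g where "g = (\<Sum>i\<in>{0<..<q}. Polynomial.monom (of_nat (q choose i) * e) i)"
  have c: "poly.coeff g i = (if 0 < i \<and> i < q then of_nat (q choose i) * e else 0)" for i
    by (simp add: g_def coeff_sum)
  have "g = 0"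
  proof (rule k_roots_zero[where n = q and A = k])
    show "g \<in> kpoly" by (simp add: kpoly_def c mult_k e_in zero_k)
    fix x assume x: "x \<in> k"
    have "(x + e) ^ q = x + e" using k_fermat add_k x e_in by blast
    also have "(x + e) ^ q = (\<Sum>i\<le>q. of_nat (q choose i) * x ^ i * e ^ (q - i))" by (rule binomial_ring)
    also have "{..q} = insert 0 (insert q {0<..<q})" using q_ge_2 by auto
    also have "(\<Sum>i\<in>insert 0 (insert q {0<..<q}). of_nat (q choose i) * x ^ i * e ^ (q - i))
      = e ^ q + (x ^ q + (\<Sum>i\<in>{0<..<q}. of_nat (q choose i) * x ^ i * e ^ (q - i)))"
      using q_ge_2 by simp
    finally have "(\<Sum>i\<in>{0<..<q}. of_nat (q choose i) * x ^ i * e ^ (q - i)) = 0"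
      using k_fermat[OF x] k_fermat[OF e_in] by simp
    moreover have "e ^ j = e" if "j > 0" for j
      using that by (induction j rule: nat_induct_non_zero) (auto simp: e_idem)
    ultimately show "poly g x = 0" by (simp add: g_def poly_sum poly_monom mult.commute mult.left_commute)
  qed (auto simp: c q_def)
  then show ?thesis using c[of i] assms by simp
qed

lemma frobenius_add: assumes "a \<in> kpoly" "b \<in> kpoly" shows "(a + b) ^ q = a ^ q + b ^ q"
proof -
  have z: "of_nat (q choose i) * a ^ i * b ^ (q - i) = 0" if "i \<in> {0<..<q}" for i
  proof -
    have "of_nat (q choose i) * a ^ i = of_nat (q choose i) * ([:e:] * a ^ i)"
      using kpoly_e'[OF kpoly_power[OF assms(1)]] that by simp
    also have "\<dots> = [:of_nat (q choose i) * e:] * a ^ i" by (simp add: of_nat_poly mult.commute)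
    also have "\<dots> = 0" using binomial_q_zero[of i] that by simp
    finally show ?thesis by simp
  qed
  have "(a + b) ^ q = (\<Sum>i\<le>q. of_nat (q choose i) * a ^ i * b ^ (q - i))" by (rule binomial_ring)
  also have "{..q} = insert 0 (insert q {0<..<q})" using q_ge_2 by auto
  also have "(\<Sum>i\<in>insert 0 (insert q {0<..<q}). of_nat (q choose i) * a ^ i * b ^ (q - i))
    = b ^ q + (a ^ q + (\<Sum>i\<in>{0<..<q}. of_nat (q choose i) * a ^ i * b ^ (q - i)))"
    using q_ge_2 by simp
  also have "(\<Sum>i\<in>{0<..<q}. of_nat (q choose i) * a ^ i * b ^ (q - i)) = 0" by (intro sum.neutral ballI z)
  finally show ?thesis by simp
qed

lemma frobenius_add_iter: assumes "a \<in> kpoly" "b \<in> kpoly" shows "(a + b) ^ (q ^ r) = a ^ (q ^ r) + b ^ (q ^ r)"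
proof (induction r)
  case (Suc r)
  have p: "x ^ (q ^ Suc r) = (x ^ (q ^ r)) ^ q" for x :: "'w poly" by (simp add: power_mult[symmetric] mult.commute)
  have "q ^ r > 0" using q_ge_2 by simp
  then show ?case unfolding p using Suc frobenius_add kpoly_power assms by simp
qed simp

lemma frobenius_sum:
  assumes "\<And>i. i \<in> A \<Longrightarrow> f i \<in> kpoly" shows "(sum f A) ^ (q ^ r) = (\<Sum>i\<in>A. f i ^ (q ^ r))"
proof -
  have "q ^ r > 0" using q_ge_2 by simp
  then show ?thesis using assms
    by (induction A rule: infinite_finite_induct) (simp_all add: frobenius_add_iter kpoly_sum power_0_left)
qed

text \<open>The coefficients lie in \<open>k\<close> and are fixed by the power map, so only the
  variable is raised to the power \<open>q ^ r\<close>.\<close>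

lemma frobenius_poly:
  assumes "f \<in> kpoly" shows "f ^ (q ^ r) = pcompose f (Polynomial.monom 1 (q ^ r))"
proof -
  have "f ^ (q ^ r) = (\<Sum>i\<le>degree f. Polynomial.monom (poly.coeff f i) i) ^ (q ^ r)"
    by (simp add: poly_as_sum_of_monoms)
  also have "\<dots> = (\<Sum>i\<le>degree f. Polynomial.monom (poly.coeff f i) i ^ (q ^ r))"
    by (rule frobenius_sum) (use assms in \<open>simp add: kpoly_monom kpoly_def zero_k\<close>)
  also have "\<dots> = (\<Sum>i\<le>degree f. Polynomial.monom (poly.coeff f i) (i * q ^ r))"
    using assms by (intro sum.cong refl) (simp add: monom_power k_fermat_iter kpoly_def)
  also have "\<dots> = pcompose f (Polynomial.monom 1 (q ^ r))"
    unfolding pcompose_altdef poly_altdef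
    by (simp add: degree_map_poly coeff_map_poly monom_power smult_monom mult.commute)
  finally show ?thesis .
qed

lemma frobenius_diff_iter: assumes "a \<in> kpoly" "b \<in> kpoly" shows "(a - b) ^ (q ^ r) = a ^ (q ^ r) - b ^ (q ^ r)"
proof -
  have "a ^ (q ^ r) = ((a - b) + b) ^ (q ^ r)" by simp
  also have "\<dots> = (a - b) ^ (q ^ r) + b ^ (q ^ r)" by (rule frobenius_add_iter[OF kpoly_diff[OF assms] assms(2)])
  finally show ?thesis by simp
qed

end

section \<open>Newton sums\<close>

unbundle no vec_syntax
unbundle fps_syntax

text \<open>Newton's identities solved for the power sums: with \<open>c 0 = 1\<close> understood,
  these are the power sums of the reciprocal roots of the series with coefficients \<open>c\<close>.
  No division and no splitting field is involved, so the definition makes sense in every commutative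
  ring.\<close>

fun newton_sum :: "(nat \<Rightarrow> 'b::comm_ring_1) \<Rightarrow> nat \<Rightarrow> 'b"
  where "newton_sum c n = - (of_nat n * c n) - (\<Sum>i\<in>{1..<n}. c i * newton_sum c (n - i))"

declare newton_sum.simps [simp del]

lemma newton_sum_0: "newton_sum c 0 = 0" by (subst newton_sum.simps) simp

text \<open>The generating series of the power sums is - T C'/C, a logarithmic derivative; this is
  why products of polynomials turn into sums of power sums.\<close>

lemma newton_sum_fps:
  assumes "c 0 = 1"
  shows "Abs_fps c * Abs_fps (newton_sum c) = - (fps_X * fps_deriv (Abs_fps c))"
proof (rule fps_ext)
  fix n
  show "(Abs_fps c * Abs_fps (newton_sum c)) $ n = (- (fps_X * fps_deriv (Abs_fps c))) $ n"
  proof (cases "n = 0")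
    case True then show ?thesis by (simp add: newton_sum_0)
  next
    case False
    have s: "{0..n} = insert 0 (insert n {1..<n})" using False by auto
    have "(Abs_fps c * Abs_fps (newton_sum c)) $ n = (\<Sum>i=0..n. c i * newton_sum c (n - i))"
      by (simp add: fps_mult_nth)
    also have "\<dots> = newton_sum c n + (\<Sum>i\<in>{1..<n}. c i * newton_sum c (n - i))"
      unfolding s using False assms by (simp add: newton_sum_0)
    also have "\<dots> = - (of_nat n * c n)" by (subst newton_sum.simps) simp
    finally show ?thesis using False by (cases n) simp_all
  qed
qed

lemma fps_mult_eq_0_unit:
  fixes C D :: "'b::comm_ring_1 fps"
  assumes "C $ 0 = 1" "C * D = 0" shows "D = 0"
proof (rule fps_ext)
  fix n show "D $ n = 0 $ n"
  proof (induction n rule: less_induct)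
    case (less n)
    have "0 = (\<Sum>i=0..n. C $ i * D $ (n - i))" using assms(2) by (metis fps_mult_nth fps_zero_nth)
    also have "\<dots> = (\<Sum>i\<in>{0}. C $ i * D $ (n - i))"
      using less by (intro sum.mono_neutral_right) auto
    finally show ?case using assms by simp
  qed
qed

lemma newton_sum_unique:
  assumes "c 0 = 1" "Abs_fps c * S = - (fps_X * fps_deriv (Abs_fps c))"
  shows "S $ n = newton_sum c n"
proof -
  have "Abs_fps c * (S - Abs_fps (newton_sum c)) = 0"
    using assms newton_sum_fps[of c] by (simp add: right_diff_distrib)
  then have "S - Abs_fps (newton_sum c) = 0" by (rule fps_mult_eq_0_unit[rotated]) (simp add: assms(1))
  then have "S = Abs_fps (newton_sum c)" by simp
  then show ?thesis by simp
qed

lemma newton_sum_mult: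
  assumes "c 0 = 1" "d 0 = 1"
  shows "newton_sum (fps_nth (Abs_fps c * Abs_fps d)) n = newton_sum c n + newton_sum d n"
proof -
  define C D where "C = Abs_fps c" and "D = Abs_fps d"
  have "C * D * (Abs_fps (newton_sum c) + Abs_fps (newton_sum d))
      = (C * Abs_fps (newton_sum c)) * D + C * (D * Abs_fps (newton_sum d))" by (simp add: algebra_simps)
  also have "\<dots> = - (fps_X * fps_deriv (C * D))"
    using newton_sum_fps[of c, OF assms(1)] newton_sum_fps[of d, OF assms(2)]
    unfolding C_def[symmetric] D_def[symmetric] by (simp add: algebra_simps)
  finally have "(Abs_fps (newton_sum c) + Abs_fps (newton_sum d)) $ n = newton_sum (fps_nth (C * D)) n"
    using assms by (intro newton_sum_unique) (auto simp: C_def D_def fps_nth_inverse)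
  then show ?thesis by (simp add: C_def D_def)
qed

text \<open>The coefficients of T^n h(1/T). For monic \<open>h\<close> and
  \<open>n = degree h\<close> they start with 1 and are the signed elementary symmetric functions of
  the roots, as \<open>newton_sum\<close> expects.\<close>

definition rev_coeff :: "nat \<Rightarrow> 'b::comm_ring_1 poly \<Rightarrow> nat \<Rightarrow> 'b"
  where "rev_coeff n h i = (if i \<le> n then poly.coeff h (n - i) else 0)"

lemma rev_coeff_mult:
  assumes "degree g \<le> n" "degree h \<le> m"
  shows "rev_coeff (n + m) (g * h) = fps_nth (Abs_fps (rev_coeff n g) * Abs_fps (rev_coeff m h))"
proof
  fix j
  show "rev_coeff (n + m) (g * h) j = (Abs_fps (rev_coeff n g) * Abs_fps (rev_coeff m h)) $ j"
  proof (cases "j \<le> n + m")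
    case True
    have "rev_coeff (n + m) (g * h) j = (\<Sum>a\<le>n + m - j. poly.coeff g a * poly.coeff h (n + m - j - a))"
      using True by (simp add: rev_coeff_def coeff_mult)
    also have "\<dots> = (\<Sum>a\<in>{a. a \<le> n + m - j \<and> a \<le> n \<and> n + m - j - a \<le> m}. poly.coeff g a * poly.coeff h (n + m - j - a))"
    proof (rule sum.mono_neutral_right)
      show "\<forall>i\<in>{..n + m - j} - {a. a \<le> n + m - j \<and> a \<le> n \<and> n + m - j - a \<le> m}.
          poly.coeff g i * poly.coeff h (n + m - j - i) = 0"
      proof
        fix i assume "i \<in> {..n + m - j} - {a. a \<le> n + m - j \<and> a \<le> n \<and> n + m - j - a \<le> m}"
        then have "i > n \<or> n + m - j - i > m" by auto
        then have "poly.coeff g i = 0 \<or> poly.coeff h (n + m - j - i) = 0"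
          using assms by (meson coeff_eq_0 le_less_trans)
        then show "poly.coeff g i * poly.coeff h (n + m - j - i) = 0" by auto
      qed
    qed auto
    also have "\<dots> = (\<Sum>i\<in>{i. i \<le> j \<and> i \<le> n \<and> j - i \<le> m}. poly.coeff g (n - i) * poly.coeff h (m - (j - i)))"
      using True by (intro sum.reindex_bij_witness[of _ "\<lambda>i. n - i" "\<lambda>a. n - a"]) (auto intro!: arg_cong2[where f = "(*)"] arg_cong[where f = "poly.coeff h"])
    also have "\<dots> = (\<Sum>i\<in>{0..j}. rev_coeff n g i * rev_coeff m h (j - i))"
      by (rule sum.mono_neutral_cong_left) (auto simp: rev_coeff_def)
    also have "\<dots> = (Abs_fps (rev_coeff n g) * Abs_fps (rev_coeff m h)) $ j" by (simp add: fps_mult_nth)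
    finally show ?thesis .
  next
    case False
    have "(Abs_fps (rev_coeff n g) * Abs_fps (rev_coeff m h)) $ j = 0"
      unfolding fps_mult_nth using False by (intro sum.neutral) (auto simp: rev_coeff_def)
    then show ?thesis using False by (simp add: rev_coeff_def)
  qed
qed

definition root_power_sum :: "'b::comm_ring_1 poly \<Rightarrow> nat \<Rightarrow> 'b"
  where "root_power_sum h j = newton_sum (rev_coeff (degree h) h) j"

lemma root_power_sum_mult:
  assumes "lead_coeff g = 1" "lead_coeff h = 1"
  shows "root_power_sum (g * h) j = root_power_sum g j + root_power_sum h j"
proof -
  have "h \<noteq> 0" using assms by auto
  then have d: "degree (g * h) = degree g + degree h" using monic_degree_mult assms by blast
  have "rev_coeff (degree g) g 0 = 1" "rev_coeff (degree h) h 0 = 1" using assms by (auto simp: rev_coeff_def)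
  then show ?thesis
    unfolding root_power_sum_def d by (simp add: rev_coeff_mult newton_sum_mult)
qed

lemma root_power_sum_linear:
  assumes "j > 0" shows "root_power_sum [:- r, 1:] j = r ^ j"
  using assms
proof (induction j rule: nat_induct_non_zero)
  case 1
  show ?case by (simp add: root_power_sum_def newton_sum.simps[of _ "Suc 0"] rev_coeff_def)
next
  case (Suc n)
  have "root_power_sum [:- r, 1:] (Suc n) = - (\<Sum>i\<in>{1..<Suc n}. rev_coeff 1 [:- r, 1:] i * newton_sum (rev_coeff 1 [:- r, 1:]) (Suc n - i))"
    using Suc(1) by (simp add: root_power_sum_def newton_sum.simps[of _ "Suc n"] rev_coeff_def)
  also have "(\<Sum>i\<in>{1..<Suc n}. rev_coeff 1 [:- r, 1:] i * newton_sum (rev_coeff 1 [:- r, 1:]) (Suc n - i))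
    = (\<Sum>i\<in>{1}. rev_coeff 1 [:- r, 1:] i * newton_sum (rev_coeff 1 [:- r, 1:]) (Suc n - i))"
    using Suc(1) by (intro sum.mono_neutral_right) (auto simp: rev_coeff_def)
  also have "\<dots> = - r * r ^ n" using Suc(2) by (simp add: root_power_sum_def rev_coeff_def)
  finally show ?case by simp
qed

lemma monic_prod_linear:
  fixes r :: "'c \<Rightarrow> 'b::comm_ring_1"
  assumes "finite A"
  shows "degree (\<Prod>i\<in>A. [:- r i, 1:]) = card A \<and> lead_coeff (\<Prod>i\<in>A. [:- r i, 1:]) = 1"
  using assms
proof (induction A rule: finite_induct)
  case (insert x A)
  define g where "g = (\<Prod>i\<in>A. [:- r i, 1:])"
  have g: "degree g = card A" "lead_coeff g = 1" using insert.IH by (auto simp: g_def)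
  then have "g \<noteq> 0" by auto
  then have "degree ([:- r x, 1:] * g) = Suc (card A)" "lead_coeff ([:- r x, 1:] * g) = 1"
    using monic_degree_mult(1,2)[of "[:- r x, 1:]" g] g by auto
  moreover have "(\<Prod>i\<in>insert x A. [:- r i, 1:]) = [:- r x, 1:] * g"
    unfolding g_def by (rule prod.insert) (use insert in auto)
  ultimately show ?case using insert(1,2) by (simp only: card_insert_disjoint) simp
qed simp

lemma root_power_sum_prod_linear:
  fixes r :: "'c \<Rightarrow> 'b::comm_ring_1"
  assumes "finite A" "j > 0"
  shows "root_power_sum (\<Prod>i\<in>A. [:- r i, 1:]) j = (\<Sum>i\<in>A. r i ^ j)"
  using assms
proof (induction A rule: finite_induct)
  case empty
  then show ?case unfolding root_power_sum_def by (subst newton_sum.simps) (simp add: rev_coeff_def)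
next
  case (insert x A)
  have "(\<Prod>i\<in>insert x A. [:- r i, 1:]) = [:- r x, 1:] * (\<Prod>i\<in>A. [:- r i, 1:])"
    by (rule prod.insert) (use insert in auto)
  also have "root_power_sum \<dots> j = root_power_sum [:- r x, 1:] j + root_power_sum (\<Prod>i\<in>A. [:- r i, 1:]) j"
    using monic_prod_linear[OF insert(1), of r] by (intro root_power_sum_mult) auto
  also have "\<dots> = (\<Sum>i\<in>insert x A. r i ^ j)"
    using insert by (simp add: root_power_sum_linear)
  finally show ?case .
qed

text \<open>Power sums are integral polynomials in the coefficients, so congruences carry over. Thus
  a factorisation valid only modulo an irreducible polynomial still computes the power sums modulo
  it.\<close>

lemma newton_sum_cong_ideal:
  fixes I :: "'b::comm_ring_1 set"
  assumes I0: "0 \<in> I" and Iadd: "\<And>a b. a \<in> I \<Longrightarrow> b \<in> I \<Longrightarrow> a + b \<in> I"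
    and Imult: "\<And>a c. a \<in> I \<Longrightarrow> c * a \<in> I"
    and c: "\<And>i. c i - d i \<in> I"
  shows "newton_sum c n - newton_sum d n \<in> I"
proof (induction n rule: less_induct)
  case (less n)
  have sumI: "sum f A \<in> I" if "\<And>i. i \<in> A \<Longrightarrow> f i \<in> I" for A :: "nat set" and f
    using that by (induction A rule: infinite_finite_induct) (auto simp: I0 Iadd)
  have neg: "- a \<in> I" if "a \<in> I" for a using Imult[OF that, of "-1"] by simp
  have "newton_sum c n - newton_sum d n = - (of_nat n * (c n - d n)) +
    - (\<Sum>i\<in>{1..<n}. c i * (newton_sum c (n - i) - newton_sum d (n - i)) + newton_sum d (n - i) * (c i - d i))"
    by (subst newton_sum.simps[of c n], subst newton_sum.simps[of d n]) (simp add: algebra_simps sum.distrib sum_subtractf)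
  also have "\<dots> \<in> I" by (intro Iadd neg sumI Imult c less) auto
  finally show ?case .
qed

lemma newton_sum_const: "newton_sum (\<lambda>i. [:c i:]) n = [:newton_sum c n:]"
proof (induction n rule: less_induct)
  case (less n)
  have s: "(\<Sum>i\<in>A. [:f i:]) = [:sum f A:]" for A :: "nat set" and f :: "nat \<Rightarrow> 'a"
    by (induction A rule: infinite_finite_induct) auto
  show ?case
    by (subst newton_sum.simps, subst newton_sum.simps[of c n]) (simp add: less s of_nat_poly mult.commute)
qed

text \<open>Newton's identities are triangular: \<open>c d\<close> enters first in the power sum of
  index \<open>d\<close>, with factor \<open>- d\<close>. Varying \<open>c d\<close> therefore
  shifts this power sum freely when \<open>d\<close> is invertible in the field.\<close>

lemma newton_sum_change:
  assumes "\<And>i. i \<noteq> d \<Longrightarrow> c' i = c i" "d > 0"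
  shows "n < d \<Longrightarrow> newton_sum c' n = newton_sum c n"
    and "newton_sum c' d = newton_sum c d - of_nat d * (c' d - c d)"
proof -
  show 1: "n < d \<Longrightarrow> newton_sum c' n = newton_sum c n" for n
  proof (induction n rule: less_induct)
    case (less n)
    then show ?case by (subst newton_sum.simps[of c' n], subst newton_sum.simps[of c n]) (simp add: assms(1))
  qed
  have "(\<Sum>i\<in>{1..<d}. c' i * newton_sum c' (d - i)) = (\<Sum>i\<in>{1..<d}. c i * newton_sum c (d - i))"
    by (intro sum.cong refl) (simp add: assms(1) 1)
  then show "newton_sum c' d = newton_sum c d - of_nat d * (c' d - c d)"
    by (subst newton_sum.simps[of c' d], subst newton_sum.simps[of c d]) (simp add: algebra_simps)
qed

context field_ideal
begin

text \<open>Projecting by \<open>e\<close> discards the complementary component, where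
  \<open>P\<close> is only a monomial. Without the projection the multiples of \<open>P\<close>
  would in general not form a prime ideal of the polynomials over the ambient ring.\<close>

definition kirr_ideal :: "'w poly \<Rightarrow> 'w poly set"
  where "kirr_ideal P = {g. P dvd Polynomial.smult e g}"

lemma kirr_ideal_0: "0 \<in> kirr_ideal P"
  and kirr_ideal_add: "a \<in> kirr_ideal P \<Longrightarrow> b \<in> kirr_ideal P \<Longrightarrow> a + b \<in> kirr_ideal P"
  and kirr_ideal_mult: "a \<in> kirr_ideal P \<Longrightarrow> c * a \<in> kirr_ideal P"
  by (auto simp: kirr_ideal_def smult_add_right mult_smult_right[symmetric] simp del: mult_smult_right)

lemma kirr_ideal_prime:
  assumes "P \<in> kirr m" "a * b \<in> kirr_ideal P" shows "a \<in> kirr_ideal P \<or> b \<in> kirr_ideal P"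
proof -
  have "Polynomial.smult e a * Polynomial.smult e b = Polynomial.smult e (a * b)" by (simp add: e_idem)
  then show ?thesis using assms kirr_prime[OF assms(1), of "Polynomial.smult e a" "Polynomial.smult e b"]
    by (auto simp: kirr_ideal_def kpoly_smult_k e_in)
qed

lemma dvd_smult_power_diff:
  assumes "P dvd Polynomial.smult e (a - b)" "c \<in> k"
  shows "P dvd Polynomial.smult c (a ^ i - b ^ i)"
proof -
  have "a - b dvd a ^ i - b ^ i" by (rule power_dvd_diff) simp
  then obtain g where "a ^ i - b ^ i = (a - b) * g" by blast
  then have "Polynomial.smult e (a ^ i - b ^ i) = Polynomial.smult e (a - b) * g" by simp
  then have "P dvd Polynomial.smult e (a ^ i - b ^ i)" using dvd_mult2[OF assms(1), of g] by (simp only:)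
  then have "P dvd Polynomial.smult c (Polynomial.smult e (a ^ i - b ^ i))" by (rule dvd_smult)
  then show ?thesis using e_mult[OF assms(2)] by (simp add: mult.commute)
qed

lemma kirr_ideal_pcompose:
  assumes "f \<in> kpoly" "P dvd Polynomial.smult e (a - b)"
  shows "P dvd pcompose f a - pcompose f b"
proof -
  have "P dvd (\<Sum>i\<le>degree f. Polynomial.smult (poly.coeff f i) (a ^ i - b ^ i))"
    using assms(1) by (intro dvd_sum dvd_smult_power_diff[OF assms(2)]) (auto simp: kpoly_def)
  moreover have "pcompose f c = (\<Sum>i\<le>degree f. Polynomial.smult (poly.coeff f i) (c ^ i))" for c
    unfolding pcompose_altdef poly_altdef by (simp add: degree_map_poly coeff_map_poly)
  ultimately show ?thesis by (simp add: smult_diff_right sum_subtractf)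
qed

text \<open>If the power map \<open>q ^ r\<close> fixed T modulo \<open>P\<close>, it would fix all
  \<open>q ^ m\<close> residues by \<open>frobenius_poly\<close>, although Y^(q^r) - Y has at most
  \<open>q ^ r < q ^ m\<close> roots in the residue field.\<close>

lemma kirr_frobenius_distinct:
  assumes P: "P \<in> kirr m" and r: "0 < r" "r < m"
  shows "\<not> P dvd Polynomial.smult e (Polynomial.monom 1 (q ^ r) - Polynomial.monom 1 1)"
proof
  assume d: "P dvd Polynomial.smult e (Polynomial.monom 1 (q ^ r) - Polynomial.monom 1 1)"
  have PV: "P \<in> kmonic m" using P by (rule kirr_kmonic)
  have fr: "P dvd f ^ (q ^ r) - f" if "f \<in> kpoly" for f
  proof -
    have "pcompose f (Polynomial.monom 1 1) = f" by (metis pcompose_idR monom_Suc monom_0 One_nat_def)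
    then show ?thesis using kirr_ideal_pcompose[OF that d] frobenius_poly[OF that] by simp
  qed
  define g :: "'w poly poly" where "g = Polynomial.monom 1 (q ^ r) - Polynomial.monom 1 1"
  have "1 < q" using q_ge_2 by simp
  then have lt: "q ^ r < q ^ m" "1 < q ^ r"
    using power_strict_increasing[OF r(2), of q] one_less_power[of q r] r(1) by auto
  have "poly.coeff g i \<in> kirr_ideal P" for i
  proof (rule coeffs_in_prime_ideal_of_roots[where n = "q ^ r + 1" and A = "kpoly_lt m"])
    show "a * b \<in> kirr_ideal P \<Longrightarrow> a \<in> kirr_ideal P \<or> b \<in> kirr_ideal P" for a b
      by (rule kirr_ideal_prime[OF P])
    show "poly.coeff g i \<in> kirr_ideal P" if "i \<ge> q ^ r + 1" for i
      using that lt by (simp add: g_def kirr_ideal_0)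
    show "card (kpoly_lt m) \<ge> q ^ r + 1" using lt by (simp add: card_kpoly_lt)
    show "x - y \<notin> kirr_ideal P" if "x \<in> kpoly_lt m" "y \<in> kpoly_lt m" "x \<noteq> y" for x y
    proof -
      have xy: "x - y \<in> kpoly_lt m" using that by (auto simp: kpoly_lt_def kpoly_diff)
      then show ?thesis using kpoly_lt_dvd_zero[OF PV xy] kpoly_e[OF kpoly_ltD[OF xy]] that(3)
        by (auto simp: kirr_ideal_def)
    qed
    show "poly g x \<in> kirr_ideal P" if "x \<in> kpoly_lt m" for x
      using fr[OF kpoly_ltD[OF that]] by (simp add: g_def poly_monom kirr_ideal_def dvd_smult)
  qed (auto simp: finite_kpoly_lt kirr_ideal_0 kirr_ideal_add kirr_ideal_mult)
  then have "poly.coeff g (q ^ r) \<in> kirr_ideal P" .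
  then have "P dvd [:e:]" using lt by (simp add: g_def kirr_ideal_def)
  then show False using kirr_not_dvd_e[OF P] by blast
qed

text \<open>Modulo \<open>P\<close> the roots of \<open>P(Y)\<close> are \<open>T^(q^i)\<close> for \<open>i < m\<close>.\<close>

lemma kirr_root_power_sum:
  assumes P: "P \<in> kirr m" and j: "j > 0"
  shows "P dvd Polynomial.smult e ([:root_power_sum P j:] - (\<Sum>i<m. Polynomial.monom 1 (j * q ^ i)))"
proof -
  have PV: "P \<in> kmonic m" using P by (rule kirr_kmonic)
  \<comment> \<open>The outer variable is a second one, Y: \<open>PY\<close> is P(Y) with constant
    coefficients and \<open>G\<close> the product of the Y - T^(q^i). Both are monic of degree
    \<open>m\<close> with the same \<open>m\<close> roots modulo \<open>P\<close>, hence congruent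
    coefficientwise.\<close>
  define T :: "nat \<Rightarrow> 'w poly" where "T i = Polynomial.monom 1 (q ^ i)" for i
  define G where "G = (\<Prod>i<m. [:- T i, 1:])"
  define PY where "PY = map_poly (\<lambda>c. [:c:]) P"
  have cPY: "poly.coeff PY i = [:poly.coeff P i:]" for i by (simp add: PY_def coeff_map_poly)
  have dPY: "degree PY = m" unfolding PY_def using kmonic_degree[OF PV] by (simp add: degree_map_poly)
  have dG: "degree G = m" "lead_coeff G = 1" using monic_prod_linear[of "{..<m}" T] by (auto simp: G_def)
  have Tdiff: "T i' - T i \<notin> kirr_ideal P" if "i < i'" "i' < m" for i i'
  proof
    assume "T i' - T i \<in> kirr_ideal P"
    then have d: "P dvd Polynomial.smult e (T i' - T i)" by (simp add: kirr_ideal_def)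
    \<comment> \<open>The difference of the two conjugates is the \<open>q ^ i\<close>-th power of
      \<open>a - b\<close>, and \<open>P\<close> is prime; so the exponents may be lowered by
      \<open>i\<close>, down to the case excluded before.\<close>
    define a b where "a = Polynomial.smult e (T (i' - i))" and "b = Polynomial.smult e (T 0)"
    have ab: "a \<in> kpoly" "b \<in> kpoly" by (auto simp: a_def b_def kpoly_smult_k e_in)
    have "q ^ (i' - i) * q ^ i = q ^ i'" using that by (simp add: power_add[symmetric])
    then have "(a - b) ^ (q ^ i) = Polynomial.smult e (T i' - T i)"
      unfolding frobenius_diff_iter[OF ab]
      by (simp add: a_def b_def T_def smult_power monom_power k_fermat_iter e_in smult_diff_right)
    then have "P dvd a - b" using kirr_prime_power[OF P kpoly_diff[OF ab]] d by metis
    then have "P dvd Polynomial.smult e (Polynomial.monom 1 (q ^ (i' - i)) - Polynomial.monom 1 1)"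
      by (simp add: a_def b_def T_def smult_diff_right)
    then show False using kirr_frobenius_distinct[OF P, of "i' - i"] that less_imp_diff_less[OF that(2), of i] by simp
  qed
  have neg: "- a \<in> kirr_ideal P" if "a \<in> kirr_ideal P" for a using kirr_ideal_mult[OF that, of "-1"] by simp
  have Tne: "T i - T i' \<notin> kirr_ideal P" if "i < m" "i' < m" "i \<noteq> i'" for i i'
    using Tdiff[of i i'] Tdiff[of i' i] that neg[of "T i - T i'"] by (cases "i < i'") auto
  have inj: "inj_on T {..<m}" using Tne kirr_ideal_0[of P] by (metis diff_self inj_onI lessThan_iff)
  have cong: "poly.coeff (PY - G) i \<in> kirr_ideal P" for i
  proof (rule coeffs_in_prime_ideal_of_roots[where n = m and A = "T ` {..<m}"])
    show "a * b \<in> kirr_ideal P \<Longrightarrow> a \<in> kirr_ideal P \<or> b \<in> kirr_ideal P" for a b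
      by (rule kirr_ideal_prime[OF P])
    show "poly.coeff (PY - G) i \<in> kirr_ideal P" if "i \<ge> m" for i
    proof (cases "i = m")
      case True
      have "poly.coeff PY m = 1" using PV by (simp add: cPY kmonic_def)
      then show ?thesis using True dG by (simp add: kirr_ideal_0)
    next
      case False
      then show ?thesis using that dG dPY by (simp add: coeff_eq_0 kirr_ideal_0)
    qed
    show "m \<le> card (T ` {..<m})" by (simp add: card_image[OF inj])
    show "x - y \<notin> kirr_ideal P" if "x \<in> T ` {..<m}" "y \<in> T ` {..<m}" "x \<noteq> y" for x y
      using that Tne by blast
    show "poly (PY - G) x \<in> kirr_ideal P" if x: "x \<in> T ` {..<m}" for x
    proof -
      obtain i where i: "i < m" "x = T i" using x by auto
      have "poly G (T i) = 0" unfolding G_def poly_prod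
        by (rule prod_zero) (use i in \<open>auto intro!: bexI[of _ i]\<close>)
      moreover have "poly PY (T i) = pcompose P (T i)" by (simp add: PY_def pcompose_altdef)
      moreover have "Polynomial.smult e (pcompose P (T i)) = Polynomial.smult e P ^ (q ^ i)"
        using frobenius_poly[OF kmonic_e[OF PV], of i] by (simp add: T_def pcompose_smult)
      moreover have "P dvd Polynomial.smult e P ^ (q ^ i)"
      proof -
        have "q ^ i > 0" using q_ge_2 by simp
        then have "Polynomial.smult e P dvd Polynomial.smult e P ^ (q ^ i)" by (simp only: dvd_power simp_thms)
        moreover have "P dvd Polynomial.smult e P" by (simp add: dvd_smult)
        ultimately show ?thesis by (rule dvd_trans[rotated])
      qed
      ultimately show ?thesis using i by (simp add: kirr_ideal_def)
    qed
  qed (auto simp: kirr_ideal_0 kirr_ideal_add kirr_ideal_mult)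
  have "newton_sum (rev_coeff m PY) j - newton_sum (rev_coeff m G) j \<in> kirr_ideal P"
  proof (rule newton_sum_cong_ideal)
    show "rev_coeff m PY i - rev_coeff m G i \<in> kirr_ideal P" for i
      using cong[of "m - i"] by (simp add: rev_coeff_def kirr_ideal_0)
  qed (auto simp: kirr_ideal_0 kirr_ideal_add kirr_ideal_mult)
  moreover have "rev_coeff m PY = (\<lambda>i. [:rev_coeff m P i:])" by (auto simp: rev_coeff_def cPY)
  then have "newton_sum (rev_coeff m PY) j = [:root_power_sum P j:]"
    using kmonic_degree[OF PV] by (simp add: newton_sum_const root_power_sum_def)
  moreover have "newton_sum (rev_coeff m G) j = (\<Sum>i<m. T i ^ j)"
    using root_power_sum_prod_linear[of "{..<m}" j T] j dG(1) by (simp add: root_power_sum_def G_def)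
  moreover have "(\<Sum>i<m. T i ^ j) = (\<Sum>i<m. Polynomial.monom 1 (j * q ^ i))"
    by (simp add: T_def monom_power mult.commute)
  ultimately show ?thesis by (simp add: kirr_ideal_def)
qed

end

section \<open>Stepanov's method\<close>

text \<open>The polynomial under study is f = sum of \<open>fc j\<close> T^j for \<open>j\<close>
  from 1 to \<open>d\<close>. The two conditions on \<open>d\<close> say in two forms that its
  degree is prime to the characteristic: \<open>d_fc\<close> serves to shift a power sum,
  \<open>coprime_d_q\<close> to recover \<open>j\<close> from \<open>j * d\<close> modulo
  \<open>q\<close>.\<close>

locale additive_poly_char = field_ideal k e for k :: "'w::comm_ring_1 set" and e +
  fixes \<psi> :: "'w \<Rightarrow> complex" and fc :: "nat \<Rightarrow> 'w" and d :: nat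
  assumes psi_add: "a \<in> k \<Longrightarrow> b \<in> k \<Longrightarrow> \<psi> (a + b) = \<psi> a * \<psi> b"
    and psi_norm: "a \<in> k \<Longrightarrow> cmod (\<psi> a) = 1"
    and psi_nontrivial: "\<exists>x\<in>k. \<psi> x \<noteq> 1"
    and fc_k: "fc j \<in> k"
    and d_pos: "d > 0"
    and d_fc: "of_nat d * fc d \<noteq> 0"
    and coprime_d_q: "coprime d q"
begin

text \<open>The sum of f over the roots of \<open>h\<close>. At \<open>P ^ r\<close> with
  \<open>r * degree P = n\<close> it is the trace to \<open>k\<close>, from the extension of degree
  \<open>n\<close>, of f at a root of \<open>P\<close>.\<close>

definition trace_sum :: "'w poly \<Rightarrow> 'w"
  where "trace_sum h = (\<Sum>j=1..d. fc j * root_power_sum h j)"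

definition \<theta> :: "'w poly \<Rightarrow> complex" where "\<theta> h = \<psi> (trace_sum h)"

lemma trace_sum_k: "h \<in> kmonic n \<Longrightarrow> trace_sum h \<in> k"
  unfolding trace_sum_def by (intro sum_k mult_k' fc_k)

lemma trace_sum_mult:
  "f \<in> kmonic n \<Longrightarrow> g \<in> kmonic m \<Longrightarrow> trace_sum (f * g) = trace_sum f + trace_sum g"
  unfolding trace_sum_def
  by (simp add: root_power_sum_mult kmonic_lead distrib_left sum.distrib)

lemma trace_sum_power:
  assumes "f \<in> kmonic n" shows "trace_sum (f ^ r) = of_nat r * trace_sum f"
proof (induction r)
  case 0
  have "trace_sum (1 * 1) = trace_sum 1 + trace_sum 1" using trace_sum_mult[of 1 0 1 0] kmonic_0 by blast
  then show ?case by simp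
next
  case (Suc r)
  then show ?case using trace_sum_mult[OF assms kmonic_power[OF assms, of r]] by (simp add: algebra_simps)
qed

lemma theta_mult: "f \<in> kmonic n \<Longrightarrow> g \<in> kmonic m \<Longrightarrow> \<theta> (f * g) = \<theta> f * \<theta> g"
  unfolding \<theta>_def by (simp add: trace_sum_mult psi_add trace_sum_k)

lemma fc_d_nz: "fc d \<noteq> 0" using d_fc by auto

lemma psi_0: "\<psi> 0 = 1"
proof -
  have "\<psi> (0 + 0) = \<psi> 0 * \<psi> 0" using psi_add zero_k by blast
  moreover have "\<psi> 0 \<noteq> 0" using psi_norm[OF zero_k] by auto
  ultimately show ?thesis by simp
qed

text \<open>Shifting the coefficient of \<open>T^(n-d)\<close> shifts the top power sum, on which \<open>\<theta>\<close> depends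
  through a nontrivial character.\<close>

lemma char_sum_theta_zero: assumes "n \<ge> d" shows "char_sum \<theta> n = 0"
proof -
  obtain x where x: "x \<in> k" "\<psi> x \<noteq> 1" using psi_nontrivial by blast
  define D where "D = of_nat d * fc d"
  have D: "D \<in> k" "D \<noteq> 0" using d_fc fc_k by (auto simp: D_def mult_k)
  obtain b where b: "b \<in> k" "D * b = e" using inv_in_k[OF D] by blast
  \<comment> \<open>Chosen so that the change \<open>- fc d * (of_nat d * y)\<close> of the trace
    equals \<open>x\<close>.\<close>
  define y where "y = - (b * x)"
  have y: "y \<in> k" unfolding y_def by (intro minus_k mult_k x)
  have Dy: "D * y = - x" using b e_mult[OF x(1)] by (simp add: y_def mult.assoc[symmetric])
  define \<phi> where "\<phi> h = h + Polynomial.monom y (n - d)" for h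
  have \<phi>: "\<phi> h \<in> kmonic n" if "h \<in> kmonic n" for h
  proof (rule kmonicI)
    have nd: "n - d < n" using assms d_pos by simp
    show "poly.coeff (\<phi> h) i = 0" if "i > n" for i
      using that nd \<open>h \<in> kmonic n\<close> by (auto simp: \<phi>_def kmonic_def coeff_eq_0)
    show "poly.coeff (\<phi> h) n = 1" using nd \<open>h \<in> kmonic n\<close> by (auto simp: \<phi>_def kmonic_def)
    show "poly.coeff (\<phi> h) i \<in> k" if "i < n" for i
      using that \<open>h \<in> kmonic n\<close> y by (auto simp: \<phi>_def kmonic_def add_k)
  qed
  have tr: "trace_sum (\<phi> h) = trace_sum h + x" if h: "h \<in> kmonic n" for h
  proof -
    have deg: "degree (\<phi> h) = n" "degree h = n" using \<phi>[OF h] h kmonic_degree by blast+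
    have ne: "rev_coeff n (\<phi> h) i = rev_coeff n h i" if "i \<noteq> d" for i
      using that assms by (auto simp: rev_coeff_def \<phi>_def)
    have c: "root_power_sum (\<phi> h) j = root_power_sum h j" if "j < d" for j
      unfolding root_power_sum_def deg by (rule newton_sum_change(1)[of d]) (use ne d_pos that in auto)
    have "root_power_sum (\<phi> h) d = root_power_sum h d - of_nat d * (rev_coeff n (\<phi> h) d - rev_coeff n h d)"
      unfolding root_power_sum_def deg by (rule newton_sum_change(2)) (use ne d_pos in auto)
    also have "rev_coeff n (\<phi> h) d - rev_coeff n h d = y" using assms by (simp add: rev_coeff_def \<phi>_def)
    finally have c2: "root_power_sum (\<phi> h) d = root_power_sum h d - of_nat d * y" .
    have s: "{1..d} = insert d {1..<d}" using d_pos by auto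
    have "trace_sum (\<phi> h) = trace_sum h - fc d * (of_nat d * y)"
      unfolding trace_sum_def s by (simp add: c c2 right_diff_distrib)
    also have "fc d * (of_nat d * y) = D * y" by (simp add: D_def algebra_simps)
    finally show ?thesis using Dy by simp
  qed
  have inj: "inj_on \<phi> (kmonic n)" by (auto simp: inj_on_def \<phi>_def)
  have "\<phi> ` kmonic n = kmonic n" by (rule endo_inj_surj[OF finite_kmonic _ inj]) (use \<phi> in auto)
  then have "char_sum \<theta> n = (\<Sum>h\<in>kmonic n. \<theta> (\<phi> h))"
    unfolding char_sum_def using sum.reindex[OF inj, of \<theta>] by simp
  also have "\<dots> = (\<Sum>h\<in>kmonic n. \<theta> h * \<psi> x)"
    using tr x(1) by (intro sum.cong refl) (simp add: \<theta>_def psi_add trace_sum_k)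
  also have "\<dots> = char_sum \<theta> n * \<psi> x" by (simp add: char_sum_def sum_distrib_right)
  finally show ?thesis using x(2) by (metis mult_cancel_left1 mult.right_neutral)
qed

section \<open>The trace as a polynomial\<close>

definition fpol :: "'w poly" where "fpol = (\<Sum>j=1..d. Polynomial.monom (fc j) j)"

lemma fpol_coeff: "poly.coeff fpol i = (if 1 \<le> i \<and> i \<le> d then fc i else 0)"
  by (simp add: fpol_def coeff_sum)

lemma fpol_kpoly: "fpol \<in> kpoly"
  by (simp add: kpoly_def fpol_coeff fc_k zero_k)

lemma fpol_degree: "degree fpol = d"
proof (rule antisym)
  show "degree fpol \<le> d" by (rule degree_le) (simp add: fpol_coeff)
  show "d \<le> degree fpol" using d_pos fc_d_nz by (intro le_degree) (simp add: fpol_coeff)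
qed

lemma fpol_frobenius: "fpol ^ (q ^ i) = (\<Sum>j=1..d. Polynomial.monom (fc j) (j * q ^ i))"
  unfolding fpol_def
  by (subst frobenius_sum) (auto simp: kpoly_monom fc_k monom_power k_fermat_iter)

text \<open>The trace polynomial f + f^q + ... + f^(q^(l-1)); at a root of an irreducible polynomial
  of degree dividing \<open>l\<close> it gives the trace of f from the extension of degree
  \<open>l\<close>.\<close>

definition Apol :: "nat \<Rightarrow> 'w poly" where "Apol l = (\<Sum>i<l. fpol ^ (q ^ i))"

lemma q_power_pos: "q ^ i > 0" using q_ge_2 by simp

lemma Apol_kpoly: "Apol l \<in> kpoly"
  unfolding Apol_def by (intro kpoly_sum kpoly_power fpol_kpoly q_power_pos)

lemma Apol_add: "Apol (l + m) = Apol l + Apol m ^ (q ^ l)"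
proof -
  have "Apol m ^ (q ^ l) = (\<Sum>i<m. (fpol ^ (q ^ i)) ^ (q ^ l))"
    unfolding Apol_def by (intro frobenius_sum kpoly_power fpol_kpoly q_power_pos)
  also have "\<dots> = (\<Sum>i<m. fpol ^ (q ^ (l + i)))" by (simp add: power_mult[symmetric] power_add mult.commute)
  finally have *: "Apol m ^ (q ^ l) = (\<Sum>i<m. fpol ^ (q ^ (l + i)))" .
  have "(\<Sum>i<l + m. fpol ^ (q ^ i)) = (\<Sum>i<l. fpol ^ (q ^ i)) + (\<Sum>i<m. fpol ^ (q ^ (l + i)))"
    by (induction m) (simp_all add: add.assoc)
  then show ?thesis unfolding * by (simp add: Apol_def)
qed

text \<open>For \<open>r = 1\<close> the power sums of \<open>P\<close> are replaced by sums over
  the conjugates T^(q^i). For larger \<open>r\<close> the summands of \<open>Apol\<close> repeat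
  with period \<open>m\<close> modulo \<open>P\<close> by Fermat.\<close>

lemma kirr_trace:
  assumes P: "P \<in> kirr m" shows "P dvd Apol (m * r) - [:trace_sum (P ^ r):]"
proof (induction r)
  case 0
  have "trace_sum 1 = 0" using trace_sum_power[of 1 0 0] kmonic_0 by simp
  then show ?case by (simp add: Apol_def)
next
  case (Suc r)
  have PV: "P \<in> kmonic m" using P by (rule kirr_kmonic)
  have "P dvd Apol m - [:trace_sum P:]"
  proof -
    have "Apol m = (\<Sum>j=1..d. \<Sum>i<m. Polynomial.monom (fc j) (j * q ^ i))"
      unfolding Apol_def fpol_frobenius by (rule sum.swap)
    also have "\<dots> = (\<Sum>j=1..d. Polynomial.smult (fc j) (\<Sum>i<m. Polynomial.monom 1 (j * q ^ i)))"
      by (intro sum.cong refl poly_eqI) (auto simp: coeff_sum sum_distrib_left intro!: sum.cong)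
    finally have 1: "Apol m = \<dots>" .
    have 2: "[:trace_sum P:] = (\<Sum>j=1..d. Polynomial.smult (fc j) [:root_power_sum P j:])"
      unfolding trace_sum_def by (rule poly_eqI) (simp add: coeff_sum coeff_pCons split: nat.split)
    have "P dvd (\<Sum>j=1..d. Polynomial.smult (fc j) ([:root_power_sum P j:] - (\<Sum>i<m. Polynomial.monom 1 (j * q ^ i))))"
    proof (rule dvd_sum)
      fix j assume "j \<in> {1..d}"
      then have "P dvd Polynomial.smult (fc j) (Polynomial.smult e ([:root_power_sum P j:] - (\<Sum>i<m. Polynomial.monom 1 (j * q ^ i))))"
        by (intro dvd_smult kirr_root_power_sum[OF P]) simp
      then show "P dvd Polynomial.smult (fc j) ([:root_power_sum P j:] - (\<Sum>i<m. Polynomial.monom 1 (j * q ^ i)))"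
        using e_mult[OF fc_k[of j]] by (simp only: smult_smult mult.commute[of "fc j" e])
    qed
    then have "P dvd [:trace_sum P:] - Apol m" unfolding 1 2 by (simp only: smult_diff_right sum_subtractf)
    then show ?thesis by (metis dvd_minus_iff minus_diff_eq)
  qed
  moreover have "P dvd Apol m ^ (q ^ (m * r)) - Apol m" by (rule kirr_fermat_iter[OF P Apol_kpoly])
  ultimately have "P dvd (Apol (m * r) - [:trace_sum (P ^ r):]) + (Apol m ^ (q ^ (m * r)) - Apol m) + (Apol m - [:trace_sum P:])"
    using Suc by (intro dvd_add)
  moreover have "trace_sum (P ^ Suc r) = trace_sum (P ^ r) + trace_sum P"
    using trace_sum_power[OF PV] by (simp only:) (simp add: algebra_simps)
  moreover have "Apol (m * Suc r) = Apol (m * r) + Apol m ^ (q ^ (m * r))"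
    using Apol_add[of "m * r" m] by (simp add: algebra_simps)
  then have "Apol (m * Suc r) - [:trace_sum (P ^ Suc r):]
    = (Apol (m * r) - [:trace_sum (P ^ r):]) + (Apol m ^ (q ^ (m * r)) - Apol m) + (Apol m - [:trace_sum P:])"
    using calculation(2) by simp
  ultimately show ?case by (simp only:)
qed

lemma Apol_degree:
  assumes "l > 0"
  shows "degree (Apol l) = d * q ^ (l - 1)" "lead_coeff (Apol l) = fc d"
proof -
  have "degree (Apol l) = d * q ^ (l - 1) \<and> lead_coeff (Apol l) = fc d"
    using assms
  proof (induction l rule: nat_induct_non_zero)
    case 1
    show ?case using d_pos by (simp add: Apol_def fpol_degree fpol_coeff)
  next
    case (Suc l)
    have A: "Apol (Suc l) = Apol l + fpol ^ (q ^ l)" by (simp add: Apol_def)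
    have fd: "poly.coeff (fpol ^ (q ^ l)) (d * q ^ l) = fc d"
    proof -
      have "poly.coeff (fpol ^ (q ^ l)) (d * q ^ l) = (\<Sum>j=1..d. if j = d then fc j else 0)"
        unfolding fpol_frobenius coeff_sum using q_power_pos[of l] by (intro sum.cong refl) auto
      then show ?thesis using d_pos by simp
    qed
    have "degree (fpol ^ (q ^ l)) \<le> d * q ^ l" using degree_power_le[of fpol "q ^ l"] by (simp add: fpol_degree)
    moreover have "d * q ^ l \<le> degree (fpol ^ (q ^ l))" using fd fc_d_nz by (intro le_degree) simp
    ultimately have dg: "degree (fpol ^ (q ^ l)) = d * q ^ l" by simp
    have "q ^ (l - 1) < q ^ l" using Suc(1) q_ge_2 by (intro power_strict_increasing) auto
    then have lt: "degree (Apol l) < degree (fpol ^ (q ^ l))" using Suc(2) dg d_pos by simp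
    show ?case unfolding A
      using degree_add_eq_right[OF lt] lt fd dg by (simp add: coeff_eq_0)
  qed
  then show "degree (Apol l) = d * q ^ (l - 1)" "lead_coeff (Apol l) = fc d" by auto
qed

text \<open>The counting principle behind Stepanov's method. When one irreducible factor is split
  off, the others still divide the cofactor, being prime to it.\<close>

lemma sum_degree_kirrs_le:
  assumes "finite S" "S \<subseteq> kirrs" "g \<in> kpoly" "g \<noteq> 0" "\<And>P. P \<in> S \<Longrightarrow> P dvd g"
  shows "(\<Sum>P\<in>S. degree P) \<le> degree g"
  using assms
proof (induction S arbitrary: g rule: finite_induct)
  case (insert P S)
  have P: "P \<in> kirr (degree P)" using insert.prems by (auto simp: kirrs_iff)
  obtain h0 where h0: "g = P * h0" using insert.prems by blast
  define h where "h = Polynomial.smult e h0"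
  have h: "h \<in> kpoly" by (simp add: h_def kpoly_smult_k e_in)
  have g: "g = P * h" using kpoly_e[OF insert.prems(2)] h0 by (simp add: h_def)
  have g': "g = Polynomial.smult e P * h" using kpoly_e[OF insert.prems(2)] g by simp
  have hnz: "h \<noteq> 0" using g insert.prems by auto
  have "P' dvd h" if "P' \<in> S" for P'
  proof -
    have P': "P' \<in> kirr (degree P')" using that insert.prems by (auto simp: kirrs_iff)
    have "P' \<noteq> P" using that insert by blast
    then have "\<not> P' dvd Polynomial.smult e P"
      using kirr_dvd_kirr[OF P' P] kmonic_dvd_smult_e[OF kirr_kmonic[OF P'] kirr_kmonic[OF P]] by blast
    then show ?thesis using kirr_prime[OF P' kmonic_e[OF kirr_kmonic[OF P]] h] insert.prems(4)[of P'] that g' by auto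
  qed
  then have "(\<Sum>P\<in>S. degree P) \<le> degree h" using insert.IH[OF _ h hnz] insert.prems by auto
  moreover have "degree g = degree P + degree h"
    unfolding g using monic_degree_mult(1)[OF kmonic_lead[OF kirr_kmonic[OF P]] hnz] .
  ultimately show ?case using insert by simp
qed simp

text \<open>Stepanov's method with \<open>Q = q^(m + l)\<close>: the combinations \<open>\<Psi>\<close> of \<open>T^i A^j T^(q^l i')\<close> have
  pairwise distinct leading degrees, hence do not vanish, while \<open>\<Psi>^(q^m)\<close> is congruent, at the points
  of trace \<open>c\<close>, to a polynomial of degree so small that it can be made zero by a choice of the coefficients.\<close>

lemma stepanov_polynomial:
  fixes m l :: nat and c :: 'w
  assumes ml: "0 < m" "m \<le> l" and c: "c \<in> k"
  obtains \<Psi> where "\<Psi> \<in> kpoly" "\<Psi> \<noteq> 0" "degree \<Psi> \<le> q ^ (m + l - 1) + (3 * d + 4) * q ^ l"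
    "\<And>P m' r. P \<in> kirr m' \<Longrightarrow> m' * r = m + l \<Longrightarrow> trace_sum (P ^ r) = c \<Longrightarrow> P dvd \<Psi>"
proof -
  \<comment> \<open>Large enough for the number \<open>q ^ l * I'\<close> of free coefficients to
    exceed \<open>E\<close>: the terms \<open>q ^ (m + l - 1)\<close> agree on both sides, and
    \<open>(2 * d + 3) * q ^ l\<close> absorbs the rest of \<open>E\<close>.\<close>
  define I' where "I' = q ^ (m - 1) + 2 * d + 3"
  define X where "X = {..<q ^ (l - 1)} \<times> {..<q} \<times> {..<I'}"
  have finX: "finite X" by (simp add: X_def)
  have cX: "card X = q ^ l * I'" using ml power_Suc[of q "l - 1"] by (simp add: X_def card_cartesian_product mult.assoc[symmetric] mult.commute)
  define w where "w = (\<lambda>(i, j, i'). Polynomial.monom 1 (i + q ^ l * i') * Apol l ^ j)"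
  \<comment> \<open>What the \<open>q ^ m\<close>-th power of \<open>w\<close> becomes at the points
    of trace \<open>c\<close>: there T^(q^(m+l)) is T, and \<open>Apol l ^ (q ^ m)\<close> is
    \<open>c - Apol m\<close> because \<open>Apol (m + l)\<close> takes the value
    \<open>c\<close>.\<close>
  define v where "v = (\<lambda>(i, j, i'). Polynomial.monom 1 (q ^ m * i + i') * ([:c:] - Apol m) ^ j)"
  define D where "D = (\<lambda>(i, j, i'). i + q ^ l * i' + j * (d * q ^ (l - 1)))"
  define Psi where "Psi \<delta> = (\<Sum>x\<in>X. Polynomial.smult (\<delta> x) (w x))" for \<delta>
  define Phi where "Phi \<delta> = (\<Sum>x\<in>X. Polynomial.smult (\<delta> x) (v x))" for \<delta>
  define E where "E = q ^ (m + l - 1) + d * q ^ m + I'"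
  have ql: "q ^ l = q * q ^ (l - 1)" "q ^ m = q * q ^ (m - 1)" using ml power_Suc[of q "l - 1"] power_Suc[of q "m - 1"] by auto
  have qml: "q ^ (m + l - 1) = q ^ m * q ^ (l - 1)" "q ^ (m + l - 1) = q ^ l * q ^ (m - 1)"
    using ml by (auto simp: power_add[symmetric] add.commute)
  have Phi_lt: "Phi \<delta> \<in> kpoly_lt E" if \<delta>: "\<And>x. x \<in> X \<Longrightarrow> \<delta> x \<in> k" for \<delta>
  proof -
    have "poly.coeff (v x) i = 0" if xX: "x \<in> X" and iE: "i \<ge> E" for x i
    proof (rule coeff_eq_0)
      obtain a j a' where x: "x = (a, j, a')" "a < q ^ (l - 1)" "j < q" "a' < I'"
        using xX unfolding X_def by blast
      have "degree ([:c:] - Apol m) \<le> d * q ^ (m - 1)"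
        using degree_diff_le[of "[:c:]" "d * q ^ (m - 1)" "Apol m"] Apol_degree(1)[OF ml(1)] by simp
      then have "degree (([:c:] - Apol m) ^ j) \<le> d * q ^ (m - 1) * j"
        using degree_power_le[of "[:c:] - Apol m" j] by (meson le_trans mult_le_mono1)
      also have "\<dots> \<le> d * q ^ m" using x(3) ql(2) by (simp add: mult.commute mult_le_mono)
      finally have "degree (v x) \<le> (q ^ m * a + a') + d * q ^ m"
        using degree_mult_le[of "Polynomial.monom 1 (q ^ m * a + a')" "([:c:] - Apol m) ^ j"]
          degree_monom_le[of "1::'w" "q ^ m * a + a'"] unfolding x(1) v_def prod.case by linarith
      moreover have "q ^ m * a \<le> q ^ (m + l - 1)" unfolding qml(1) using x(2) by simp
      ultimately have "degree (v x) < E" unfolding E_def using x(4) by linarith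
      then show "degree (v x) < i" using iE by simp
    qed
    then show ?thesis unfolding kpoly_lt_def Phi_def
      using \<delta> by (auto simp: coeff_sum intro!: kpoly_sum kpoly_smult_k sum.neutral)
  qed
  have EX: "E < q ^ l * I'"
  proof -
    have mono: "q ^ m \<le> q ^ l" "q ^ (m - 1) < q ^ m" "2 \<le> q ^ m"
    proof -
      show "q ^ m \<le> q ^ l" using ml q_ge_2 by (intro power_increasing) auto
      show "q ^ (m - 1) < q ^ m" using ml q_ge_2 by (intro power_strict_increasing) auto
      show "2 \<le> q ^ m" using self_le_power[of q m] ml q_ge_2 by simp
    qed
    have "I' \<le> q ^ (m - 1) + (2 * d + 3)" by (simp add: I'_def)
    also have "\<dots> < q ^ m + (d + 2) * q ^ m"
    proof -
      have "(d + 2) * 2 \<le> (d + 2) * q ^ m" using mono(3) by (rule mult_le_mono2)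
      then show ?thesis using mono(2) by simp
    qed
    also have "\<dots> = (d + 3) * q ^ m" by (simp add: algebra_simps)
    finally have "E < q ^ (m + l - 1) + d * q ^ m + (d + 3) * q ^ m" unfolding E_def by simp
    also have "\<dots> = q ^ (m + l - 1) + (2 * d + 3) * q ^ m" by (simp add: algebra_simps)
    also have "\<dots> \<le> q ^ (m + l - 1) + (2 * d + 3) * q ^ l" using mono(1) by simp
    also have "\<dots> = q ^ l * I'" unfolding qml(2) I'_def by (simp add: algebra_simps)
    finally show ?thesis .
  qed
  \<comment> \<open>Pigeonhole in place of solving a linear system: two coefficient vectors have the
    same \<open>Phi\<close>, and \<open>Phi\<close> is additive, so their difference is a nontrivial
    zero.\<close>
  have "\<not> inj_on Phi (X \<rightarrow>\<^sub>E k)"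
  proof
    assume inj: "inj_on Phi (X \<rightarrow>\<^sub>E k)"
    have "card (X \<rightarrow>\<^sub>E k) \<le> card (kpoly_lt E)"
      by (rule card_inj_on_le[OF inj]) (auto intro!: Phi_lt simp: finite_kpoly_lt)
    then have "q ^ (q ^ l * I') \<le> q ^ E" using finX by (simp add: card_PiE cX card_kpoly_lt q_def[symmetric])
    moreover have "1 < q" using q_ge_2 by simp
    ultimately have "q ^ l * I' \<le> E" by (simp only: power_le_imp_le_exp)
    then show False using EX by simp
  qed
  then obtain c1 c2 where c12: "c1 \<in> X \<rightarrow>\<^sub>E k" "c2 \<in> X \<rightarrow>\<^sub>E k" "Phi c1 = Phi c2" "c1 \<noteq> c2"
    unfolding inj_on_def by blast
  define \<delta> where "\<delta> x = c1 x - c2 x" for x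
  have \<delta>k: "\<delta> x \<in> k" if "x \<in> X" for x using c12 that unfolding \<delta>_def by (intro diff_k) auto
  have "\<exists>x\<in>X. \<delta> x \<noteq> 0"
  proof (rule ccontr)
    assume "\<not> ?thesis"
    then have "c1 = c2" using c12 by (intro PiE_ext[OF c12(1,2)]) (auto simp: \<delta>_def)
    then show False using c12 by simp
  qed
  then have ne: "{x \<in> X. \<delta> x \<noteq> 0} \<noteq> {}" by blast
  have Phi0: "Phi \<delta> = 0"
    using c12(3) by (simp add: Phi_def \<delta>_def smult_diff_left sum_subtractf)
  have Pk: "Psi \<delta> \<in> kpoly" unfolding Psi_def by (intro kpoly_sum kpoly_smult_k \<delta>k)
  \<comment> \<open>Over a ring with zero divisors the exact degree of a power is not immediate, so
    a degree bound is paired with the coefficient at that place.\<close>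
  have wdeg: "degree (w x) \<le> D x" "poly.coeff (w x) (D x) = fc d ^ (fst (snd x))" for x
  proof -
    obtain i j i' where x: "x = (i, j, i')" by (cases x)
    have dA: "degree (Apol l) = d * q ^ (l - 1)" and lA: "poly.coeff (Apol l) (d * q ^ (l - 1)) = fc d"
      using Apol_degree[of l] ml by auto
    have dj: "degree (Apol l ^ j) \<le> j * (d * q ^ (l - 1))" and cj: "poly.coeff (Apol l ^ j) (j * (d * q ^ (l - 1))) = fc d ^ j"
    proof -
      show "degree (Apol l ^ j) \<le> j * (d * q ^ (l - 1))"
        using degree_power_le[of "Apol l" j] dA by (simp add: mult.commute)
      show "poly.coeff (Apol l ^ j) (j * (d * q ^ (l - 1))) = fc d ^ j"
      proof (induction j)
        case (Suc j)
        have "poly.coeff (Apol l * Apol l ^ j) (d * q ^ (l - 1) + j * (d * q ^ (l - 1)))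
          = fc d * fc d ^ j"
        proof (cases "degree (Apol l ^ j) = j * (d * q ^ (l - 1))")
          case True
          then show ?thesis using coeff_mult_degree_sum[of "Apol l" "Apol l ^ j"] dA lA Suc by simp
        next
          case False
          have "degree (Apol l ^ j) \<le> j * (d * q ^ (l - 1))"
            using degree_power_le[of "Apol l" j] dA by (simp add: mult.commute)
          then have lt: "degree (Apol l ^ j) < j * (d * q ^ (l - 1))" using False by simp
          then have z: "fc d ^ j = 0" using Suc by (simp add: coeff_eq_0)
          have "degree (Apol l * Apol l ^ j) < d * q ^ (l - 1) + j * (d * q ^ (l - 1))"
            using degree_mult_le[of "Apol l" "Apol l ^ j"] dA lt by linarith
          then show ?thesis using z by (simp add: coeff_eq_0)
        qed
        then show ?case by simp
      qed simp
    qed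
    show "degree (w x) \<le> D x"
      using degree_mult_le[of "Polynomial.monom 1 (i + q ^ l * i')" "Apol l ^ j"] dj
        degree_monom_le[of "1::'w" "i + q ^ l * i'"] unfolding x w_def D_def prod.case by linarith
    show "poly.coeff (w x) (D x) = fc d ^ (fst (snd x))"
      using cj unfolding x w_def D_def prod.case by (simp add: coeff_monom_mult)
  qed
  \<comment> \<open>The degree modulo \<open>q ^ (l - 1)\<close> is \<open>i\<close>; after its
    removal, the residue modulo \<open>q\<close> gives \<open>j * d\<close> and hence
    \<open>j < q\<close>, and then \<open>i'\<close> is determined.\<close>
  have Dinj: "inj_on D X"
  proof (rule inj_onI)
    fix x y assume xy: "x \<in> X" "y \<in> X" "D x = D y"
    obtain i j i' where x: "x = (i, j, i')" "i < q ^ (l - 1)" "j < q" using xy(1) by (auto simp: X_def)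
    obtain a b a' where y: "y = (a, b, a')" "a < q ^ (l - 1)" "b < q" using xy(2) by (auto simp: X_def)
    have Dx: "D x = i + q ^ (l - 1) * (q * i' + j * d)" unfolding x(1) D_def ql(1) by (simp add: algebra_simps)
    have Dy: "D y = a + q ^ (l - 1) * (q * a' + b * d)" unfolding y(1) D_def ql(1) by (simp add: algebra_simps)
    have "D x mod q ^ (l - 1) = i" "D y mod q ^ (l - 1) = a" unfolding Dx Dy using x y by auto
    then have ia: "i = a" using xy(3) by simp
    then have jj: "q * i' + j * d = q * a' + b * d" using xy(3) Dx Dy q_ge_2 by simp
    then have "(q * i' + j * d) mod q = (q * a' + b * d) mod q" by simp
    then have "(j * d) mod q = (b * d) mod q" by simp
    then have "[j * d = b * d] (mod q)" by (simp add: cong_def)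
    then have "[j = b] (mod q)" using coprime_d_q by (simp add: cong_mult_rcancel_nat)
    then have "j = b" using x y by (simp add: cong_less_modulus_unique_nat)
    then show "x = y" using jj ia x(1) y(1) q_ge_2 by auto
  qed
  have Pnz: "Psi \<delta> \<noteq> 0"
  proof -
    have "Max (D ` {x \<in> X. \<delta> x \<noteq> 0}) \<in> D ` {x \<in> X. \<delta> x \<noteq> 0}" using ne finX by (intro Max_in) auto
    then obtain x where x: "x \<in> X" "\<delta> x \<noteq> 0" "D x = Max (D ` {x \<in> X. \<delta> x \<noteq> 0})" by auto
    have mx: "D y \<le> D x" if "y \<in> X" "\<delta> y \<noteq> 0" for y
      unfolding x(3) using that finX by (intro Max_ge) auto
    have "poly.coeff (Psi \<delta>) (D x) = (\<Sum>y\<in>X. \<delta> y * poly.coeff (w y) (D x))"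
      by (simp add: Psi_def coeff_sum)
    also have "\<dots> = (\<Sum>y\<in>{x}. \<delta> y * poly.coeff (w y) (D x))"
    proof (rule sum.mono_neutral_right[OF finX])
      show "\<forall>y\<in>X - {x}. \<delta> y * poly.coeff (w y) (D x) = 0"
      proof
        fix y assume y: "y \<in> X - {x}"
        show "\<delta> y * poly.coeff (w y) (D x) = 0"
        proof (cases "\<delta> y = 0")
          case False
          then have "D y < D x" using mx[of y] y x Dinj by (metis DiffD1 DiffD2 inj_onD le_neq_implies_less singletonI)
          then have "degree (w y) < D x" using wdeg(1)[of y] by simp
          then show ?thesis by (simp add: coeff_eq_0)
        qed simp
      qed
    qed (use x in auto)
    also have "\<dots> = \<delta> x * fc d ^ (fst (snd x))" using wdeg(2) by simp
    finally have co: "poly.coeff (Psi \<delta>) (D x) = \<delta> x * fc d ^ (fst (snd x))" .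
    \<comment> \<open>The exponent 0 is treated apart since \<open>fc d ^ 0 = 1\<close> need not lie
      in \<open>k\<close>.\<close>
    have "\<delta> x * fc d ^ n \<noteq> 0" for n
    proof (cases "n = 0")
      case False
      then show ?thesis using mult_zero_k[OF \<delta>k[OF x(1)] power_k[OF fc_k, of n d]] power_nz_k[OF fc_k fc_d_nz] x(2) by auto
    qed (use x in simp)
    then show ?thesis using co by (metis coeff_0)
  qed
  have Pdeg: "degree (Psi \<delta>) \<le> q ^ (m + l - 1) + (3 * d + 4) * q ^ l"
  proof (rule degree_le, intro allI impI)
    fix t assume t: "q ^ (m + l - 1) + (3 * d + 4) * q ^ l < t"
    have "poly.coeff (w x) t = 0" if xX: "x \<in> X" for x
    proof (rule coeff_eq_0)
      obtain i j i' where x: "x = (i, j, i')" "i < q ^ (l - 1)" "j < q" "i' < I'"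
        using xX unfolding X_def by blast
      have "q ^ l * i' \<le> q ^ l * I'" using x by simp
      moreover have "j * (d * q ^ (l - 1)) \<le> q * (d * q ^ (l - 1))" using x(3) by (intro mult_le_mono1) simp
      moreover have "q * (d * q ^ (l - 1)) = d * q ^ l" using ql by simp
      moreover have "q ^ (l - 1) \<le> q ^ l" using q_ge_2 by (intro power_increasing) auto
      ultimately have "D x \<le> q ^ l + q ^ l * I' + d * q ^ l" using x(2) unfolding x(1) D_def prod.case by linarith
      also have "\<dots> = q ^ (m + l - 1) + (3 * d + 4) * q ^ l" unfolding qml(2) I'_def by (simp add: algebra_simps)
      finally show "degree (w x) < t" using t wdeg(1)[of x] by linarith
    qed
    then show "poly.coeff (Psi \<delta>) t = 0" by (simp add: Psi_def coeff_sum)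
  qed
  have "P dvd Psi \<delta>" if P: "P \<in> kirr m'" and mr: "m' * r = m + l" and tr: "trace_sum (P ^ r) = c" for P m' r
  proof -
    have "P dvd Apol (m + l) - [:c:]" using kirr_trace[OF P, of r] mr tr by simp
    then have "P dvd Apol l ^ (q ^ m) - ([:c:] - Apol m)" unfolding Apol_add by (simp add: algebra_simps)
    then have dB: "P dvd Polynomial.smult e (Apol l ^ (q ^ m) - ([:c:] - Apol m))" by (rule dvd_smult)
    have "P dvd Polynomial.smult e (Polynomial.monom 1 1) ^ (q ^ (m' * r)) - Polynomial.smult e (Polynomial.monom 1 1)"
      by (rule kirr_fermat_iter[OF P]) (simp add: kpoly_smult_k e_in)
    then have dT: "P dvd Polynomial.smult e (Polynomial.monom 1 (q ^ (m + l)) - Polynomial.monom 1 1)"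
      unfolding mr by (simp add: smult_power monom_power k_fermat_iter e_in smult_diff_right)
    \<comment> \<open>The power map fixes \<open>\<delta> x\<close>, being in \<open>k\<close>.
      Modulo \<open>P\<close>, Fermat for T replaces \<open>u\<close> by \<open>u'\<close> and the
      trace condition replaces \<open>B\<close> by \<open>B'\<close>.\<close>
    have "P dvd Polynomial.smult (\<delta> x) (w x) ^ (q ^ m) - Polynomial.smult (\<delta> x) (v x)" if x: "x \<in> X" for x
    proof -
      obtain i j i' where xe: "x = (i, j, i')" by (cases x)
      define B B' u u' where "B = (Apol l ^ (q ^ m)) ^ j" and "B' = ([:c:] - Apol m) ^ j"
        and "u = Polynomial.monom (1::'w) (q ^ (m + l)) ^ i'" and "u' = Polynomial.monom (1::'w) 1 ^ i'"
      define s where "s = Polynomial.monom (1::'w) (q ^ m * i)"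
      have "Polynomial.smult (\<delta> x) (w x) ^ (q ^ m) = Polynomial.smult (\<delta> x) (w x ^ (q ^ m))"
        by (simp add: smult_power k_fermat_iter[OF \<delta>k[OF x]])
      also have "w x ^ (q ^ m) = s * u * B"
      proof -
        have "Polynomial.monom (1::'w) (i + q ^ l * i') ^ (q ^ m) = s * u"
          by (simp add: s_def u_def monom_power mult_monom power_add algebra_simps)
        moreover have "(Apol l ^ j) ^ (q ^ m) = B" by (simp add: B_def power_mult[symmetric] mult.commute)
        ultimately show ?thesis unfolding xe w_def prod.case power_mult_distrib by simp
      qed
      finally have 1: "Polynomial.smult (\<delta> x) (w x) ^ (q ^ m) = Polynomial.smult (\<delta> x) (s * u * B)" .
      have 2: "v x = s * u' * B'"
        unfolding xe v_def prod.case by (simp add: s_def u'_def B'_def monom_power mult_monom)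
      have "Polynomial.smult (\<delta> x) (w x) ^ (q ^ m) - Polynomial.smult (\<delta> x) (v x)
        = Polynomial.smult (\<delta> x) (u - u') * (s * B) + Polynomial.smult (\<delta> x) (B - B') * (s * u')"
        unfolding 1 2 by (simp add: algebra_simps smult_diff_right)
      moreover have "P dvd Polynomial.smult (\<delta> x) (u - u')"
        unfolding u_def u'_def by (rule dvd_smult_power_diff[OF dT \<delta>k[OF x]])
      moreover have "P dvd Polynomial.smult (\<delta> x) (B - B')"
        unfolding B_def B'_def by (rule dvd_smult_power_diff[OF dB \<delta>k[OF x]])
      ultimately show ?thesis by (simp only: dvd_add dvd_mult2)
    qed
    then have "P dvd (\<Sum>x\<in>X. Polynomial.smult (\<delta> x) (w x) ^ (q ^ m) - Polynomial.smult (\<delta> x) (v x))"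
      by (rule dvd_sum)
    also have "\<dots> = Psi \<delta> ^ (q ^ m) - Phi \<delta>"
      unfolding Psi_def Phi_def sum_subtractf by (subst frobenius_sum) (auto simp: kpoly_smult_k \<delta>k)
    finally have "P dvd Psi \<delta> ^ (q ^ m)" by (simp add: Phi0)
    then show ?thesis by (rule kirr_prime_power[OF P Pk])
  qed
  then show ?thesis using that[OF Pk Pnz Pdeg] by blast
qed

text \<open>With Q = q^(m+l) and \<open>l\<close> close to \<open>m\<close>, this is the expected
  number Q/q of points of trace \<open>c\<close> plus an error of order Q^(1/2) with a constant
  depending on \<open>q\<close>.\<close>

lemma sum_degree_trace_fibre_le:
  assumes ml: "0 < m" "m \<le> l" and c: "c \<in> k"
  shows "(\<Sum>(P, r)\<in>{x \<in> prime_powers (m + l). trace_sum (fst x ^ snd x) = c}. degree P)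
    \<le> q ^ (m + l - 1) + (3 * d + 4) * q ^ l"
proof -
  define S where "S = {x \<in> prime_powers (m + l). trace_sum (fst x ^ snd x) = c}"
  obtain \<Psi> where \<Psi>: "\<Psi> \<in> kpoly" "\<Psi> \<noteq> 0" "degree \<Psi> \<le> q ^ (m + l - 1) + (3 * d + 4) * q ^ l"
    "\<And>P m' r. P \<in> kirr m' \<Longrightarrow> m' * r = m + l \<Longrightarrow> trace_sum (P ^ r) = c \<Longrightarrow> P dvd \<Psi>"
    using stepanov_polynomial[OF assms] by metis
  have finS: "finite S" unfolding S_def using finite_prime_powers by auto
  have inj: "inj_on fst S"
  proof (rule inj_onI)
    fix x y assume xy: "x \<in> S" "y \<in> S" "fst x = fst y"
    then have 1: "snd x * degree (fst x) = m + l" "snd y * degree (fst y) = m + l"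
      by (auto simp: S_def prime_powers_def)
    then have "degree (fst x) \<noteq> 0" using ml by (cases "degree (fst x) = 0") auto
    moreover have "snd x * degree (fst x) = snd y * degree (fst x)" using 1 xy(3) by simp
    ultimately have "snd x = snd y" by (simp only: mult_cancel2 simp_thms)
    then show "x = y" using xy by (simp add: prod_eq_iff)
  qed
  have "(\<Sum>(P, r)\<in>S. degree P) = (\<Sum>P\<in>fst ` S. degree P)"
    using sum.reindex[OF inj, of degree] by (simp add: case_prod_beta)
  also have "\<dots> \<le> degree \<Psi>"
  proof (rule sum_degree_kirrs_le)
    show "P dvd \<Psi>" if PS: "P \<in> fst ` S" for P
    proof -
      obtain r where r: "(P, r) \<in> S" using PS by auto
      then show ?thesis using \<Psi>(4)[of P "degree P" r] by (auto simp: S_def prime_powers_def kirrs_iff mult.commute)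
    qed
  qed (use finS \<Psi> in \<open>auto simp: S_def prime_powers_def\<close>)
  finally show ?thesis using \<Psi>(3) unfolding S_def by simp
qed

text \<open>Upper bounds for all fibres imply lower bounds, because the fibre sizes
  \<open>M c\<close> add up exactly to \<open>q ^ (m + l)\<close>. The mean \<open>N\<close> may be
  subtracted since the values of \<open>\<psi>\<close> sum to 0.\<close>

lemma mangoldt_sum_theta_bound:
  assumes ml: "0 < m" "m \<le> l"
  shows "cmod (mangoldt_sum \<theta> (m + l)) \<le> 2 * real q * ((3 * real d + 4) * real q ^ l)"
proof -
  define M where "M c = (\<Sum>(P, r)\<in>{x \<in> prime_powers (m + l). trace_sum (fst x ^ snd x) = c}. degree P)" for c
  define N where "N = q ^ (m + l - 1)"
  define B where "B = (3 * d + 4) * q ^ l"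
  have Mle: "M c \<le> N + B" if "c \<in> k" for c
    using sum_degree_trace_fibre_le[OF ml that] by (simp add: M_def N_def B_def)
  have im: "(\<lambda>x. trace_sum (fst x ^ snd x)) ` prime_powers (m + l) \<subseteq> k"
    by (auto simp: prime_powers_def kirrs_iff intro!: trace_sum_k[OF kmonic_power[OF kirr_kmonic]])
  have grp: "(\<Sum>c\<in>k. \<Sum>x\<in>{x \<in> prime_powers (m + l). trace_sum (fst x ^ snd x) = c}. h x)
      = (\<Sum>x\<in>prime_powers (m + l). h x)" for h :: "_ \<Rightarrow> complex"
    by (rule sum.group[OF finite_prime_powers finite_k im])
  have "complex_of_nat (\<Sum>c\<in>k. M c) = (\<Sum>c\<in>k. \<Sum>x\<in>{x \<in> prime_powers (m + l). trace_sum (fst x ^ snd x) = c}. of_nat (degree (fst x)))"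
    by (simp add: M_def case_prod_beta)
  also have "\<dots> = of_nat (\<Sum>(P, r)\<in>prime_powers (m + l). degree P)" unfolding grp by (simp add: case_prod_beta)
  also have "\<dots> = of_nat (q ^ (m + l))" using sum_degree_prime_powers[of "m + l"] ml by simp
  finally have sumM: "(\<Sum>c\<in>k. M c) = q ^ (m + l)" by (simp only: of_nat_eq_iff)
  have qN: "q ^ (m + l) = q * N" using ml unfolding N_def by (cases "m + l") auto
  have sum0: "(\<Sum>c\<in>k. real (M c) - real N) = 0"
    using sumM qN by (simp add: sum_subtractf q_def[symmetric] flip: of_nat_sum)
  have psisum: "(\<Sum>c\<in>k. \<psi> c) = 0"
  proof -
    obtain x where x: "x \<in> k" "\<psi> x \<noteq> 1" using psi_nontrivial by blast
    have inj: "inj_on ((+) x) k" by (auto simp: inj_on_def)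
    have "(+) x ` k = k" by (rule endo_inj_surj[OF finite_k _ inj]) (auto intro: add_k x)
    then have "(\<Sum>c\<in>k. \<psi> c) = (\<Sum>c\<in>k. \<psi> (x + c))" using sum.reindex[OF inj, of \<psi>] by simp
    also have "\<dots> = \<psi> x * (\<Sum>c\<in>k. \<psi> c)" using x by (simp add: psi_add sum_distrib_left)
    finally show ?thesis using x(2) by (metis mult_cancel_right1)
  qed
  have "mangoldt_sum \<theta> (m + l) = (\<Sum>c\<in>k. \<Sum>x\<in>{x \<in> prime_powers (m + l). trace_sum (fst x ^ snd x) = c}. of_nat (degree (fst x)) * \<theta> (fst x ^ snd x))"
    unfolding grp mangoldt_sum_def by (simp add: case_prod_beta)
  also have "\<dots> = (\<Sum>c\<in>k. of_nat (M c) * \<psi> c)"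
    unfolding M_def by (intro sum.cong refl) (auto simp: \<theta>_def case_prod_beta sum_distrib_right intro!: sum.cong)
  also have "\<dots> = (\<Sum>c\<in>k. complex_of_real (real (M c) - real N) * \<psi> c)"
    using psisum by (simp add: left_diff_distrib sum_subtractf sum_distrib_left[symmetric])
  finally have "cmod (mangoldt_sum \<theta> (m + l)) \<le> (\<Sum>c\<in>k. cmod (complex_of_real (real (M c) - real N) * \<psi> c))"
    by (simp only: norm_sum)
  also have "\<dots> = (\<Sum>c\<in>k. \<bar>real (M c) - real N\<bar>)"
    using psi_norm by (intro sum.cong refl) (simp add: norm_mult del: of_real_diff)
  \<comment> \<open>A number t with t \<le> B satisfies |t| \<le> 2 B - t, and the deviations from
    the mean sum to 0.\<close>
  also have "\<dots> \<le> (\<Sum>c\<in>k. 2 * real B - (real (M c) - real N))"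
  proof (rule sum_mono)
    fix c assume "c \<in> k"
    then have "real (M c) \<le> real N + real B" using Mle by (metis of_nat_add of_nat_le_iff)
    then show "\<bar>real (M c) - real N\<bar> \<le> 2 * real B - (real (M c) - real N)" by linarith
  qed
  also have "\<dots> = 2 * real q * real B" using sum0 by (simp add: sum_subtractf q_def)
  finally show ?thesis by (simp add: B_def)
qed

end

section \<open>The Weil bound\<close>

text \<open>The coefficient next to the leading one is minus the sum of the roots, of which there
  are \<open>degree M\<close> with multiplicity; they are split off one by one.\<close>

lemma monic_complex_poly_root_sum_bound:
  fixes M :: "complex poly" and B :: real
  assumes "lead_coeff M = 1" "\<And>z. poly M z = 0 \<Longrightarrow> cmod z \<le> B"
  shows "degree M > 0 \<Longrightarrow> cmod (poly.coeff M (degree M - 1)) \<le> real (degree M) * B"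
  using assms
proof (induction "degree M" arbitrary: M)
  case (Suc n)
  have "\<not> constant (poly M)" using Suc.hyps(2) constant_degree[of M] by simp
  then obtain z where z: "poly M z = 0" using fundamental_theorem_of_algebra by blast
  then obtain K where K: "M = [:- z, 1:] * K" by (auto simp: poly_eq_0_iff_dvd)
  have Knz: "K \<noteq> 0" using K Suc.hyps(2) by auto
  then have dM: "degree M = Suc (degree K)" "lead_coeff M = lead_coeff K"
    unfolding K using monic_degree_mult(1,2)[of "[:- z, 1:]" K] by auto
  have zB: "cmod z \<le> B" using z Suc.prems by blast
  have lK: "lead_coeff K = 1" using dM Suc.prems by simp
  have c: "poly.coeff M (degree K) = (if degree K = 0 then 0 else poly.coeff K (degree K - 1)) - z"
    unfolding K using lK by (cases "degree K") (auto simp: coeff_pCons)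
  have "cmod (if degree K = 0 then 0 else poly.coeff K (degree K - 1)) \<le> real (degree K) * B"
  proof (cases "degree K = 0")
    case False
    then show ?thesis using Suc.hyps(1)[of K] dM Suc.hyps(2) lK Suc.prems(3) K by auto
  qed simp
  then have "cmod (poly.coeff M (degree K)) \<le> real (degree K) * B + B"
    unfolding c using norm_triangle_ineq4[of "if degree K = 0 then 0 else poly.coeff K (degree K - 1)" z] zB by linarith
  then show ?case using dM by (simp add: algebra_simps)
qed simp

text \<open>The power sums \<open>S\<close> are the coefficients of the logarithmic derivative of the polynomial \<open>L\<close>,
  whose poles are the roots of \<open>L\<close>.\<close>

lemma no_root_of_log_derivative_bound:
  fixes L :: "complex poly" and S :: "nat \<Rightarrow> complex"
  assumes L0: "poly L 0 \<noteq> 0" and S0: "S 0 = 0"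
    and rec: "\<And>n. of_nat n * poly.coeff L n = (\<Sum>j=0..n. S j * poly.coeff L (n - j))"
    and bound: "\<And>n. n > 0 \<Longrightarrow> cmod (S n) \<le> C * B ^ n" and B: "B > 0"
    and z: "cmod z * B < 1"
  shows "poly L z \<noteq> 0"
proof
  assume root: "poly L z = 0"
  define F where "F = Abs_fps S"
  have znz: "z \<noteq> 0" using root L0 by auto
  have Lnz: "L \<noteq> 0" using L0 by auto
  \<comment> \<open>A radius strictly beyond \<open>cmod z\<close>, so that \<open>z\<close> is
    interior to the disc of convergence and the series is continuous there.\<close>
  obtain r where r: "cmod z < r" "r * B < 1"
  proof -
    have "cmod z < 1 / B" using z B by (simp add: field_simps)
    then obtain r where "cmod z < r" "r < 1 / B" using dense by blast
    then show ?thesis using that B by (simp add: field_simps)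
  qed
  have rpos: "r > 0" using r(1) norm_ge_zero[of z] by linarith
  have C: "C \<ge> 0"
  proof -
    have "cmod (S 1) \<le> C * B" using bound[of 1] by simp
    then have "0 \<le> C * B" by (rule order_trans[OF norm_ge_zero])
    then show ?thesis using B by (simp add: zero_le_mult_iff)
  qed
  have "summable (\<lambda>n. S n * (of_real r) ^ n)"
  proof (rule summable_comparison_test')
    show "summable (\<lambda>n. C * (r * B) ^ n)" using r(2) rpos B by (intro summable_mult summable_geometric) simp
    show "norm (S n * of_real r ^ n) \<le> C * (r * B) ^ n" if "n \<ge> 0" for n
    proof (cases "n = 0")
      case False
      then have "cmod (S n) * r ^ n \<le> C * B ^ n * r ^ n" using bound[of n] rpos by (intro mult_right_mono) auto
      then show ?thesis using rpos by (simp add: norm_mult norm_power power_mult_distrib mult.assoc mult.commute)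
    qed (simp add: S0 C)
  qed
  then have "conv_radius S \<ge> norm (of_real r :: complex)" by (rule conv_radius_geI)
  then have rad: "fps_conv_radius F \<ge> ereal r" using rpos by (simp add: F_def fps_conv_radius_def)
  have ev: "eval_fps F w * poly L w = w * poly (pderiv L) w" if "cmod w < r" for w
  proof -
    have "F * fps_of_poly L = fps_of_poly (pCons 0 (pderiv L))"
    proof (rule fps_ext)
      fix n
      have "(F * fps_of_poly L) $ n = of_nat n * poly.coeff L n"
        unfolding rec by (simp add: fps_mult_nth F_def)
      also have "\<dots> = fps_of_poly (pCons 0 (pderiv L)) $ n"
        by (cases n) (simp_all add: coeff_pderiv)
      finally show "(F * fps_of_poly L) $ n = fps_of_poly (pCons 0 (pderiv L)) $ n" .
    qed
    moreover have "ereal (norm w) < fps_conv_radius F" using that rad by (simp add: less_le_trans[of _ "ereal r"])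
    then have "eval_fps (F * fps_of_poly L) w = eval_fps F w * eval_fps (fps_of_poly L) w"
      by (intro eval_fps_mult) auto
    ultimately show ?thesis by (simp del: fps_of_poly_pCons)
  qed
  \<comment> \<open>Near the root, L(w) = (w - z)^(m+1) K(w) with K(z) nonzero. Dividing F L = w L'
    by (w - z)^m gives G(w) = 0 off \<open>z\<close>; by continuity G(z) = (m+1) z K(z) vanishes as
    well, a contradiction.\<close>
  obtain K where K: "L = [:- z, 1:] ^ Polynomial.order z L * K" "\<not> [:- z, 1:] dvd K"
    using order_decomp[OF Lnz, of z] by blast
  have Kz: "poly K z \<noteq> 0" using K(2) by (simp add: poly_eq_0_iff_dvd)
  have "Polynomial.order z L \<noteq> 0" using root Lnz by (simp add: order_root)
  then obtain m where m: "Polynomial.order z L = Suc m" using not0_implies_Suc by blast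
  define G where "G w = w * (of_nat (Suc m) * poly K w + (w - z) * poly (pderiv K) w) - eval_fps F w * ((w - z) * poly K w)" for w
  have G0: "G w = 0" if "w \<noteq> z" "cmod w < r" for w
  proof -
    have pd: "pderiv L = Polynomial.smult (of_nat (Suc m)) ([:- z, 1:] ^ m) * K + [:- z, 1:] ^ Suc m * pderiv K"
      unfolding K(1)[unfolded m] pderiv_mult pderiv_power_Suc by (simp add: pderiv_pCons algebra_simps)
    have p1: "poly (pderiv L) w = (w - z) ^ m * (of_nat (Suc m) * poly K w + (w - z) * poly (pderiv K) w)"
      unfolding pd by (simp add: algebra_simps)
    have p2: "poly L w = (w - z) ^ m * ((w - z) * poly K w)"
      by (subst K(1)) (simp add: m algebra_simps)
    have "(w - z) ^ m * G w = w * poly (pderiv L) w - eval_fps F w * poly L w"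
      unfolding G_def p1 p2 by (simp add: algebra_simps)
    then have "(w - z) ^ m * G w = 0" using ev[OF that(2)] by simp
    then show ?thesis using that by simp
  qed
  have zr: "ereal (norm z) < fps_conv_radius F" using r(1) rad by (simp add: less_le_trans[of _ "ereal r"])
  have "isCont G z" unfolding G_def
    using zr by (intro continuous_intros) auto
  then have "(G \<longlongrightarrow> G z) (at z)" by (simp add: isCont_def)
  moreover have "(G \<longlongrightarrow> 0) (at z)"
  proof (rule tendsto_eventually)
    have "open {w. cmod w < r}" by (intro open_Collect_less continuous_intros)
    then have "\<forall>\<^sub>F w in at z. cmod w < r" using r(1) eventually_at_topological[of _ z UNIV] by blast
    then show "\<forall>\<^sub>F w in at z. G w = 0"
      using eventually_neq_at_within[of z z UNIV] by eventually_elim (use G0 in auto)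
  qed
  ultimately have "G z = 0" using tendsto_unique[OF _ \<open>(G \<longlongrightarrow> G z) (at z)\<close>] by (metis at_neq_bot)
  then show False using znz Kz by (simp add: G_def del: of_nat_Suc)
qed

text \<open>\<open>M\<close> is z^(d-1) L(1/z) for the polynomial L with coefficients
  \<open>a\<close>; it is monic, and its nonzero roots are the reciprocals of the roots of L, hence
  bounded by \<open>B\<close>. As \<open>a 1\<close> is minus the sum of the roots of
  \<open>M\<close>, growth of \<open>S\<close> at rate \<open>B\<close> with any constant
  \<open>C\<close> suffices.\<close>

lemma power_sum_bound_of_growth:
  fixes a S :: "nat \<Rightarrow> complex"
  assumes a0: "a 0 = 1" and az: "\<And>n. n \<ge> d \<Longrightarrow> a n = 0"
    and rec: "\<And>n. of_nat n * a n = (\<Sum>j=1..n. S j * a (n - j))"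
    and bound: "\<And>n. n > 0 \<Longrightarrow> cmod (S n) \<le> C * B ^ n" and B: "B > 0"
  shows "cmod (a 1) \<le> (real d - 1) * B"
proof (cases "d \<le> 1")
  case True
  then have "d = 1" using a0 az[of 0] by (cases d) auto
  then show ?thesis using az[of 1] by simp
next
  case False
  define D where "D = d - 1"
  have D: "D > 0" "d = Suc D" using False by (auto simp: D_def)
  define L where "L = (\<Sum>n<d. Polynomial.monom (a n) n)"
  have cL: "poly.coeff L n = a n" for n using az by (auto simp: L_def coeff_sum)
  define M where "M = (\<Sum>n<d. Polynomial.monom (a n) (D - n))"
  have cM: "poly.coeff M i = (if i \<le> D then a (D - i) else 0)" for i
  proof -
    have "poly.coeff M i = (\<Sum>n<d. if n = D - i \<and> i \<le> D then a n else 0)"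
      unfolding M_def coeff_sum using D by (intro sum.cong refl) auto
    then show ?thesis using D by (auto simp: sum.delta)
  qed
  have dM: "degree M = D"
  proof (rule antisym)
    show "degree M \<le> D" by (rule degree_le) (simp add: cM)
    show "D \<le> degree M" by (rule le_degree) (simp add: cM a0)
  qed
  \<comment> \<open>The recursion starts at index 1 and leaves \<open>S 0\<close> open, whereas the
    power series must have constant term 0.\<close>
  define S' where "S' n = (if n = 0 then 0 else S n)" for n
  have rts: "cmod z \<le> B" if z: "poly M z = 0" for z
  proof (rule ccontr)
    assume "\<not> ?thesis"
    then have zB: "cmod z > B" by simp
    then have znz: "z \<noteq> 0" using B by auto
    have "poly L (1 / z) = (\<Sum>n<d. a n * (1 / z) ^ n)" by (simp add: L_def poly_sum poly_monom)
    then have "z ^ D * poly L (1 / z) = (\<Sum>n<d. a n * z ^ (D - n))"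
      using znz D by (auto simp: sum_distrib_left power_diff power_one_over field_simps intro!: sum.cong)
    also have "\<dots> = poly M z" by (simp add: M_def poly_sum poly_monom)
    finally have "poly L (1 / z) = 0" using z znz by simp
    moreover have "poly L (1 / z) \<noteq> 0"
    proof (rule no_root_of_log_derivative_bound[where S = S' and C = C and B = B])
      show "poly L 0 \<noteq> 0" using cL[of 0] a0 by (simp add: poly_0_coeff_0)
      show "of_nat n * poly.coeff L n = (\<Sum>j=0..n. S' j * poly.coeff L (n - j))" for n
      proof -
        have "(\<Sum>j=0..n. S' j * poly.coeff L (n - j)) = (\<Sum>j=1..n. S' j * poly.coeff L (n - j))"
          by (rule sum.mono_neutral_right) (auto simp: S'_def)
        also have "\<dots> = (\<Sum>j=1..n. S j * a (n - j))" by (intro sum.cong refl) (auto simp: S'_def cL)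
        finally show ?thesis using rec cL by simp
      qed
      have "0 < cmod z" using zB B by linarith
      then show "cmod (1 / z) * B < 1" using zB by (simp add: norm_divide field_simps)
    qed (use bound B in \<open>auto simp: S'_def\<close>)
    ultimately show False by blast
  qed
  have "cmod (poly.coeff M (D - 1)) \<le> real D * B"
    using monic_complex_poly_root_sum_bound[of M B] rts dM D by (simp add: cM a0)
  then show ?thesis using D by (simp add: cM Suc_diff_le)
qed

context additive_poly_char
begin

text \<open>The monic polynomials of degree 1 are the T - x with x in \<open>k\<close>, and the sum
  of f over the single root is f(x). So the exponential sum is the first coefficient of the
  L-function.\<close>

lemma char_sum_theta_1: "char_sum \<theta> 1 = (\<Sum>x\<in>k. \<psi> (\<Sum>j=1..d. fc j * x ^ j))"
proof -
  have eq: "kmonic 1 = (\<lambda>x. [:- x, 1:]) ` k"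
  proof (intro equalityI subsetI)
    fix h assume h: "h \<in> kmonic 1"
    have "h = [:- (- poly.coeff h 0), 1:]"
      using h by (intro poly_eqI) (auto simp: kmonic_def coeff_pCons coeff_eq_0 split: nat.split)
    moreover have "- poly.coeff h 0 \<in> k" using h by (auto simp: kmonic_def minus_k)
    ultimately show "h \<in> (\<lambda>x. [:- x, 1:]) ` k" by blast
  next
    fix h assume "h \<in> (\<lambda>x. [:- x, 1:]) ` k"
    then show "h \<in> kmonic 1" by (auto intro!: kmonicI simp: minus_k coeff_pCons split: nat.split)
  qed
  have "char_sum \<theta> 1 = (\<Sum>x\<in>k. \<theta> [:- x, 1:])"
    unfolding char_sum_def eq by (subst sum.reindex) (auto simp: inj_on_def)
  also have "\<dots> = (\<Sum>x\<in>k. \<psi> (\<Sum>j=1..d. fc j * x ^ j))"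
    by (intro sum.cong refl) (simp add: \<theta>_def trace_sum_def root_power_sum_linear)
  finally show ?thesis .
qed

theorem weil_bound: "cmod (\<Sum>x\<in>k. \<psi> (\<Sum>j=1..d. fc j * x ^ j)) \<le> (real d - 1) * sqrt (real q)"
proof -
  \<comment> \<open>One factor \<open>q\<close> comes from the bound for von Mangoldt sums, the
    other from rounding up n/2 to \<open>l\<close>. The last summand covers \<open>n = 1\<close>,
    which has no splitting \<open>m + l\<close> with \<open>0 < m \<le> l\<close>.\<close>
  define C where "C = 2 * real q * (3 * real d + 4) * real q + cmod (mangoldt_sum \<theta> 1)"
  have q1: "sqrt (real q) \<ge> 1" using q_ge_2 by simp
  have "cmod (char_sum \<theta> 1) \<le> (real d - 1) * sqrt (real q)"
  proof (rule power_sum_bound_of_growth[where S = "mangoldt_sum \<theta>" and C = C])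
    show "char_sum \<theta> 0 = 1" using trace_sum_power[of 1 0 0] kmonic_0
      by (simp add: char_sum_def \<theta>_def psi_0)
    show "char_sum \<theta> n = 0" if "n \<ge> d" for n using char_sum_theta_zero[OF that] .
    show "of_nat n * char_sum \<theta> n = (\<Sum>j=1..n. mangoldt_sum \<theta> j * char_sum \<theta> (n - j))" for n
      by (rule mangoldt_convolution) (rule theta_mult)
    show "cmod (mangoldt_sum \<theta> n) \<le> C * sqrt (real q) ^ n" if "n > 0" for n
    proof (cases "n = 1")
      case True
      have "cmod (mangoldt_sum \<theta> 1) \<le> C" by (simp add: C_def)
      also have "\<dots> \<le> C * sqrt (real q)"
        using mult_left_mono[OF q1, of C] by (simp add: C_def)
      finally show ?thesis using True by simp
    next
      case False
      define m l where "m = n div 2" and "l = n - n div 2"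
      have ml: "0 < m" "m \<le> l" "m + l = n" "2 * l \<le> n + 1" using that False by (auto simp: m_def l_def)
      have "real q ^ l = sqrt (real q) ^ (2 * l)" by (simp add: power_mult)
      also have "\<dots> \<le> sqrt (real q) ^ (n + 1)" using ml q1 by (intro power_increasing) auto
      also have "\<dots> \<le> sqrt (real q) ^ n * real q"
        using q_ge_2 real_sqrt_le_mono[of "real q" "real q * real q"] by (simp add: mult.commute mult_left_mono real_sqrt_mult)
      finally have "real q ^ l \<le> sqrt (real q) ^ n * real q" .
      then have "2 * real q * ((3 * real d + 4) * real q ^ l) \<le> 2 * real q * ((3 * real d + 4) * (sqrt (real q) ^ n * real q))"
        by (intro mult_left_mono) auto
      also have "\<dots> \<le> C * sqrt (real q) ^ n" by (simp add: C_def algebra_simps)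
      finally show ?thesis using mangoldt_sum_theta_bound[OF ml(1,2)] ml(3) by simp
    qed
    show "sqrt (real q) > 0" using q1 by linarith
  qed
  then show ?thesis by (simp only: char_sum_theta_1)
qed

end

section \<open>Additive characters and incidences\<close>

context field_ideal
begin

section \<open>The characteristic and the additive group\<close>

definition chr :: nat where "chr = (LEAST n. n > 0 \<and> of_nat n * e = 0)"

text \<open>Translation by \<open>e\<close> permutes \<open>k\<close>, so adding \<open>q\<close>
  copies of \<open>e\<close> does not change the sum of all elements.\<close>

lemma q_e_zero: "of_nat q * e = 0"
proof -
  have inj: "inj_on (\<lambda>x. x + e) k" by (auto simp: inj_on_def)
  have "(\<lambda>x. x + e) ` k = k" by (rule endo_inj_surj[OF finite_k _ inj]) (auto intro: add_k e_in)
  then have "(\<Sum>x\<in>k. x) = (\<Sum>x\<in>k. x + e)" using sum.reindex[OF inj, of "\<lambda>x. x"] by simp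
  then show ?thesis by (simp add: sum.distrib q_def)
qed

lemma chr_props: "chr > 0" "of_nat chr * e = 0"
proof -
  have "chr > 0 \<and> of_nat chr * e = 0"
    unfolding chr_def by (rule LeastI[of _ q]) (use q_e_zero q_ge_2 in auto)
  then show "chr > 0" "of_nat chr * e = 0" by auto
qed

lemma chr_mult: assumes "x \<in> k" shows "of_nat chr * x = 0"
proof -
  have "of_nat chr * x = of_nat chr * e * x" using e_mult[OF assms] by (simp add: mult.assoc)
  then show ?thesis using chr_props by simp
qed

lemma of_nat_mod_chr: assumes "x \<in> k" shows "of_nat (n mod chr) * x = of_nat n * x"
proof -
  have "(of_nat n :: 'w) = of_nat (n div chr) * of_nat chr + of_nat (n mod chr)"
    by (simp flip: of_nat_mult of_nat_add)
  then show ?thesis using chr_mult[OF assms] by (simp add: distrib_right mult.assoc)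
qed

lemma of_nat_e_nz: "0 < j \<Longrightarrow> j < chr \<Longrightarrow> of_nat j * e \<noteq> 0"
  unfolding chr_def using not_less_Least by blast

lemma prime_chr: "prime chr"
proof (rule ccontr)
  assume np: "\<not> prime chr"
  have "chr \<noteq> 1" using chr_props e_nz by auto
  then have "chr > 1" using chr_props(1) by simp
  then obtain a b where ab: "chr = a * b" "1 < a" "1 < b"
    using np prime_nat_iff[of chr] by (metis dvd_def dvd_triv_left less_one linorder_neqE_nat mult.right_neutral mult_eq_0_iff not_less_zero)
  then have "a < chr" "b < chr" by auto
  then have nz: "of_nat a * e \<noteq> 0" "of_nat b * e \<noteq> 0" using ab of_nat_e_nz by auto
  have "(of_nat a * e) * (of_nat b * e) = of_nat (a * b) * (e * e)" by (simp add: algebra_simps)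
  then have "(of_nat a * e) * (of_nat b * e) = of_nat chr * e" by (simp only: ab e_idem)
  then show False using mult_zero_k[of "of_nat a * e" "of_nat b * e"] mult_k[OF e_in] nz chr_props by auto
qed

text \<open>Additive subgroups; negatives are included because - b is the multiple of b by
  \<open>chr - 1\<close>.\<close>

definition add_sub :: "'w set \<Rightarrow> bool"
  where "add_sub H \<longleftrightarrow> H \<subseteq> k \<and> 0 \<in> H \<and> (\<forall>a\<in>H. \<forall>b\<in>H. a + b \<in> H)"

lemma add_sub_of_nat: "add_sub H \<Longrightarrow> h \<in> H \<Longrightarrow> of_nat n * h \<in> H"
  by (induction n) (auto simp: add_sub_def algebra_simps)

lemma add_sub_diff: assumes "add_sub H" "a \<in> H" "b \<in> H" shows "a - b \<in> H"
proof -
  have b: "b \<in> k" using assms by (auto simp: add_sub_def)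
  have "chr = Suc (chr - 1)" using chr_props(1) by simp
  then have "of_nat chr * b = b + of_nat (chr - 1) * b" by (metis distrib_right mult_1 of_nat_Suc)
  then have "- b = of_nat (chr - 1) * b" using chr_mult[OF b] by (simp add: eq_neg_iff_add_eq_0 add.commute minus_unique)
  then have "a - b = a + of_nat (chr - 1) * b" by (metis diff_conv_add_uminus)
  moreover have "of_nat (chr - 1) * b \<in> H" by (rule add_sub_of_nat[OF assms(1,3)])
  ultimately show ?thesis using assms by (simp only: add_sub_def)
qed

lemma add_sub_divide:
  assumes H: "add_sub H" and x: "x \<in> k" and j: "of_nat j * x \<in> H" "0 < j" "j < chr"
  shows "x \<in> H"
proof -
  have "coprime j chr" using prime_chr j by (metis coprime_commute nat_dvd_not_less prime_imp_coprime)
  then obtain j' where "[j * j' = Suc 0] (mod chr)" using cong_solve_coprime_nat by blast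
  then have "(j' * j) mod chr = 1 mod chr" by (simp add: cong_def mult.commute)
  then have "of_nat (j' * j) * x = of_nat 1 * x" using of_nat_mod_chr[OF x] by metis
  moreover have "of_nat j' * (of_nat j * x) \<in> H" by (rule add_sub_of_nat[OF H j(1)])
  ultimately show ?thesis by (simp add: mult.assoc)
qed

lemma add_sub_extend:
  assumes H: "add_sub H" and x: "x \<in> k" "x \<notin> H"
  shows "inj_on (\<lambda>(h, j). h + of_nat j * x) (H \<times> {..<chr})"
    and "add_sub ((\<lambda>(h, j). h + of_nat j * x) ` (H \<times> {..<chr}))"
proof -
  have key: False if "h \<in> H" "h' \<in> H" "j < j'" "j' < chr" "h + of_nat j * x = h' + of_nat j' * x" for h h' j j'
  proof -
    have "of_nat (j' - j) * x = h - h'" using that by (simp add: of_nat_diff algebra_simps)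
    then have "of_nat (j' - j) * x \<in> H" using add_sub_diff[OF H that(1,2)] by simp
    moreover have "0 < j' - j" "j' - j < chr" using that by auto
    ultimately show False using add_sub_divide[OF H x(1)] x(2) by blast
  qed
  show "inj_on (\<lambda>(h, j). h + of_nat j * x) (H \<times> {..<chr})"
  proof (rule inj_onI, clarsimp)
    fix h j h' j' assume *: "h \<in> H" "j < chr" "h' \<in> H" "j' < chr" "h + of_nat j * x = h' + of_nat j' * x"
    consider "j < j'" | "j' < j" | "j = j'" by linarith
    then show "h = h' \<and> j = j'"
      by cases (use * key[of h h' j j'] key[of h' h j' j] in auto)
  qed
  show "add_sub ((\<lambda>(h, j). h + of_nat j * x) ` (H \<times> {..<chr}))"
    unfolding add_sub_def
  proof (intro conjI ballI)
    show "(\<lambda>(h, j). h + of_nat j * x) ` (H \<times> {..<chr}) \<subseteq> k"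
      using H x by (auto simp: add_sub_def intro!: add_k mult_k)
    have "0 + of_nat 0 * x \<in> (\<lambda>(h, j). h + of_nat j * x) ` (H \<times> {..<chr})"
      using H chr_props by (intro image_eqI[of _ _ "(0, 0)"]) (auto simp: add_sub_def)
    then show "0 \<in> (\<lambda>(h, j). h + of_nat j * x) ` (H \<times> {..<chr})" by simp
    fix a b assume "a \<in> (\<lambda>(h, j). h + of_nat j * x) ` (H \<times> {..<chr})" "b \<in> (\<lambda>(h, j). h + of_nat j * x) ` (H \<times> {..<chr})"
    then obtain h j h' j' where *: "h \<in> H" "h' \<in> H" "a = h + of_nat j * x" "b = h' + of_nat j' * x" by auto
    have "a + b = (h + h') + of_nat ((j + j') mod chr) * x"
      unfolding of_nat_mod_chr[OF x(1)] * by (simp add: algebra_simps)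
    moreover have "h + h' \<in> H" using H * by (auto simp: add_sub_def)
    ultimately show "a + b \<in> (\<lambda>(h, j). h + of_nat j * x) ` (H \<times> {..<chr})"
      using chr_props by (intro image_eqI[of _ _ "(h + h', (j + j') mod chr)"]) auto
  qed
qed

text \<open>A largest proper subgroup whose order is a power of \<open>chr\<close>. Adjoining the
  multiples of one more element \<open>x\<close> multiplies the order by \<open>chr\<close>, so
  maximality forces the result to be all of \<open>k\<close>. This also shows that \<open>q\<close>
  is a power of \<open>chr\<close>.\<close>

lemma add_sub_hyperplane:
  obtains H x i where "add_sub H" "x \<in> k" "x \<notin> H" "card H = chr ^ i"
    "(\<lambda>(h, j). h + of_nat j * x) ` (H \<times> {..<chr}) = k"
proof -
  define Q where "Q H \<longleftrightarrow> add_sub H \<and> H \<noteq> k \<and> (\<exists>i. card H = chr ^ i)" for H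
  have "Q {0}" unfolding Q_def add_sub_def using zero_k e_in e_nz by (auto intro: exI[of _ 0])
  moreover have bd: "\<forall>H. Q H \<longrightarrow> card H < Suc q"
    unfolding Q_def add_sub_def q_def using card_mono[OF finite_k] by (auto simp: less_Suc_eq_le)
  ultimately obtain H where H: "Q H" and mx: "\<And>H'. Q H' \<Longrightarrow> card H' \<le> card H"
    using ex_has_greatest_nat[of Q "{0}" card "Suc q"] by auto
  obtain i where i: "card H = chr ^ i" "add_sub H" "H \<noteq> k" using H by (auto simp: Q_def)
  obtain x where x: "x \<in> k" "x \<notin> H" using i by (auto simp: add_sub_def)
  define H' where "H' = (\<lambda>(h, j). h + of_nat j * x) ` (H \<times> {..<chr})"
  have "finite H" using i finite_k finite_subset by (auto simp: add_sub_def)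
  then have "card H' = chr ^ Suc i" unfolding H'_def
    using card_image[OF add_sub_extend(1)[OF i(2) x]] i(1) by (simp add: card_cartesian_product)
  moreover have "chr ^ i < chr ^ Suc i"
    by (rule power_strict_increasing) (use prime_gt_1_nat[OF prime_chr] in auto)
  ultimately have "\<not> Q H'" using mx[of H'] i(1) by auto
  moreover have "add_sub H'" unfolding H'_def by (rule add_sub_extend(2)[OF i(2) x])
  ultimately have "H' = k" using \<open>card H' = chr ^ Suc i\<close> unfolding Q_def by blast
  then show ?thesis using that i x unfolding H'_def by blast
qed

lemma q_chr_power: "\<exists>i. q = chr ^ i"
proof -
  obtain H x i where H: "add_sub H" "x \<in> k" "x \<notin> H" "card H = chr ^ i"
    "(\<lambda>(h, j). h + of_nat j * x) ` (H \<times> {..<chr}) = k"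
    using add_sub_hyperplane by metis
  have "q = card (H \<times> {..<chr})" unfolding q_def
    using card_image[OF add_sub_extend(1)[OF H(1-3)]] H(5) by simp
  then have "q = chr ^ Suc i" using H(4) by (simp add: card_cartesian_product)
  then show ?thesis by blast
qed

lemma coprime_less_chr: assumes "0 < j" "j < chr" shows "coprime j q"
proof -
  have "coprime j chr" using prime_chr assms by (metis coprime_commute nat_dvd_not_less prime_imp_coprime)
  then show ?thesis using q_chr_power by auto
qed

definition additive_character :: "('w \<Rightarrow> complex) \<Rightarrow> bool"
  where "additive_character \<psi> \<longleftrightarrow> (\<forall>a\<in>k. \<forall>b\<in>k. \<psi> (a + b) = \<psi> a * \<psi> b) \<and> (\<forall>a\<in>k. cmod (\<psi> a) = 1)
    \<and> (\<exists>x\<in>k. \<psi> x \<noteq> 1)"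

text \<open>\<open>k\<close> is the direct sum of a hyperplane \<open>H\<close> and the multiples of
  \<open>x\<close>. The character is trivial on \<open>H\<close> and takes \<open>j\<close> times
  \<open>x\<close> to the \<open>j\<close>-th power of a primitive root of unity of order
  \<open>chr\<close>.\<close>

lemma additive_character_exists: "\<exists>\<psi>. additive_character \<psi>"
proof -
  obtain H x i where H: "add_sub H" "x \<in> k" "x \<notin> H" "card H = chr ^ i"
    "(\<lambda>(h, j). h + of_nat j * x) ` (H \<times> {..<chr}) = k"
    using add_sub_hyperplane by metis
  note inj = add_sub_extend(1)[OF H(1-3)]
  define \<zeta> where "\<zeta> = cis (2 * pi / real chr)"
  have z1: "\<zeta> ^ chr = 1" unfolding \<zeta>_def Complex.DeMoivre using chr_props(1) by simp
  have zmod: "\<zeta> ^ (j mod chr) = \<zeta> ^ j" for j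
  proof -
    have "\<zeta> ^ j = \<zeta> ^ (chr * (j div chr) + j mod chr)" by simp
    also have "\<dots> = \<zeta> ^ (j mod chr)" by (simp only: power_add power_mult z1) simp
    finally show ?thesis by simp
  qed
  define \<psi> where "\<psi> y = \<zeta> ^ (SOME j. j < chr \<and> (\<exists>h\<in>H. y = h + of_nat j * x))" for y
  have psi: "\<psi> (h + of_nat j * x) = \<zeta> ^ j" if h: "h \<in> H" for h j
  proof -
    define y where "y = h + of_nat j * x"
    define j' where "j' = (SOME j. j < chr \<and> (\<exists>h\<in>H. y = h + of_nat j * x))"
    have y: "y = h + of_nat (j mod chr) * x" by (simp add: y_def of_nat_mod_chr H)
    have "j mod chr < chr \<and> (\<exists>h\<in>H. y = h + of_nat (j mod chr) * x)" using y h chr_props(1) by auto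
    then have "j' < chr \<and> (\<exists>h\<in>H. y = h + of_nat j' * x)"
      unfolding j'_def by (rule someI)
    then obtain h' where h': "h' \<in> H" "y = h' + of_nat j' * x" "j' < chr" by blast
    have "(h', j') = (h, j mod chr)"
      by (rule inj_onD[OF inj]) (use h' y h chr_props(1) in auto)
    then show ?thesis unfolding \<psi>_def y_def[symmetric] j'_def[symmetric] using zmod by simp
  qed
  have add: "\<psi> (a + b) = \<psi> a * \<psi> b" if ab: "a \<in> k" "b \<in> k" for a b
  proof -
    obtain h j where a: "h \<in> H" "a = h + of_nat j * x" using ab(1) unfolding H(5)[symmetric] by auto
    obtain h' j' where b: "h' \<in> H" "b = h' + of_nat j' * x" using ab(2) unfolding H(5)[symmetric] by auto
    have "h + h' \<in> H" using H(1) a b by (auto simp: add_sub_def)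
    moreover have "a + b = (h + h') + of_nat (j + j') * x" by (simp add: a b algebra_simps)
    ultimately show ?thesis using psi a b by (simp only: power_add)
  qed
  have "\<psi> x = \<zeta>" using psi[of 0 1] H(1) by (simp add: add_sub_def)
  moreover have "\<zeta> \<noteq> 1"
  proof
    assume "\<zeta> = 1"
    then have "cos (2 * pi / real chr) = 1" unfolding \<zeta>_def by (metis cis.sel(1) one_complex.sel(1))
    moreover have "cos (2 * pi / real chr) < cos 0 \<or> chr = 1"
    proof (cases "chr = 2")
      case True then show ?thesis by simp
    next
      case False
      then have "chr > 2" using prime_gt_1_nat[OF prime_chr] by linarith
      then have "2 * pi / real chr \<le> pi" "0 < 2 * pi / real chr" by (auto simp: field_simps)
      then show ?thesis using cos_monotone_0_pi[of 0 "2 * pi / real chr"] by simp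
    qed
    ultimately show False using prime_gt_1_nat[OF prime_chr] by simp
  qed
  moreover have "cmod (\<psi> a) = 1" for a by (simp add: \<psi>_def \<zeta>_def norm_power)
  ultimately have "additive_character \<psi>" unfolding additive_character_def using add H(2) by auto
  then show ?thesis by blast
qed

text \<open>A single nontrivial \<open>\<psi>\<close> suffices for Fourier analysis on \<open>k\<close>: the characters are \<open>t \<mapsto> \<psi> (a * t)\<close>.\<close>

lemma additive_character_sum:
  assumes "additive_character \<psi>" "t \<in> k"
  shows "(\<Sum>a\<in>k. \<psi> (a * t)) = (if t = 0 then of_nat q else 0)"
proof (cases "t = 0")
  case True
  have "\<psi> (0 + 0) = \<psi> 0 * \<psi> 0" "\<psi> 0 \<noteq> 0" using assms(1) zero_k unfolding additive_character_def by (blast, force)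
  then have "\<psi> 0 = 1" by simp
  then show ?thesis using True by (simp add: q_def)
next
  case False
  have inj: "inj_on (\<lambda>a. a * t) k"
  proof (rule inj_onI)
    fix a b assume ab: "a \<in> k" "b \<in> k" "a * t = b * t"
    then have "(a - b) * t = 0" by (simp add: left_diff_distrib)
    then show "a = b" using mult_zero_k[of "a - b" t] ab diff_k assms(2) False by auto
  qed
  have "(\<lambda>a. a * t) ` k = k" by (rule endo_inj_surj[OF finite_k _ inj]) (auto intro: mult_k')
  then have "(\<Sum>a\<in>k. \<psi> (a * t)) = (\<Sum>c\<in>k. \<psi> c)" using sum.reindex[OF inj, of \<psi>] by simp
  also have "\<dots> = 0"
  proof -
    obtain x where x: "x \<in> k" "\<psi> x \<noteq> 1" using assms by (auto simp: additive_character_def)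
    have inj: "inj_on ((+) x) k" by (auto simp: inj_on_def)
    have "(+) x ` k = k" by (rule endo_inj_surj[OF finite_k _ inj]) (auto intro: add_k x)
    then have "(\<Sum>c\<in>k. \<psi> c) = (\<Sum>c\<in>k. \<psi> (x + c))" using sum.reindex[OF inj, of \<psi>] by simp
    also have "\<dots> = \<psi> x * (\<Sum>c\<in>k. \<psi> c)" using x assms(1) by (simp add: additive_character_def sum_distrib_left)
    finally show ?thesis using x(2) by (metis mult_cancel_right1)
  qed
  finally show ?thesis using False by simp
qed

lemma additive_character_0: assumes "additive_character \<psi>" shows "\<psi> 0 = 1"
  using additive_character_sum[OF assms zero_k] q_ge_2 by (simp add: q_def)

lemma additive_character_minus:
  assumes "additive_character \<psi>" "a \<in> k" shows "\<psi> (- a) = cnj (\<psi> a)"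
proof -
  have "\<psi> a * \<psi> (- a) = \<psi> (a + - a)" using assms minus_k unfolding additive_character_def by metis
  then have "\<psi> a * \<psi> (- a) = 1" by (simp add: additive_character_0[OF assms(1)])
  moreover have "\<psi> a * cnj (\<psi> a) = 1"
    using assms complex_norm_square[of "\<psi> a"] by (simp add: additive_character_def)
  moreover have "\<psi> a \<noteq> 0" using assms by (force simp: additive_character_def)
  ultimately show ?thesis by (metis mult_left_cancel)
qed

text \<open>Weil's bound is applied at the true degree \<open>N\<close>, which may be below
  \<open>D\<close>; as \<open>0 < N < chr\<close>, it is prime to the characteristic.\<close>

lemma character_sum_bound:
  assumes \<psi>: "additive_character \<psi>" and a: "a \<in> k" "a \<noteq> 0"
    and g: "\<And>j. g j \<in> k" and D: "D < chr" and nz: "j0 \<in> {1..D}" "g j0 \<noteq> 0"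
  shows "cmod (\<Sum>x\<in>k. \<psi> (a * (\<Sum>j=1..D. g j * x ^ j))) \<le> real D * sqrt (real q)"
proof -
  define N where "N = Max {j \<in> {1..D}. g j \<noteq> 0}"
  have "N \<in> {j \<in> {1..D}. g j \<noteq> 0}" unfolding N_def by (rule Max_in) (use nz in auto)
  then have N: "1 \<le> N" "N \<le> D" "g N \<noteq> 0" by auto
  have above: "g j = 0" if "j \<in> {1..D}" "j > N" for j
  proof (rule ccontr)
    assume "g j \<noteq> 0"
    then have "j \<le> N" unfolding N_def using that by (intro Max_ge) auto
    then show False using that by simp
  qed
  have Ne: "of_nat N * e \<noteq> 0" "of_nat N * e \<in> k" using of_nat_e_nz[of N] N D mult_k e_in by auto
  have ag: "a * g N \<noteq> 0" "a * g N \<in> k" using mult_zero_k[OF a(1) g[of N]] a N mult_k' by auto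
  have "(of_nat N * e) * (a * g N) \<noteq> 0" using mult_zero_k[OF Ne(2) ag(2)] Ne ag by blast
  moreover have "(of_nat N * e) * (a * g N) = of_nat N * (a * g N)" using e_mult[OF ag(2)] by (simp add: mult.assoc)
  ultimately have Nag: "of_nat N * (a * g N) \<noteq> 0" by simp
  interpret additive_poly_char k e \<psi> "\<lambda>j. a * g j" N
    by unfold_locales
      (use \<psi> N Nag D a g in \<open>auto simp: additive_character_def mult_k intro!: coprime_less_chr\<close>)
  have "(\<Sum>j=1..D. g j * x ^ j) = (\<Sum>j=1..N. g j * x ^ j)" for x
    by (rule sum.mono_neutral_right) (use N above in auto)
  then have "(\<Sum>x\<in>k. \<psi> (a * (\<Sum>j=1..D. g j * x ^ j))) = (\<Sum>x\<in>k. \<psi> (\<Sum>j=1..N. a * g j * x ^ j))"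
    by (simp add: sum_distrib_left mult.assoc)
  then have "cmod (\<Sum>x\<in>k. \<psi> (a * (\<Sum>j=1..D. g j * x ^ j))) \<le> (real N - 1) * sqrt (real q)"
    using weil_bound by simp
  also have "\<dots> \<le> real D * sqrt (real q)" using N by (intro mult_right_mono) auto
  finally show ?thesis .
qed

lemma character_parseval:
  assumes \<psi>: "additive_character \<psi>" and V: "V \<subseteq> k"
  shows "(\<Sum>a\<in>k. (cmod (\<Sum>v\<in>V. \<psi> (a * v)))\<^sup>2) = real q * real (card V)"
proof -
  have finV: "finite V" using V finite_k finite_subset by blast
  have "complex_of_real (\<Sum>a\<in>k. (cmod (\<Sum>v\<in>V. \<psi> (a * v)))\<^sup>2)
      = (\<Sum>a\<in>k. \<Sum>v\<in>V. \<Sum>v'\<in>V. \<psi> (a * (v - v')))"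
  proof -
    have "complex_of_real ((cmod (\<Sum>v\<in>V. \<psi> (a * v)))\<^sup>2) = (\<Sum>v\<in>V. \<Sum>v'\<in>V. \<psi> (a * (v - v')))" if a: "a \<in> k" for a
    proof -
      have "complex_of_real ((cmod (\<Sum>v\<in>V. \<psi> (a * v)))\<^sup>2) = (\<Sum>v\<in>V. \<psi> (a * v)) * (\<Sum>v'\<in>V. cnj (\<psi> (a * v')))"
        by (simp only: complex_norm_square cnj_sum)
      also have "\<dots> = (\<Sum>v\<in>V. \<Sum>v'\<in>V. \<psi> (a * v) * \<psi> (- (a * v')))"
        unfolding sum_product using V a
        by (intro sum.cong refl) (simp add: additive_character_minus[OF \<psi>] mult_k' a)
      also have "\<dots> = (\<Sum>v\<in>V. \<Sum>v'\<in>V. \<psi> (a * (v - v')))"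
      proof (intro sum.cong refl)
        fix v v'
        have "a * v \<in> k" "- (a * v') \<in> k" by (auto intro: mult_k' minus_k a)
        then have "\<psi> (a * v + - (a * v')) = \<psi> (a * v) * \<psi> (- (a * v'))"
          using \<psi> unfolding additive_character_def by blast
        then show "\<psi> (a * v) * \<psi> (- (a * v')) = \<psi> (a * (v - v'))" by (simp add: right_diff_distrib)
      qed
      finally show ?thesis .
    qed
    then show ?thesis by (simp only: of_real_sum cong: sum.cong)
  qed
  also have "\<dots> = (\<Sum>v\<in>V. \<Sum>v'\<in>V. \<Sum>a\<in>k. \<psi> (a * (v - v')))"
    by (subst sum.swap) (intro sum.cong refl sum.swap)
  also have "\<dots> = (\<Sum>v\<in>V. \<Sum>v'\<in>V. if v = v' then of_nat q else 0)"
  proof (intro sum.cong refl)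
    fix v v' assume "v \<in> V" "v' \<in> V"
    then have "v - v' \<in> k" using V diff_k by blast
    then show "(\<Sum>a\<in>k. \<psi> (a * (v - v'))) = (if v = v' then of_nat q else 0)"
      by (simp add: additive_character_sum[OF \<psi>])
  qed
  also have "\<dots> = complex_of_real (real q * real (card V))" using finV by (simp add: sum.delta)
  finally show ?thesis by (simp only: of_real_eq_iff)
qed

lemma card_roots_le:
  assumes g: "\<And>j. g j \<in> k" and nz: "j0 \<le> D" "g j0 \<noteq> 0"
  shows "card {u \<in> k. (\<Sum>j\<le>D. g j * u ^ j) = 0} \<le> D"
proof (rule ccontr)
  assume H: "\<not> ?thesis"
  define f where "f = (\<Sum>j\<le>D. Polynomial.monom (g j) j)"
  have c: "poly.coeff f j = (if j \<le> D then g j else 0)" for j by (simp add: f_def coeff_sum)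
  have "f = 0"
  proof (rule k_roots_zero[where n = "Suc D" and A = "{u \<in> k. (\<Sum>j\<le>D. g j * u ^ j) = 0}"])
    show "f \<in> kpoly" using g by (simp add: kpoly_def c zero_k)
    show "poly f x = 0" if "x \<in> {u \<in> k. (\<Sum>j\<le>D. g j * u ^ j) = 0}" for x
      using that by (simp add: f_def poly_sum poly_monom)
  qed (use H in \<open>auto simp: c\<close>)
  then show False using c[of j0] nz by simp
qed

text \<open>Both indices start at 1: the mixed part of F. The terms in one variable alone go into
  the shifts \<open>v\<close> and \<open>J\<close> of the incidence problem.\<close>

definition bipoly :: "nat \<Rightarrow> (nat \<Rightarrow> nat \<Rightarrow> 'w) \<Rightarrow> 'w \<Rightarrow> 'w \<Rightarrow> 'w"
  where "bipoly D c x u = (\<Sum>i=1..D. (\<Sum>j=1..D. c i j * u ^ j) * x ^ i)"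

lemma bipoly_k: assumes "\<And>i j. c i j \<in> k" shows "bipoly D c x u \<in> k"
  unfolding bipoly_def by (intro sum_k mult_k' assms)

text \<open>The difference is a polynomial in \<open>x\<close> whose coefficient of index
  \<open>i0\<close>, seen as a polynomial in \<open>u'\<close>, is nonzero because of
  \<open>c i0 j0\<close>. So it vanishes for at most \<open>D\<close> values \<open>u'\<close>,
  where the trivial bound \<open>q\<close> is used; Weil's bound handles the others.\<close>

lemma bipoly_kernel_row_sum:
  assumes \<psi>: "additive_character \<psi>" and a: "a \<in> k" "a \<noteq> 0"
    and c: "\<And>i j. c i j \<in> k" and D: "D < chr"
    and nz: "i0 \<in> {1..D}" "j0 \<in> {1..D}" "c i0 j0 \<noteq> 0" and u: "u \<in> k"
  shows "(\<Sum>u'\<in>k. cmod (\<Sum>x\<in>k. \<psi> (a * (bipoly D c x u - bipoly D c x u')))) \<le> 2 * real D * (real q * sqrt (real q))"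
proof -
  define h where "h i u' = (\<Sum>j=1..D. c i j * u' ^ j)" for i u'
  have hk: "h i u' \<in> k" for i u' unfolding h_def by (intro sum_k mult_k' c)
  define bad where "bad = {u' \<in> k. h i0 u - h i0 u' = 0}"
  have cb: "card bad \<le> D"
  proof -
    define g where "g j = (if j = 0 then h i0 u else - c i0 j)" for j
    have gk: "g j \<in> k" for j by (simp add: g_def hk minus_k c)
    have "{..D} = insert 0 {1..D}" by auto
    then have "(\<Sum>j\<le>D. g j * u' ^ j) = h i0 u - h i0 u'" for u'
      by (simp add: g_def h_def sum_negf)
    then show ?thesis using card_roots_le[of g j0 D, OF gk] nz by (auto simp: bad_def g_def)
  qed
  have finbad: "finite bad" using finite_k by (simp add: bad_def)
  have eq: "bipoly D c x u - bipoly D c x u' = (\<Sum>i=1..D. (h i u - h i u') * x ^ i)" for x u'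
    by (simp add: bipoly_def h_def sum_subtractf left_diff_distrib)
  have psi1: "cmod (\<psi> t) = 1" if "t \<in> k" for t using \<psi> that by (simp add: additive_character_def)
  have each: "cmod (\<Sum>x\<in>k. \<psi> (a * (bipoly D c x u - bipoly D c x u'))) \<le> real D * sqrt (real q) + (if u' \<in> bad then real q else 0)"
    if "u' \<in> k" for u'
  proof (cases "u' \<in> bad")
    case True
    have "cmod (\<Sum>x\<in>k. \<psi> (a * (bipoly D c x u - bipoly D c x u'))) \<le> (\<Sum>x\<in>k. cmod (\<psi> (a * (bipoly D c x u - bipoly D c x u'))))"
      by (rule norm_sum)
    also have "\<dots> = (\<Sum>x\<in>k. 1)" by (intro sum.cong refl psi1 mult_k' a)
    also have "\<dots> = real q" by (simp add: q_def)
    finally show ?thesis using True by (simp add: add_increasing)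
  next
    case False
    then have "h i0 u - h i0 u' \<noteq> 0" using that by (auto simp: bad_def)
    then show ?thesis unfolding eq
      using character_sum_bound[OF \<psi> a, of "\<lambda>i. h i u - h i u'" D i0] nz(1) D hk False by (simp add: diff_k)
  qed
  have "(\<Sum>u'\<in>k. cmod (\<Sum>x\<in>k. \<psi> (a * (bipoly D c x u - bipoly D c x u'))))
      \<le> (\<Sum>u'\<in>k. real D * sqrt (real q) + (if u' \<in> bad then real q else 0))"
    by (rule sum_mono) (rule each)
  also have "\<dots> = real q * (real D * sqrt (real q)) + real (card bad) * real q"
  proof -
    have "k \<inter> bad = bad" by (auto simp: bad_def)
    then show ?thesis by (simp add: sum.distrib sum.If_cases[OF finite_k] q_def)
  qed
  also have "\<dots> \<le> real q * (real D * sqrt (real q)) + real D * (real q * sqrt (real q))"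
  proof -
    have "real (card bad) * real q \<le> real D * real q" using cb by (intro mult_right_mono) auto
    also have "real q \<le> real q * sqrt (real q)" using q_ge_2 by (simp add: mult_le_cancel_left1)
    then have "real D * real q \<le> real D * (real q * sqrt (real q))" by (intro mult_left_mono) auto
    finally show ?thesis by simp
  qed
  also have "\<dots> = 2 * real D * (real q * sqrt (real q))" by simp
  finally show ?thesis .
qed

text \<open>Schur's test for the Gram matrix of the columns of \<open>K\<close>, whose entries have
  absolute values \<open>s u u'\<close> with row sums at most \<open>R\<close>. Enlarging
  \<open>X\<close> to \<open>k\<close> makes these entries complete character sums.\<close>

lemma bipoly_bilinear_bound:
  assumes \<psi>: "additive_character \<psi>" and a: "a \<in> k" "a \<noteq> 0"
    and c: "\<And>i j. c i j \<in> k" and D: "D < chr"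
    and nz: "i0 \<in> {1..D}" "j0 \<in> {1..D}" "c i0 j0 \<noteq> 0"
    and X: "X \<subseteq> k" and \<alpha>: "\<And>x. x \<in> X \<Longrightarrow> cmod (\<alpha> x) \<le> 1"
  shows "(cmod (\<Sum>x\<in>X. \<Sum>u\<in>k. \<alpha> x * \<psi> (a * bipoly D c x u) * \<beta> u))\<^sup>2
    \<le> real (card X) * (2 * real D * (real q * sqrt (real q))) * (\<Sum>u\<in>k. (cmod (\<beta> u))\<^sup>2)"
proof -
  define R where "R = 2 * real D * (real q * sqrt (real q))"
  have finX: "finite X" using X finite_k finite_subset by blast
  define K where "K x u = \<psi> (a * bipoly D c x u)" for x u
  define v where "v x = (\<Sum>u\<in>k. K x u * \<beta> u)" for x
  define s where "s u u' = cmod (\<Sum>x\<in>k. \<psi> (a * (bipoly D c x u - bipoly D c x u')))" for u u'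
  have bk: "bipoly D c x u \<in> k" for x u by (rule bipoly_k[OF c])
  have KK: "K x u * cnj (K x u') = \<psi> (a * (bipoly D c x u - bipoly D c x u'))" for x u u'
  proof -
    have in_k: "a * bipoly D c x u \<in> k" "- (a * bipoly D c x u') \<in> k" by (auto intro: mult_k' minus_k a)
    then have "\<psi> (a * bipoly D c x u + - (a * bipoly D c x u')) = \<psi> (a * bipoly D c x u) * \<psi> (- (a * bipoly D c x u'))"
      using \<psi> unfolding additive_character_def by blast
    then show ?thesis
      using additive_character_minus[OF \<psi>, of "a * bipoly D c x u'"] by (simp add: K_def right_diff_distrib mult_k' a)
  qed
  have s_sym: "s u u' = s u' u" for u u'
  proof -
    have "cnj (\<psi> (a * (bipoly D c x u - bipoly D c x u'))) = \<psi> (a * (bipoly D c x u' - bipoly D c x u))" for x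
      unfolding KK[symmetric] by simp
    then have "cnj (\<Sum>x\<in>k. \<psi> (a * (bipoly D c x u - bipoly D c x u'))) = (\<Sum>x\<in>k. \<psi> (a * (bipoly D c x u' - bipoly D c x u)))"
      by simp
    then show ?thesis unfolding s_def by (metis complex_mod_cnj)
  qed
  have row: "(\<Sum>u'\<in>k. s u u') \<le> R" if "u \<in> k" for u
    unfolding s_def R_def by (rule bipoly_kernel_row_sum[OF \<psi> a, of c, OF c D nz that])
  have snn: "s u u' \<ge> 0" for u u' by (simp add: s_def)
  have vv: "(\<Sum>x\<in>k. (cmod (v x))\<^sup>2) \<le> R * (\<Sum>u\<in>k. (cmod (\<beta> u))\<^sup>2)"
  proof -
    have "complex_of_real (\<Sum>x\<in>k. (cmod (v x))\<^sup>2) = (\<Sum>x\<in>k. v x * cnj (v x))"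
      by (simp only: of_real_sum complex_norm_square)
    also have "\<dots> = (\<Sum>x\<in>k. \<Sum>u\<in>k. \<Sum>u'\<in>k. \<beta> u * cnj (\<beta> u') * (K x u * cnj (K x u')))"
      unfolding v_def cnj_sum sum_product by (intro sum.cong refl) (simp add: algebra_simps)
    also have "\<dots> = (\<Sum>u\<in>k. \<Sum>u'\<in>k. \<Sum>x\<in>k. \<beta> u * cnj (\<beta> u') * (K x u * cnj (K x u')))"
      by (subst sum.swap) (intro sum.cong refl sum.swap)
    also have "\<dots> = (\<Sum>u\<in>k. \<Sum>u'\<in>k. \<beta> u * cnj (\<beta> u') * (\<Sum>x\<in>k. \<psi> (a * (bipoly D c x u - bipoly D c x u'))))"
      by (simp only: sum_distrib_left KK)
    finally have eq: "complex_of_real (\<Sum>x\<in>k. (cmod (v x))\<^sup>2) = \<dots>" .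
    have "(\<Sum>x\<in>k. (cmod (v x))\<^sup>2) = cmod (complex_of_real (\<Sum>x\<in>k. (cmod (v x))\<^sup>2))"
      by (simp only: norm_of_real abs_of_nonneg[OF sum_nonneg] zero_le_power2)
    also have "\<dots> \<le> (\<Sum>u\<in>k. \<Sum>u'\<in>k. cmod (\<beta> u) * cmod (\<beta> u') * s u u')"
      unfolding eq by (intro sum_norm_le[THEN order_trans] sum_norm_le sum_mono order_refl) (auto simp: norm_mult s_def)
    also have "\<dots> \<le> (\<Sum>u\<in>k. \<Sum>u'\<in>k. ((cmod (\<beta> u))\<^sup>2 + (cmod (\<beta> u'))\<^sup>2) / 2 * s u u')"
    proof (intro sum_mono mult_right_mono snn)
      fix u u'
      have "0 \<le> (cmod (\<beta> u) - cmod (\<beta> u'))\<^sup>2" by simp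
      then show "cmod (\<beta> u) * cmod (\<beta> u') \<le> ((cmod (\<beta> u))\<^sup>2 + (cmod (\<beta> u'))\<^sup>2) / 2"
        by (simp add: power2_diff)
    qed
    also have "\<dots> = (\<Sum>u\<in>k. \<Sum>u'\<in>k. (cmod (\<beta> u))\<^sup>2 / 2 * s u u') + (\<Sum>u\<in>k. \<Sum>u'\<in>k. (cmod (\<beta> u'))\<^sup>2 / 2 * s u u')"
      by (simp add: sum.distrib[symmetric] algebra_simps add_divide_distrib)
    also have "(\<Sum>u\<in>k. \<Sum>u'\<in>k. (cmod (\<beta> u'))\<^sup>2 / 2 * s u u') = (\<Sum>u\<in>k. \<Sum>u'\<in>k. (cmod (\<beta> u))\<^sup>2 / 2 * s u u')"
      by (subst sum.swap) (simp add: s_sym)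
    also have "(\<Sum>u\<in>k. \<Sum>u'\<in>k. (cmod (\<beta> u))\<^sup>2 / 2 * s u u') + (\<Sum>u\<in>k. \<Sum>u'\<in>k. (cmod (\<beta> u))\<^sup>2 / 2 * s u u')
      = (\<Sum>u\<in>k. (cmod (\<beta> u))\<^sup>2 * (\<Sum>u'\<in>k. s u u'))"
      unfolding sum.distrib[symmetric] sum_distrib_left by (intro sum.cong refl) simp
    also have "\<dots> \<le> (\<Sum>u\<in>k. (cmod (\<beta> u))\<^sup>2 * R)" by (intro sum_mono mult_left_mono row) auto
    also have "\<dots> = R * (\<Sum>u\<in>k. (cmod (\<beta> u))\<^sup>2)" by (simp add: sum_distrib_left mult.commute)
    finally show ?thesis .
  qed
  have "(\<Sum>x\<in>X. \<Sum>u\<in>k. \<alpha> x * \<psi> (a * bipoly D c x u) * \<beta> u) = (\<Sum>x\<in>X. \<alpha> x * v x)"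
    by (simp add: v_def K_def sum_distrib_left mult.assoc)
  also have "cmod \<dots> \<le> (\<Sum>x\<in>X. 1 * cmod (v x))"
    using \<alpha> by (intro sum_norm_le) (simp add: norm_mult mult_left_le_one_le)
  finally have "(cmod (\<Sum>x\<in>X. \<Sum>u\<in>k. \<alpha> x * \<psi> (a * bipoly D c x u) * \<beta> u))\<^sup>2 \<le> (\<Sum>x\<in>X. 1 * cmod (v x))\<^sup>2"
    by (intro power_mono) auto
  also have "\<dots> \<le> (\<Sum>x\<in>X. 1\<^sup>2) * (\<Sum>x\<in>X. (cmod (v x))\<^sup>2)" by (rule Cauchy_Schwarz_ineq_sum)
  also have "\<dots> = real (card X) * (\<Sum>x\<in>X. (cmod (v x))\<^sup>2)" by simp
  also have "\<dots> \<le> real (card X) * (\<Sum>x\<in>k. (cmod (v x))\<^sup>2)"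
    by (intro mult_left_mono sum_mono2 finite_k X) auto
  also have "\<dots> \<le> real (card X) * (R * (\<Sum>u\<in>k. (cmod (\<beta> u))\<^sup>2))" using vv by (intro mult_left_mono) auto
  finally show ?thesis by (simp add: R_def mult.assoc)
qed

text \<open>There are no solutions of \<open>bipoly D c x u + v + J x = w\<close>, so in the
  character expansion the term for \<open>a = 0\<close>, equal to |X||B||W|, is cancelled by the
  others. These are bounded by the bilinear estimate and Cauchy-Schwarz over \<open>a\<close>, with
  Parseval for \<open>B\<close> and for \<open>W\<close>.\<close>

theorem bipoly_incidence_bound:
  assumes c: "\<And>i j. c i j \<in> k" and D: "D < chr"
    and nz: "i0 \<in> {1..D}" "j0 \<in> {1..D}" "c i0 j0 \<noteq> 0"
    and X: "X \<subseteq> k" and B: "B \<subseteq> k \<times> k" and W: "W \<subseteq> k" and J: "\<And>x. x \<in> X \<Longrightarrow> J x \<in> k"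
    and avoid: "\<And>x u v. x \<in> X \<Longrightarrow> (u, v) \<in> B \<Longrightarrow> bipoly D c x u + v + J x \<notin> W"
  shows "real (card X) * real (card B) * real (card W) \<le> 2 * real D * (real q ^ 3 * sqrt (real q))"
proof -
  define R where "R = 2 * real D * (real q * sqrt (real q))"
  obtain \<psi> where \<psi>: "additive_character \<psi>" using additive_character_exists by blast
  have padd: "\<psi> (s + t) = \<psi> s * \<psi> t" if "s \<in> k" "t \<in> k" for s t
    using \<psi> that unfolding additive_character_def by blast
  have pnorm: "cmod (\<psi> t) = 1" if "t \<in> k" for t using \<psi> that unfolding additive_character_def by blast
  have fin: "finite X" "finite B" "finite W"
    using X B W finite_k finite_subset finite_cartesian_product by metis+
  have bk: "bipoly D c x u \<in> k" for x u by (rule bipoly_k[OF c])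
  define Bu where "Bu u = {v. (u, v) \<in> B}" for u
  have Buk: "Bu u \<subseteq> k" for u using B by (auto simp: Bu_def)
  have BS: "B = (SIGMA u:k. Bu u)" using B by (auto simp: Bu_def)
  have finBu: "finite (Bu u)" for u using Buk finite_k finite_subset by blast
  define \<beta> where "\<beta> a u = (\<Sum>v\<in>Bu u. \<psi> (a * v))" for a u
  define Wh where "Wh a = (\<Sum>w\<in>W. \<psi> (a * (- w)))" for a
  define T where "T a = (\<Sum>x\<in>X. \<Sum>u\<in>k. \<psi> (a * J x) * \<psi> (a * bipoly D c x u) * \<beta> a u)" for a
  define NB where "NB a = (\<Sum>u\<in>k. (cmod (\<beta> a u))\<^sup>2)" for a
  have expand: "(\<Sum>x\<in>X. \<Sum>(u, v)\<in>B. \<Sum>w\<in>W. \<psi> (a * (bipoly D c x u + v + J x - w))) = T a * Wh a" if a: "a \<in> k" for a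
  proof -
    have "\<psi> (a * (bipoly D c x u + v + J x - w)) = \<psi> (a * J x) * \<psi> (a * bipoly D c x u) * \<psi> (a * v) * \<psi> (a * (- w))" for x u v w
    proof -
      have "a * (bipoly D c x u + v + J x - w) = a * J x + a * bipoly D c x u + a * v + a * (- w)" by (simp add: algebra_simps)
      then show ?thesis using a by (simp only: padd add_k mult_k')
    qed
    then have "(\<Sum>x\<in>X. \<Sum>(u, v)\<in>B. \<Sum>w\<in>W. \<psi> (a * (bipoly D c x u + v + J x - w)))
      = (\<Sum>x\<in>X. \<Sum>(u, v)\<in>B. \<psi> (a * J x) * \<psi> (a * bipoly D c x u) * \<psi> (a * v) * Wh a)"
      by (simp only: Wh_def sum_distrib_left)
    also have "\<dots> = (\<Sum>x\<in>X. \<Sum>(u, v)\<in>B. \<psi> (a * J x) * \<psi> (a * bipoly D c x u) * \<psi> (a * v)) * Wh a"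
      by (simp only: sum_distrib_right case_prod_unfold)
    also have "(\<Sum>x\<in>X. \<Sum>(u, v)\<in>B. \<psi> (a * J x) * \<psi> (a * bipoly D c x u) * \<psi> (a * v)) = T a"
      unfolding T_def \<beta>_def BS by (subst sum.Sigma[symmetric]) (auto simp: finite_k finBu sum_distrib_left)
    finally show ?thesis .
  qed
  have "(\<Sum>a\<in>k. T a * Wh a) = (\<Sum>a\<in>k. \<Sum>x\<in>X. \<Sum>(u, v)\<in>B. \<Sum>w\<in>W. \<psi> (a * (bipoly D c x u + v + J x - w)))"
    using expand by (intro sum.cong refl) auto
  also have "\<dots> = (\<Sum>x\<in>X. \<Sum>(u, v)\<in>B. \<Sum>w\<in>W. \<Sum>a\<in>k. \<psi> (a * (bipoly D c x u + v + J x - w)))"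
    unfolding case_prod_unfold by (subst sum.swap, intro sum.cong refl, subst sum.swap, intro sum.cong refl sum.swap)
  also have "\<dots> = 0"
    unfolding case_prod_unfold
  proof (rule sum.neutral, rule ballI, rule sum.neutral, rule ballI, rule sum.neutral, rule ballI)
    fix x b w assume b: "x \<in> X" "b \<in> B" "w \<in> W"
    define u v where "u = fst b" and "v = snd b"
    have *: "x \<in> X" "(u, v) \<in> B" "w \<in> W" using b by (auto simp: u_def v_def)
    have "bipoly D c x u + v + J x - w \<in> k" using * B W J bk by (auto intro!: add_k diff_k)
    moreover have "bipoly D c x u + v + J x - w \<noteq> 0" using avoid[OF *(1,2)] *(3) by auto
    ultimately show "(\<Sum>a\<in>k. \<psi> (a * (bipoly D c x (fst b) + snd b + J x - w))) = 0"
      unfolding u_def[symmetric] v_def[symmetric] by (simp add: additive_character_sum[OF \<psi>])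
  qed
  finally have tot: "(\<Sum>a\<in>k. T a * Wh a) = 0" .
  have T0: "T 0 * Wh 0 = of_nat (card X * card B * card W)"
  proof -
    have "T 0 * Wh 0 = (\<Sum>x\<in>X. \<Sum>(u, v)\<in>B. \<Sum>w\<in>W. 1)"
      using expand[OF zero_k] by (simp add: additive_character_0[OF \<psi>])
    then show ?thesis by (simp add: case_prod_beta)
  qed
  have "(\<Sum>a\<in>k. T a * Wh a) = T 0 * Wh 0 + (\<Sum>a\<in>k - {0}. T a * Wh a)"
    using sum.remove[OF finite_k zero_k] by blast
  then have "T 0 * Wh 0 = - (\<Sum>a\<in>k - {0}. T a * Wh a)" using tot by (simp add: eq_neg_iff_add_eq_0)
  then have "cmod (T 0 * Wh 0) \<le> (\<Sum>a\<in>k - {0}. cmod (T a) * cmod (Wh a))"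
    by (simp only: norm_minus_cancel) (rule sum_norm_le, simp add: norm_mult)
  also have "\<dots> \<le> (\<Sum>a\<in>k - {0}. sqrt (real (card X) * R) * (sqrt (NB a) * cmod (Wh a)))"
  proof (rule sum_mono)
    fix a assume a: "a \<in> k - {0}"
    have "(cmod (T a))\<^sup>2 \<le> real (card X) * R * NB a"
      unfolding T_def NB_def R_def
      by (rule bipoly_bilinear_bound[where c = c, OF \<psi> _ _ c D nz X]) (use a in \<open>auto simp: pnorm mult_k'\<close>)
    then have "cmod (T a) \<le> sqrt (real (card X) * R * NB a)" by (rule real_le_rsqrt)
    then have "cmod (T a) \<le> sqrt (real (card X) * R) * sqrt (NB a)" by (simp add: real_sqrt_mult)
    then show "cmod (T a) * cmod (Wh a) \<le> sqrt (real (card X) * R) * (sqrt (NB a) * cmod (Wh a))"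
      by (simp add: mult_right_mono mult.assoc[symmetric])
  qed
  also have "\<dots> = sqrt (real (card X) * R) * (\<Sum>a\<in>k - {0}. sqrt (NB a) * cmod (Wh a))" by (simp add: sum_distrib_left)
  also have "\<dots> \<le> sqrt (real (card X) * R) * (\<Sum>a\<in>k. sqrt (NB a) * cmod (Wh a))"
    by (intro mult_left_mono sum_mono2 finite_k) (auto simp: R_def NB_def sum_nonneg)
  finally have main: "cmod (T 0 * Wh 0) \<le> sqrt (real (card X) * R) * (\<Sum>a\<in>k. sqrt (NB a) * cmod (Wh a))" .
  have NBnn: "NB a \<ge> 0" for a by (simp add: NB_def sum_nonneg)
  have sumNB: "(\<Sum>a\<in>k. NB a) = real q * real (card B)"
  proof -
    have "(\<Sum>a\<in>k. NB a) = (\<Sum>u\<in>k. \<Sum>a\<in>k. (cmod (\<beta> a u))\<^sup>2)" unfolding NB_def by (rule sum.swap)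
    also have "\<dots> = (\<Sum>u\<in>k. real q * real (card (Bu u)))"
      unfolding \<beta>_def by (intro sum.cong refl character_parseval[OF \<psi> Buk])
    also have "\<dots> = real q * real (card B)"
      unfolding BS by (subst card_SigmaI) (auto simp: finite_k finBu sum_distrib_left)
    finally show ?thesis .
  qed
  have sumW: "(\<Sum>a\<in>k. (cmod (Wh a))\<^sup>2) = real q * real (card W)"
  proof -
    have inj: "inj_on uminus W" by (auto simp: inj_on_def)
    have "Wh a = (\<Sum>w\<in>uminus ` W. \<psi> (a * w))" for a
      unfolding Wh_def by (subst sum.reindex[OF inj]) simp
    moreover have "uminus ` W \<subseteq> k" using W minus_k by auto
    ultimately show ?thesis using character_parseval[OF \<psi>, of "uminus ` W"] card_image[OF inj] by simp
  qed
  have "(\<Sum>a\<in>k. sqrt (NB a) * cmod (Wh a))\<^sup>2 \<le> (\<Sum>a\<in>k. (sqrt (NB a))\<^sup>2) * (\<Sum>a\<in>k. (cmod (Wh a))\<^sup>2)"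
    by (rule Cauchy_Schwarz_ineq_sum)
  then have CS: "(\<Sum>a\<in>k. sqrt (NB a) * cmod (Wh a))\<^sup>2 \<le> (real q * real (card B)) * (real q * real (card W))"
    using NBnn sumNB sumW by simp
  define S where "S = real (card X) * real (card B) * real (card W)"
  have "S \<le> sqrt (real (card X) * R) * (\<Sum>a\<in>k. sqrt (NB a) * cmod (Wh a))"
    using main unfolding T0 S_def norm_of_nat by simp
  then have "S\<^sup>2 \<le> (sqrt (real (card X) * R) * (\<Sum>a\<in>k. sqrt (NB a) * cmod (Wh a)))\<^sup>2"
    by (intro power_mono) (auto simp: S_def)
  also have "\<dots> = real (card X) * R * (\<Sum>a\<in>k. sqrt (NB a) * cmod (Wh a))\<^sup>2"
    by (simp add: power_mult_distrib R_def)
  also have "\<dots> \<le> real (card X) * R * ((real q * real (card B)) * (real q * real (card W)))"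
    by (intro mult_left_mono CS) (simp add: R_def)
  \<comment> \<open>After squaring, the product of the three cardinalities reappears on the right
    and can be cancelled once.\<close>
  also have "\<dots> = S * (R * (real q)\<^sup>2)" by (simp add: S_def power2_eq_square algebra_simps)
  finally have fin2: "S * S \<le> S * (R * (real q)\<^sup>2)" by (simp add: power2_eq_square)
  have "S \<le> R * (real q)\<^sup>2"
  proof (cases "S > 0")
    case True then show ?thesis using fin2 by simp
  next
    case False
    have "R * (real q)\<^sup>2 \<ge> 0" by (simp add: R_def)
    then show ?thesis using False by linarith
  qed
  also have "R * (real q)\<^sup>2 = 2 * real D * (real q ^ 3 * sqrt (real q))" by (simp add: R_def power2_eq_square power3_eq_cube)
  finally show ?thesis by (simp add: S_def)
qed

end

section \<open>Fibres of a pair of polynomials\<close>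

abbreviation cconst2 :: "'b::comm_ring_1 \<Rightarrow> 'b poly poly" where "cconst2 x \<equiv> [:[:x:]:]"

definition bicoeff :: "'b::comm_ring_1 poly poly \<Rightarrow> nat \<Rightarrow> nat \<Rightarrow> 'b"
  where "bicoeff G a b = poly.coeff (poly.coeff G a) b"

lemma bicoeff_mult:
  "bicoeff (G * H) n m = (\<Sum>i\<le>n. \<Sum>j\<le>m. bicoeff G i j * bicoeff H (n - i) (m - j))"
  by (simp add: bicoeff_def coeff_mult coeff_sum)

lemma bicoeff_simps [simp]:
  "bicoeff 0 a b = 0" "bicoeff (G + H) a b = bicoeff G a b + bicoeff H a b"
  "bicoeff (G - H) a b = bicoeff G a b - bicoeff H a b"
  "bicoeff (Polynomial.smult [:x:] G) a b = x * bicoeff G a b"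
  by (simp_all add: bicoeff_def)

lemma bicoeff_const: "bicoeff (cconst2 x) a b = (if a = 0 \<and> b = 0 then x else 0)"
  by (auto simp: bicoeff_def coeff_pCons split: nat.split)

lemma bicoeff_1: "bicoeff 1 a b = (if a = 0 \<and> b = 0 then 1 else 0)"
  using bicoeff_const[of 1 a b] by (simp add: one_pCons)

lemma bicoeff_sum: "bicoeff (sum f A) a b = (\<Sum>i\<in>A. bicoeff (f i) a b)"
  by (simp add: bicoeff_def coeff_sum)

lemma bicoeff_eqI: "(\<And>a b. bicoeff G a b = bicoeff H a b) \<Longrightarrow> G = H"
  by (simp add: bicoeff_def poly_eq_iff)

definition tdeg_le :: "'b::comm_ring_1 poly poly \<Rightarrow> nat \<Rightarrow> bool"
  where "tdeg_le G n \<longleftrightarrow> (\<forall>a b. bicoeff G a b \<noteq> 0 \<longrightarrow> a + b \<le> n)"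

lemma tdeg_le_mult: assumes "tdeg_le G n" "tdeg_le H m" shows "tdeg_le (G * H) (n + m)"
  unfolding tdeg_le_def
proof (intro allI impI)
  fix a b assume "bicoeff (G * H) a b \<noteq> 0"
  then obtain i where i: "i \<le> a" "(\<Sum>j\<le>b. bicoeff G i j * bicoeff H (a - i) (b - j)) \<noteq> 0"
    unfolding bicoeff_mult by (meson atMost_iff sum.not_neutral_contains_not_neutral)
  then obtain j where j: "j \<le> b" "bicoeff G i j * bicoeff H (a - i) (b - j) \<noteq> 0"
    by (meson atMost_iff sum.not_neutral_contains_not_neutral)
  then have "bicoeff G i j \<noteq> 0" "bicoeff H (a - i) (b - j) \<noteq> 0" by auto
  then have "i + j \<le> n" "(a - i) + (b - j) \<le> m" using assms unfolding tdeg_le_def by blast+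
  then show "a + b \<le> n + m" using i(1) j(1) by linarith
qed

lemma tdeg_le_mono: "tdeg_le G n \<Longrightarrow> n \<le> m \<Longrightarrow> tdeg_le G m"
  unfolding tdeg_le_def by fastforce

lemma tdeg_le_const: "tdeg_le (cconst2 x) 0"
  by (simp add: tdeg_le_def bicoeff_const)

lemma tdeg_le_sum: "(\<And>i. i \<in> A \<Longrightarrow> tdeg_le (f i) n) \<Longrightarrow> tdeg_le (sum f A) n"
  unfolding tdeg_le_def bicoeff_sum by (meson sum.not_neutral_contains_not_neutral)

lemma tdeg_le_power: "tdeg_le G n \<Longrightarrow> tdeg_le (G ^ j) (j * n)"
proof (induction j)
  case 0 then show ?case by (simp add: tdeg_le_def bicoeff_1)
next
  case (Suc j) then show ?case using tdeg_le_mult[of G n "G ^ j" "j * n"] by simp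
qed

text \<open>Graded lexicographic order: no monomial of \<open>G\<close> exceeds
  \<open>(a, b)\<close>, which itself need not occur. The order is compatible with products, so top
  coefficients multiply.\<close>

definition lead_bound :: "'b::comm_ring_1 poly poly \<Rightarrow> nat \<Rightarrow> nat \<Rightarrow> bool"
  where "lead_bound G a b \<longleftrightarrow>
    (\<forall>a' b'. bicoeff G a' b' \<noteq> 0 \<longrightarrow> a' + b' < a + b \<or> a' + b' = a + b \<and> a' \<le> a)"

lemma lead_bound_mult:
  assumes "lead_bound G a b" "lead_bound H c d"
  shows "lead_bound (G * H) (a + c) (b + d)"
    and "bicoeff (G * H) (a + c) (b + d) = bicoeff G a b * bicoeff H c d"
proof -
  show "lead_bound (G * H) (a + c) (b + d)"
    unfolding lead_bound_def
  proof (intro allI impI)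
    fix n m assume "bicoeff (G * H) n m \<noteq> 0"
    then obtain i where i: "i \<le> n" "(\<Sum>j\<le>m. bicoeff G i j * bicoeff H (n - i) (m - j)) \<noteq> 0"
      unfolding bicoeff_mult by (meson atMost_iff sum.not_neutral_contains_not_neutral)
    then obtain j where j: "j \<le> m" "bicoeff G i j * bicoeff H (n - i) (m - j) \<noteq> 0"
      by (meson atMost_iff sum.not_neutral_contains_not_neutral)
    then have "bicoeff G i j \<noteq> 0" "bicoeff H (n - i) (m - j) \<noteq> 0" by auto
    then have "i + j < a + b \<or> i + j = a + b \<and> i \<le> a"
      "(n - i) + (m - j) < c + d \<or> (n - i) + (m - j) = c + d \<and> n - i \<le> c"
      using assms unfolding lead_bound_def by blast+
    then show "n + m < a + c + (b + d) \<or> n + m = a + c + (b + d) \<and> n \<le> a + c"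
      using i(1) j(1) by linarith
  qed
  have z: "bicoeff G i j * bicoeff H (a + c - i) (b + d - j) = 0"
    if "i \<le> a + c" "j \<le> b + d" "(i, j) \<noteq> (a, b)" for i j
  proof (rule ccontr)
    assume "\<not> ?thesis"
    then have "bicoeff G i j \<noteq> 0" "bicoeff H (a + c - i) (b + d - j) \<noteq> 0" by auto
    then have "i + j < a + b \<or> i + j = a + b \<and> i \<le> a"
      "(a + c - i) + (b + d - j) < c + d \<or> (a + c - i) + (b + d - j) = c + d \<and> a + c - i \<le> c"
      using assms unfolding lead_bound_def by blast+
    then have "i = a \<and> j = b" using that(1,2) by linarith
    then show False using that(3) by simp
  qed
  have "bicoeff (G * H) (a + c) (b + d)
      = (\<Sum>i\<le>a + c. \<Sum>j\<le>b + d. if i = a \<and> j = b then bicoeff G a b * bicoeff H c d else 0)"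
    unfolding bicoeff_mult using z by (intro sum.cong refl) auto
  also have "\<dots> = (\<Sum>i\<le>a + c. if i = a then bicoeff G a b * bicoeff H c d else 0)"
    by (intro sum.cong refl) (auto simp: sum.delta)
  also have "\<dots> = bicoeff G a b * bicoeff H c d" by (simp add: sum.delta)
  finally show "bicoeff (G * H) (a + c) (b + d) = bicoeff G a b * bicoeff H c d" .
qed

lemma lead_bound_power:
  assumes "lead_bound G a b"
  shows "lead_bound (G ^ j) (j * a) (j * b) \<and> bicoeff (G ^ j) (j * a) (j * b) = bicoeff G a b ^ j"
proof (induction j)
  case 0 then show ?case by (simp add: lead_bound_def bicoeff_1)
next
  case (Suc j)
  then show ?case using lead_bound_mult[OF assms, of "G ^ j" "j * a" "j * b"] by simp
qed

definition bieval :: "'b::comm_ring_1 poly poly \<Rightarrow> 'b \<Rightarrow> 'b \<Rightarrow> 'b"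
  where "bieval G y z = poly (poly G [:y:]) z"

lemma bieval_simps [simp]:
  "bieval (G + H) y z = bieval G y z + bieval H y z"
  "bieval (G * H) y z = bieval G y z * bieval H y z"
  "bieval (G ^ n) y z = bieval G y z ^ n"
  "bieval (Polynomial.smult [:x:] G) y z = x * bieval G y z"
  "bieval (cconst2 x) y z = x" "bieval 0 y z = 0"
  "bieval [:0, 1:] y z = y" "bieval [:[:0, 1:]:] y z = z"
  by (simp_all add: bieval_def)

lemma bieval_sum: "bieval (sum f A) y z = (\<Sum>i\<in>A. bieval (f i) y z)"
  by (simp add: bieval_def poly_sum)

lemma bieval_altdef:
  assumes "\<And>i. i > n \<Longrightarrow> poly.coeff G i = 0"
  shows "bieval G y z = (\<Sum>i\<le>n. poly (poly.coeff G i) z * y ^ i)"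
proof -
  have "degree G \<le> n" using assms by (intro degree_le) auto
  have "bieval G y z = (\<Sum>i\<le>degree G. poly (poly.coeff G i) z * y ^ i)"
    unfolding bieval_def poly_altdef[of G] by (simp add: poly_sum)
  also have "\<dots> = (\<Sum>i\<le>n. poly (poly.coeff G i) z * y ^ i)"
    by (rule sum.mono_neutral_left) (use \<open>degree G \<le> n\<close> in \<open>auto simp: coeff_eq_0\<close>)
  finally show ?thesis .
qed

text \<open>Just above \<open>(2 * d + 2)\<^sup>2\<close>, so that the cube of this number, a count
  of coefficients, exceeds the count of monomials in
  \<open>algebraic_relation_exists\<close>.\<close>

definition fibre_degree :: "nat \<Rightarrow> nat" where "fibre_degree d = (2 * d + 2)\<^sup>2 + 1"

context field_ideal
begin

definition kbipoly :: "'w poly poly set" where "kbipoly = {G. \<forall>a b. bicoeff G a b \<in> k}"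

lemma kbipoly_sum: "(\<And>i. i \<in> A \<Longrightarrow> f i \<in> kbipoly) \<Longrightarrow> sum f A \<in> kbipoly"
  by (auto simp: kbipoly_def bicoeff_sum intro!: sum_k)

lemma kbipoly_mult: "G \<in> kbipoly \<Longrightarrow> H * G \<in> kbipoly"
  by (auto simp: kbipoly_def bicoeff_mult intro!: sum_k mult_k)

lemma kbipoly_mult': "G \<in> kbipoly \<Longrightarrow> G * H \<in> kbipoly" using kbipoly_mult[of G H] by (simp add: mult.commute)

lemma kbipoly_const: "x \<in> k \<Longrightarrow> cconst2 x \<in> kbipoly"
  by (simp add: kbipoly_def bicoeff_const zero_k)

lemma kbipoly_add: "G \<in> kbipoly \<Longrightarrow> H \<in> kbipoly \<Longrightarrow> G + H \<in> kbipoly"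
  by (simp add: kbipoly_def add_k)

lemma poly_in_k: "f \<in> kpoly \<Longrightarrow> poly f z \<in> k"
  unfolding poly_altdef by (intro sum_k mult_k') (simp add: kpoly_def)

lemma bieval_in_k: assumes "G \<in> kbipoly" shows "bieval G y z \<in> k"
proof -
  have "bieval G y z = (\<Sum>i\<le>degree G. poly (poly.coeff G i) z * y ^ i)"
    by (rule bieval_altdef) (simp add: coeff_eq_0)
  also have "\<dots> \<in> k"
    using assms by (intro sum_k mult_k' poly_in_k) (auto simp: kbipoly_def kpoly_def bicoeff_def)
  finally show ?thesis .
qed

text \<open>Fix a nonzero coefficient of \<open>G\<close> as a polynomial in y. At most
  \<open>n\<close> values z annihilate it, costing \<open>q\<close> points each; for every other z
  there are at most \<open>n\<close> roots y.\<close>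

lemma card_bieval_zeros_le:
  assumes G: "G \<in> kbipoly" "G \<noteq> 0" "tdeg_le G n"
  shows "card {(y, z) \<in> k \<times> k. bieval G y z = 0} \<le> 2 * n * q"
proof -
  have "\<exists>a b. bicoeff G a b \<noteq> 0"
  proof (rule ccontr)
    assume "\<not> ?thesis"
    then have "G = 0" by (intro bicoeff_eqI) simp
    then show False using G(2) by simp
  qed
  then obtain a b where ab: "bicoeff G a b \<noteq> 0" by blast
  then have abn: "a + b \<le> n" using G(3) unfolding tdeg_le_def by blast
  have hi: "bicoeff G i j = 0" if "i + j > n" for i j using G(3) that unfolding tdeg_le_def by (meson not_less)
  have pk: "poly.coeff G i \<in> kpoly" for i using G(1) by (simp add: kbipoly_def kpoly_def bicoeff_def)
  have z0: "poly.coeff G i = 0" if "i > n" for i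
    using hi that by (intro poly_eqI) (simp add: bicoeff_def)
  define Z where "Z = {z \<in> k. poly (poly.coeff G a) z = 0}"
  have "poly (poly.coeff G a) z = (\<Sum>j\<le>n. bicoeff G a j * z ^ j)" for z
  proof -
    have "poly.coeff (poly.coeff G a) i = 0" if "i > n" for i using hi[of a i] that by (simp add: bicoeff_def)
    then have "degree (poly.coeff G a) \<le> n" by (intro degree_le) auto
    then show ?thesis unfolding poly_altdef bicoeff_def
      by (intro sum.mono_neutral_left) (auto simp: coeff_eq_0)
  qed
  then have cZ: "card Z \<le> n" unfolding Z_def
    using card_roots_le[of "bicoeff G a" b n] ab abn G(1) by (simp add: kbipoly_def)
  have bialt: "bieval G y z = (\<Sum>i\<le>n. poly (poly.coeff G i) z * y ^ i)" for y z
    by (rule bieval_altdef[OF z0])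
  have cY: "card {y \<in> k. bieval G y z = 0} \<le> n" if "z \<in> k - Z" for z
    unfolding bialt
    using card_roots_le[of "\<lambda>i. poly (poly.coeff G i) z" a n] poly_in_k[OF pk] that abn by (simp add: Z_def)
  have "{(y, z) \<in> k \<times> k. bieval G y z = 0} \<subseteq> k \<times> Z \<union> (\<lambda>(z, y). (y, z)) ` (SIGMA z:k - Z. {y \<in> k. bieval G y z = 0})"
    by force
  then have "card {(y, z) \<in> k \<times> k. bieval G y z = 0}
      \<le> card (k \<times> Z \<union> (\<lambda>(z, y). (y, z)) ` (SIGMA z:k - Z. {y \<in> k. bieval G y z = 0}))"
    by (rule card_mono[rotated]) (auto simp: finite_k Z_def)
  also have "\<dots> \<le> card (k \<times> Z) + card ((\<lambda>(z, y). (y, z)) ` (SIGMA z:k - Z. {y \<in> k. bieval G y z = 0}))"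
    by (rule card_Un_le)
  also have "card ((\<lambda>(z, y). (y, z)) ` (SIGMA z:k - Z. {y \<in> k. bieval G y z = 0}))
      \<le> card (SIGMA z:k - Z. {y \<in> k. bieval G y z = 0})"
    by (rule card_image_le) (auto simp: finite_k)
  also have "\<dots> = (\<Sum>z\<in>k - Z. card {y \<in> k. bieval G y z = 0})"
    by (rule card_SigmaI) (auto simp: finite_k)
  also have "\<dots> \<le> (\<Sum>z\<in>k - Z. n)" by (rule sum_mono) (rule cY)
  also have "\<dots> \<le> q * n" unfolding q_def using card_mono[OF finite_k, of "k - Z"] by simp
  also have "card (k \<times> Z) \<le> q * n" using cZ by (simp add: card_cartesian_product q_def)
  finally show ?thesis by (simp add: algebra_simps)
qed

lemma kbipoly_tdeg_card:
  "finite {G \<in> kbipoly. tdeg_le G n}" "card {G \<in> kbipoly. tdeg_le G n} \<le> q ^ ((n + 1)\<^sup>2)"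
proof -
  define f where "f G = restrict (\<lambda>(a, b). bicoeff G a b) ({..n} \<times> {..n})" for G :: "'w poly poly"
  have inj: "inj_on f {G \<in> kbipoly. tdeg_le G n}"
  proof (rule inj_onI, rule bicoeff_eqI)
    fix G H a b assume *: "G \<in> {G \<in> kbipoly. tdeg_le G n}" "H \<in> {G \<in> kbipoly. tdeg_le G n}" "f G = f H"
    show "bicoeff G a b = bicoeff H a b"
    proof (cases "a \<le> n \<and> b \<le> n")
      case True
      then show ?thesis using fun_cong[OF *(3), of "(a, b)"] by (simp add: f_def)
    next
      case False
      then have "\<not> a + b \<le> n" by linarith
      then have "bicoeff G a b = 0" "bicoeff H a b = 0" using * unfolding tdeg_le_def by blast+
      then show ?thesis by simp
    qed
  qed
  have sub: "f ` {G \<in> kbipoly. tdeg_le G n} \<subseteq> ({..n} \<times> {..n}) \<rightarrow>\<^sub>E k"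
    unfolding f_def by (intro image_subsetI) (simp add: restrict_PiE_iff kbipoly_def case_prod_unfold)
  have fin: "finite (({..n} \<times> {..n}) \<rightarrow>\<^sub>E k)" by (intro finite_PiE) (auto simp: finite_k)
  show "finite {G \<in> kbipoly. tdeg_le G n}" using inj_on_finite[OF inj sub fin] .
  show "card {G \<in> kbipoly. tdeg_le G n} \<le> q ^ ((n + 1)\<^sup>2)"
    using card_inj_on_le[OF inj sub fin] by (simp add: card_PiE q_def power2_eq_square)
qed

text \<open>Three polynomials in two variables are algebraically dependent. By pigeonhole: there are
  \<open>M ^ 3\<close> coefficients, while all the combinations have total degree at most
  \<open>(2 * d + 1) * M\<close>, so their number of monomials is only quadratic in
  \<open>M\<close>.\<close>

lemma algebraic_relation_exists:
  assumes "tdeg_le U 1" "tdeg_le G d" "tdeg_le H d" and M: "M = fibre_degree d"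
  shows "\<exists>Q a0 b0 c0. (\<forall>a b c. Q a b c \<in> k) \<and> a0 < M \<and> b0 < M \<and> c0 < M \<and> Q a0 b0 c0 \<noteq> 0 \<and>
    (\<Sum>a<M. U ^ a * (\<Sum>b<M. \<Sum>c<M. cconst2 (Q a b c) * (G ^ b * H ^ c))) = 0"
proof -
  define X where "X = {..<M} \<times> {..<M} \<times> {..<M}"
  have finX: "finite X" and cX: "card X = M ^ 3"
    by (simp_all add: X_def card_cartesian_product power3_eq_cube)
  define n where "n = (2 * d + 1) * M"
  define f where "f Q = (\<Sum>(a, b, c)\<in>X. cconst2 (Q (a, b, c)) * (U ^ a * (G ^ b * H ^ c)))" for Q :: "nat \<times> nat \<times> nat \<Rightarrow> 'w"
  have "f Q \<in> {G \<in> kbipoly. tdeg_le G n}" if Q: "Q \<in> X \<rightarrow>\<^sub>E k" for Q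
  proof -
    have "f Q \<in> kbipoly" unfolding f_def case_prod_unfold
      using Q by (intro kbipoly_sum kbipoly_mult' kbipoly_const) auto
    moreover have "tdeg_le (f Q) n" unfolding f_def case_prod_unfold
    proof (rule tdeg_le_sum)
      fix x assume "x \<in> X"
      then obtain a b c where x: "x = (a, b, c)" "a < M" "b < M" "c < M" by (auto simp: X_def)
      have "tdeg_le (cconst2 (Q x) * (U ^ a * (G ^ b * H ^ c))) (0 + (a * 1 + (b * d + c * d)))"
        by (intro tdeg_le_mult tdeg_le_const tdeg_le_power assms)
      moreover have "0 + (a * 1 + (b * d + c * d)) \<le> n"
      proof -
        have "b * d \<le> M * d" "c * d \<le> M * d" using x by auto
        then have "0 + (a * 1 + (b * d + c * d)) \<le> M + (M * d + M * d)" using x(2) by linarith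
        then show ?thesis unfolding n_def by (simp add: algebra_simps)
      qed
      ultimately show "tdeg_le (cconst2 (Q (fst x, fst (snd x), snd (snd x))) * (U ^ fst x * (G ^ fst (snd x) * H ^ snd (snd x)))) n"
        using tdeg_le_mono by (simp add: x)
    qed
    ultimately show ?thesis by simp
  qed
  then have sub: "f ` (X \<rightarrow>\<^sub>E k) \<subseteq> {G \<in> kbipoly. tdeg_le G n}" by blast
  have "\<not> inj_on f (X \<rightarrow>\<^sub>E k)"
  proof
    assume inj: "inj_on f (X \<rightarrow>\<^sub>E k)"
    have "q ^ (M ^ 3) = card (X \<rightarrow>\<^sub>E k)" using finX by (simp add: card_PiE cX q_def)
    also have "\<dots> \<le> q ^ ((n + 1)\<^sup>2)"
      using card_inj_on_le[OF inj sub kbipoly_tdeg_card(1)] kbipoly_tdeg_card(2)[of n] by simp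
    finally have "q ^ (M ^ 3) \<le> q ^ ((n + 1)\<^sup>2)" .
    moreover have "1 < q" using q_ge_2 by simp
    ultimately have "M ^ 3 \<le> (n + 1)\<^sup>2" by (simp only: power_le_imp_le_exp)
    also have "\<dots> \<le> ((2 * d + 2) * M)\<^sup>2"
      by (intro power_mono) (simp_all add: n_def M fibre_degree_def)
    also have "\<dots> = (2 * d + 2)\<^sup>2 * M\<^sup>2" by (simp only: power_mult_distrib)
    also have "\<dots> < M * M\<^sup>2" by (simp add: M fibre_degree_def)
    also have "\<dots> = M ^ 3" by (simp add: power2_eq_square power3_eq_cube)
    finally show False by simp
  qed
  then obtain Q1 Q2 where Q: "Q1 \<in> X \<rightarrow>\<^sub>E k" "Q2 \<in> X \<rightarrow>\<^sub>E k" "f Q1 = f Q2" "Q1 \<noteq> Q2"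
    unfolding inj_on_def by blast
  define Q where "Q a b c = (if (a, b, c) \<in> X then Q1 (a, b, c) - Q2 (a, b, c) else 0)" for a b c
  have 1: "Q a b c \<in> k" for a b c using Q by (auto simp: Q_def zero_k intro!: diff_k)
  have "\<exists>x\<in>X. Q1 x \<noteq> Q2 x"
    using Q(4) PiE_ext[OF Q(1,2)] by blast
  then obtain a0 b0 c0 where "(a0, b0, c0) \<in> X" "Q1 (a0, b0, c0) \<noteq> Q2 (a0, b0, c0)"
    by (metis prod_cases3)
  then have 2: "a0 < M" "b0 < M" "c0 < M" "Q a0 b0 c0 \<noteq> 0" by (auto simp: Q_def X_def)
  have "(\<Sum>a<M. U ^ a * (\<Sum>b<M. \<Sum>c<M. cconst2 (Q a b c) * (G ^ b * H ^ c)))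
      = (\<Sum>a<M. \<Sum>b<M. \<Sum>c<M. cconst2 (Q1 (a, b, c)) * (U ^ a * (G ^ b * H ^ c)) - cconst2 (Q2 (a, b, c)) * (U ^ a * (G ^ b * H ^ c)))"
    unfolding sum_distrib_left
  proof (intro sum.cong refl)
    fix a b c assume abc: "a \<in> {..<M}" "b \<in> {..<M}" "c \<in> {..<M}"
    define A where "A = U ^ a * (G ^ b * H ^ c)"
    have "U ^ a * (cconst2 (Q a b c) * (G ^ b * H ^ c)) = cconst2 (Q a b c) * A"
      unfolding A_def by (rule mult.left_commute)
    also have "\<dots> = cconst2 (Q1 (a, b, c)) * A - cconst2 (Q2 (a, b, c)) * A"
      by (rule bicoeff_eqI) (use abc in \<open>simp add: Q_def X_def left_diff_distrib\<close>)
    finally show "U ^ a * (cconst2 (Q a b c) * (G ^ b * H ^ c)) =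
      cconst2 (Q1 (a, b, c)) * (U ^ a * (G ^ b * H ^ c)) - cconst2 (Q2 (a, b, c)) * (U ^ a * (G ^ b * H ^ c))"
      unfolding A_def .
  qed
  also have "\<dots> = f Q1 - f Q2"
    by (simp add: f_def X_def sum.cartesian_product[symmetric] sum_subtractf)
  finally have "(\<Sum>a<M. U ^ a * (\<Sum>b<M. \<Sum>c<M. cconst2 (Q a b c) * (G ^ b * H ^ c))) = 0"
    using Q(3) by simp
  with 1 2 show ?thesis by (intro exI[of _ Q] exI[of _ a0] exI[of _ b0] exI[of _ c0] conjI allI)
qed

text \<open>On a fibre of \<open>(G, H)\<close> the relation becomes an equation of degree below
  \<open>M\<close> for the value of \<open>U\<close> alone. It is nontrivial off the zeros of one
  coefficient \<open>C a0\<close>, a nonzero polynomial by independence; these zeros form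
  \<open>Ex\<close>. The alternative condition on \<open>U\<close> admits the coordinates, whose
  coefficient 1 need not lie in \<open>k\<close>.\<close>

lemma fibre_coordinate_bound:
  assumes U: "tdeg_le U 1" "U \<in> kbipoly \<or> (\<forall>y\<in>k. \<forall>z\<in>k. bieval U y z \<in> k)"
    and G: "tdeg_le G d" "G \<in> kbipoly" and H: "tdeg_le H d" "H \<in> kbipoly"
    and M: "M = fibre_degree d"
    and indep: "\<And>Q N. (\<And>b c. Q b c \<in> k) \<Longrightarrow> (\<Sum>b<N. \<Sum>c<N. cconst2 (Q b c) * (G ^ b * H ^ c)) = 0
      \<Longrightarrow> \<forall>b<N. \<forall>c<N. Q b c = (0::'w)"
  obtains Ex where "Ex \<subseteq> k \<times> k" "card Ex \<le> 4 * d * M * q"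
    "\<And>u v. card (((\<lambda>(y, z). bieval U y z) ` {(y, z) \<in> k \<times> k - Ex. bieval G y z = u \<and> bieval H y z = v})) \<le> M"
proof -
  obtain Q a0 b0 c0 where Q': "\<forall>a b c. Q a b c \<in> k" and Q2: "a0 < M" "b0 < M" "c0 < M" "Q a0 b0 c0 \<noteq> 0"
    "(\<Sum>a<M. U ^ a * (\<Sum>b<M. \<Sum>c<M. cconst2 (Q a b c) * (G ^ b * H ^ c))) = 0"
    using algebraic_relation_exists[OF U(1) G(1) H(1) M] by blast
  have Q1: "Q a b c \<in> k" for a b c using Q' by blast
  note Q = Q1 Q2
  define C where "C a = (\<Sum>b<M. \<Sum>c<M. cconst2 (Q a b c) * (G ^ b * H ^ c))" for a
  have Ck: "C a \<in> kbipoly" for a unfolding C_def by (intro kbipoly_sum kbipoly_mult' kbipoly_const Q)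
  have C0: "C a0 \<noteq> 0"
    using indep[of "Q a0" M] Q unfolding C_def by blast
  have Ct: "tdeg_le (C a0) (2 * d * M)" unfolding C_def
  proof (intro tdeg_le_sum)
    fix b c assume bc: "b \<in> {..<M}" "c \<in> {..<M}"
    have "tdeg_le (cconst2 (Q a0 b c) * (G ^ b * H ^ c)) (0 + (b * d + c * d))"
      by (intro tdeg_le_mult tdeg_le_const tdeg_le_power G H)
    moreover have "0 + (b * d + c * d) \<le> 2 * d * M"
    proof -
      have "b * d \<le> M * d" "c * d \<le> M * d" using bc by auto
      then have "0 + (b * d + c * d) \<le> M * d + M * d" by linarith
      then show ?thesis by (simp add: algebra_simps)
    qed
    ultimately show "tdeg_le (cconst2 (Q a0 b c) * (G ^ b * H ^ c)) (2 * d * M)" by (rule tdeg_le_mono)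
  qed
  define Ex where "Ex = {(y, z) \<in> k \<times> k. bieval (C a0) y z = 0}"
  have cE: "card Ex \<le> 4 * d * M * q"
    using card_bieval_zeros_le[OF Ck C0 Ct] by (simp add: Ex_def mult.assoc)
  have fib: "card ((\<lambda>(y, z). bieval U y z) ` {(y, z) \<in> k \<times> k - Ex. bieval G y z = u \<and> bieval H y z = v}) \<le> M" for u v
  proof -
    define S where "S = {(y, z) \<in> k \<times> k - Ex. bieval G y z = u \<and> bieval H y z = v}"
    define g where "g a = (if a < M then \<Sum>b<M. \<Sum>c<M. Q a b c * (u ^ b * v ^ c) else 0)" for a
    have gk: "g a \<in> k" for a by (auto simp: g_def zero_k intro!: sum_k mult_k' Q)
    have gC: "bieval (C a) y z = g a" if "(y, z) \<in> S" "a < M" for y z a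
      using that by (simp add: C_def S_def g_def bieval_sum)
    show ?thesis
    proof (cases "S = {}")
      case True then show ?thesis unfolding S_def[symmetric] by simp
    next
      case False
      then obtain y z where yz: "(y, z) \<in> S" by auto
      then have "g a0 \<noteq> 0" using gC[OF yz Q(2)] by (auto simp: S_def Ex_def)
      have "(\<lambda>(y, z). bieval U y z) ` S \<subseteq> {t \<in> k. (\<Sum>a\<le>M. g a * t ^ a) = 0}"
      proof
        fix t assume "t \<in> (\<lambda>(y, z). bieval U y z) ` S"
        then obtain y z where t: "(y, z) \<in> S" "t = bieval U y z" by auto
        have "(\<Sum>a\<le>M. g a * t ^ a) = (\<Sum>a<M. g a * t ^ a)"
          by (rule sum.mono_neutral_right) (auto simp: g_def)
        also have "\<dots> = bieval (\<Sum>a<M. U ^ a * C a) y z"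
          using gC[OF t(1)] by (simp add: bieval_sum t(2) mult.commute)
        also have "\<dots> = 0" using Q(6) by (simp add: C_def)
        finally show "t \<in> {t \<in> k. (\<Sum>a\<le>M. g a * t ^ a) = 0}"
          using U(2) t bieval_in_k by (auto simp: S_def)
      qed
      then have "card ((\<lambda>(y, z). bieval U y z) ` S) \<le> card {t \<in> k. (\<Sum>a\<le>M. g a * t ^ a) = 0}"
        by (rule card_mono[rotated]) (simp add: finite_k)
      also have "\<dots> \<le> M" using card_roots_le[of g a0 M, OF gk] Q(2) \<open>g a0 \<noteq> 0\<close> by simp
      finally show ?thesis unfolding S_def .
    qed
  qed
  show ?thesis using that[of Ex] cE fib by (auto simp: Ex_def)
qed

text \<open>Used for both coordinates, the preceding bound confines each fibre off
  \<open>E1 \<union> E2\<close> to a product of two sets of at most \<open>M\<close>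
  elements.\<close>

theorem card_image_pair_ge:
  assumes G: "tdeg_le G d" "G \<in> kbipoly" and H: "tdeg_le H d" "H \<in> kbipoly"
    and M: "M = fibre_degree d"
    and indep: "\<And>Q N. (\<And>b c. Q b c \<in> k) \<Longrightarrow> (\<Sum>b<N. \<Sum>c<N. cconst2 (Q b c) * (G ^ b * H ^ c)) = 0
      \<Longrightarrow> \<forall>b<N. \<forall>c<N. Q b c = (0::'w)"
    and YZ: "Y \<subseteq> k" "Z \<subseteq> k"
  shows "card Y * card Z \<le> 8 * d * M * q + M\<^sup>2 * card ((\<lambda>(y, z). (bieval G y z, bieval H y z)) ` (Y \<times> Z))"
proof -
  have ty: "tdeg_le ([:0, 1:] :: 'w poly poly) 1" "tdeg_le ([:[:0, 1:]:] :: 'w poly poly) 1"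
    by (auto simp: tdeg_le_def bicoeff_def coeff_pCons split: nat.splits)
  obtain E1 where E1: "E1 \<subseteq> k \<times> k" "card E1 \<le> 4 * d * M * q"
    "\<And>u v. card (((\<lambda>(y, z). bieval [:0, 1:] y z) ` {(y, z) \<in> k \<times> k - E1. bieval G y z = u \<and> bieval H y z = v})) \<le> M"
    by (rule fibre_coordinate_bound[OF ty(1) _ G H M indep]) auto
  obtain E2 where E2: "E2 \<subseteq> k \<times> k" "card E2 \<le> 4 * d * M * q"
    "\<And>u v. card (((\<lambda>(y, z). bieval [:[:0, 1:]:] y z) ` {(y, z) \<in> k \<times> k - E2. bieval G y z = u \<and> bieval H y z = v})) \<le> M"
    by (rule fibre_coordinate_bound[OF ty(2) _ G H M indep]) auto
  define g where "g = (\<lambda>(y, z). (bieval G y z, bieval H y z))"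
  define S where "S = Y \<times> Z - (E1 \<union> E2)"
  have finYZ: "finite (Y \<times> Z)" using YZ finite_k finite_subset by blast
  have finE: "finite E1" "finite E2" using E1(1) E2(1) finite_k finite_subset finite_cartesian_product by metis+
  have finS: "finite S" using finYZ by (simp add: S_def)
  have fib: "card {s \<in> S. g s = w} \<le> M\<^sup>2" for w
  proof -
    obtain u v where w: "w = (u, v)" by (cases w)
    define A1 where "A1 = (\<lambda>(y, z). bieval [:0, 1:] y z) ` {(y, z) \<in> k \<times> k - E1. bieval G y z = u \<and> bieval H y z = v}"
    define A2 where "A2 = (\<lambda>(y, z). bieval [:[:0, 1:]:] y z) ` {(y, z) \<in> k \<times> k - E2. bieval G y z = u \<and> bieval H y z = v}"
    have "{s \<in> S. g s = w} \<subseteq> A1 \<times> A2"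
    proof
      fix s assume "s \<in> {s \<in> S. g s = w}"
      then obtain y z where s: "s = (y, z)" "(y, z) \<in> Y \<times> Z" "(y, z) \<notin> E1" "(y, z) \<notin> E2" "bieval G y z = u" "bieval H y z = v"
        by (auto simp: S_def g_def w)
      have "(y, z) \<in> k \<times> k" using s(2) YZ by auto
      then have "bieval [:0, 1:] y z \<in> A1" "bieval [:[:0, 1:]:] y z \<in> A2" unfolding A1_def A2_def using s by force+
      then show "s \<in> A1 \<times> A2" using s by simp
    qed
    moreover have "finite (A1 \<times> A2)"
    proof -
      have "finite {(y, z) \<in> k \<times> k - E. bieval G y z = u \<and> bieval H y z = v}" for E
        by (rule finite_subset[of _ "k \<times> k"]) (auto simp: finite_k)
      then show ?thesis unfolding A1_def A2_def by blast
    qed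
    ultimately have "card {s \<in> S. g s = w} \<le> card (A1 \<times> A2)" by (rule card_mono[rotated])
    also have "\<dots> = card A1 * card A2" by (rule card_cartesian_product)
    also have "\<dots> \<le> M * M" unfolding A1_def A2_def by (rule mult_le_mono[OF E1(3) E2(3)])
    finally show ?thesis by (simp add: power2_eq_square)
  qed
  have "card S = (\<Sum>w\<in>g ` S. card {s \<in> S. g s = w})"
    using sum.image_gen[OF finS, of "\<lambda>_. 1::nat" g] by simp
  also have "\<dots> \<le> (\<Sum>w\<in>g ` S. M\<^sup>2)" by (rule sum_mono) (rule fib)
  also have "\<dots> \<le> M\<^sup>2 * card (g ` (Y \<times> Z))"
    using card_mono[of "g ` (Y \<times> Z)" "g ` S"] finYZ by (simp add: S_def image_mono mult.commute)
  finally have cS: "card S \<le> M\<^sup>2 * card (g ` (Y \<times> Z))" .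
  have "card Y * card Z = card (Y \<times> Z)" by (simp add: card_cartesian_product)
  also have "\<dots> \<le> card (S \<union> (E1 \<union> E2))"
    by (rule card_mono) (use finS finE in \<open>auto simp: S_def\<close>)
  also have "\<dots> \<le> card S + (card E1 + card E2)"
    using card_Un_le[of S "E1 \<union> E2"] card_Un_le[of E1 E2] by linarith
  also have "\<dots> \<le> M\<^sup>2 * card (g ` (Y \<times> Z)) + 8 * d * M * q" using cS E1(2) E2(2) by linarith
  finally show ?thesis by (simp add: g_def)
qed

end

section \<open>Reduction to bounded degrees\<close>

context field_ideal
begin

text \<open>The polynomials in \<open>G\<close> with coefficients in \<open>k\<close>. Requiring
  \<open>r\<close> to vanish from \<open>N\<close> on lets two representations be extended to a
  common length.\<close>

definition poly_span :: "'w poly poly \<Rightarrow> 'w poly poly set"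
  where "poly_span G = {T. \<exists>N r. (\<forall>b. r b \<in> k) \<and> (\<forall>b\<ge>N. r b = 0) \<and> T = (\<Sum>b<N. cconst2 (r b) * G ^ b)}"

lemma poly_spanI:
  assumes "\<And>b. b < N \<Longrightarrow> r b \<in> k" shows "(\<Sum>b<N. cconst2 (r b) * G ^ b) \<in> poly_span G"
proof -
  have "(\<Sum>b<N. cconst2 (r b) * G ^ b) = (\<Sum>b<N. cconst2 (if b < N then r b else 0) * G ^ b)" by simp
  then show ?thesis unfolding poly_span_def using assms zero_k
    by (intro CollectI exI[of _ N] exI[of _ "\<lambda>b. if b < N then r b else 0"]) auto
qed

lemma poly_span_extend:
  assumes "T \<in> poly_span G"
  shows "\<exists>N. \<forall>N'\<ge>N. \<exists>r. (\<forall>b. r b \<in> k) \<and> T = (\<Sum>b<N'. cconst2 (r b) * G ^ b)"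
proof -
  obtain N r where r: "\<forall>b. r b \<in> k" "\<forall>b\<ge>N. r b = 0" "T = (\<Sum>b<N. cconst2 (r b) * G ^ b)"
    using assms unfolding poly_span_def by blast
  have "T = (\<Sum>b<N'. cconst2 (r b) * G ^ b)" if "N' \<ge> N" for N'
    unfolding r(3) by (rule sum.mono_neutral_left) (use that r(2) in auto)
  then show ?thesis using r(1) by blast
qed

lemma poly_span_add: assumes "S \<in> poly_span G" "T \<in> poly_span G" shows "S + T \<in> poly_span G"
proof -
  obtain N1 where N1: "\<forall>N'\<ge>N1. \<exists>r. (\<forall>b. r b \<in> k) \<and> S = (\<Sum>b<N'. cconst2 (r b) * G ^ b)"
    using poly_span_extend[OF assms(1)] by blast
  obtain N2 where N2: "\<forall>N'\<ge>N2. \<exists>r. (\<forall>b. r b \<in> k) \<and> T = (\<Sum>b<N'. cconst2 (r b) * G ^ b)"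
    using poly_span_extend[OF assms(2)] by blast
  define N where "N = max N1 N2"
  have "N \<ge> N1" "N \<ge> N2" by (auto simp: N_def)
  then obtain r s where rs: "\<forall>b. r b \<in> k" "S = (\<Sum>b<N. cconst2 (r b) * G ^ b)"
    "\<forall>b. s b \<in> k" "T = (\<Sum>b<N. cconst2 (s b) * G ^ b)" using N1 N2 by meson
  have "S + T = (\<Sum>b<N. cconst2 (r b + s b) * G ^ b)"
    unfolding rs(2,4) sum.distrib[symmetric]
    by (intro sum.cong refl bicoeff_eqI) (simp add: distrib_right)
  also have "\<dots> \<in> poly_span G" using rs by (intro poly_spanI add_k) auto
  finally show ?thesis .
qed

lemma poly_span_0: "0 \<in> poly_span G"
  using poly_spanI[of 0] by simp

lemma poly_span_sum: "(\<And>i. i \<in> A \<Longrightarrow> f i \<in> poly_span G) \<Longrightarrow> sum f A \<in> poly_span G"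
  by (induction A rule: infinite_finite_induct) (auto simp: poly_span_0 poly_span_add)

lemma poly_span_monomial: assumes "x \<in> k" shows "cconst2 x * G ^ b \<in> poly_span G"
proof -
  have "(\<Sum>i<Suc b. cconst2 (if i = b then x else 0) * G ^ i) = (\<Sum>i<Suc b. if i = b then cconst2 x * G ^ b else 0)"
    by (intro sum.cong refl) auto
  then have "cconst2 x * G ^ b = (\<Sum>i<Suc b. cconst2 (if i = b then x else 0) * G ^ i)"
    by (simp add: sum.delta)
  then show ?thesis using poly_spanI[of "Suc b" "\<lambda>i. if i = b then x else 0" G] assms zero_k by simp
qed

lemma poly_span_of_nat: "T \<in> poly_span G \<Longrightarrow> of_nat n * T \<in> poly_span G"
  by (induction n) (auto simp: poly_span_0 poly_span_add distrib_right)

lemma poly_span_mult: assumes "S \<in> poly_span G" "T \<in> poly_span G" shows "S * T \<in> poly_span G"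
proof -
  obtain N r where r: "\<forall>b. r b \<in> k" "S = (\<Sum>b<N. cconst2 (r b) * G ^ b)"
    using assms(1) unfolding poly_span_def by blast
  obtain N' s where s: "\<forall>b. s b \<in> k" "T = (\<Sum>b<N'. cconst2 (s b) * G ^ b)"
    using assms(2) unfolding poly_span_def by blast
  have "S * T = (\<Sum>b<N. \<Sum>b'<N'. cconst2 (r b * s b') * G ^ (b + b'))"
    unfolding r s sum_product by (intro sum.cong refl) (simp add: power_add mult.commute)
  also have "\<dots> \<in> poly_span G" using r s by (intro poly_span_sum poly_span_monomial mult_k) auto
  finally show ?thesis .
qed

lemma poly_span_mult_power:
  assumes "S \<in> poly_span G" "T \<in> poly_span G" shows "S * T ^ n \<in> poly_span G"
proof (induction n)
  case (Suc n)
  have "S * T ^ Suc n = (S * T ^ n) * T" by (simp add: mult.assoc mult.commute)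
  then show ?case using poly_span_mult[OF Suc assms(2)] by (simp only:)
qed (use assms in simp)

definition alg_indep :: "'w poly poly \<Rightarrow> 'w poly poly \<Rightarrow> bool"
  where "alg_indep G H \<longleftrightarrow> (\<forall>Q N. (\<forall>b c. Q b c \<in> k) \<longrightarrow>
    (\<Sum>b<N. \<Sum>c<N. cconst2 (Q b c) * (G ^ b * H ^ c)) = 0 \<longrightarrow> (\<forall>b<N. \<forall>c<N. Q b c = (0::'w)))"

lemma alg_indepD:
  assumes "alg_indep G H" "\<And>b c. Q b c \<in> k" "(\<Sum>b<N. \<Sum>c<N. cconst2 (Q b c) * (G ^ b * H ^ c)) = 0"
    "b < N" "c < N"
  shows "Q b c = 0"
  using assms unfolding alg_indep_def by blast

text \<open>Independence read as transcendence of \<open>H\<close> over the polynomials in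
  \<open>G\<close>. Padding with zeros makes the coefficients a square array.\<close>

lemma alg_indep_span:
  assumes ind: "alg_indep G H" and T: "\<And>l. l < L \<Longrightarrow> T l \<in> poly_span G"
    and z: "(\<Sum>l<L. T l * H ^ l) = 0" and l: "l < L"
  shows "T l = 0"
proof -
  have "\<exists>N. \<forall>N'\<ge>N. \<exists>r. (\<forall>b. r b \<in> k) \<and> T l = (\<Sum>b<N'. cconst2 (r b) * G ^ b)" if "l < L" for l
    using poly_span_extend[OF T[OF that]] .
  then obtain N where N: "\<And>l. l < L \<Longrightarrow> \<forall>N'\<ge>N l. \<exists>r. (\<forall>b. r b \<in> k) \<and> T l = (\<Sum>b<N'. cconst2 (r b) * G ^ b)"
    by metis
  define M where "M = L + (\<Sum>l<L. N l)"
  have "N l \<le> M" if "l < L" for l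
    using member_le_sum[of l "{..<L}" N] that by (simp add: M_def)
  then have ex: "\<exists>r. (\<forall>b. r b \<in> k) \<and> T l = (\<Sum>b<M. cconst2 (r b) * G ^ b)" if "l < L" for l
    using N[OF that] that by blast
  define r where "r l = (SOME r. (\<forall>b. r b \<in> k) \<and> T l = (\<Sum>b<M. cconst2 (r b) * G ^ b))" for l
  have rl: "(\<forall>b. r l b \<in> k) \<and> T l = (\<Sum>b<M. cconst2 (r l b) * G ^ b)" if "l < L" for l
    unfolding r_def by (rule someI_ex[OF ex[OF that]])
  have r: "r l b \<in> k" "T l = (\<Sum>b<M. cconst2 (r l b) * G ^ b)" if "l < L" for l b
    using rl[OF that] by blast+
  define Q where "Q b c = (if c < L then r c b else 0)" for b c
  have Qk: "Q b c \<in> k" for b c using r(1) zero_k by (simp add: Q_def)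
  have "(\<Sum>b<M. \<Sum>c<M. cconst2 (Q b c) * (G ^ b * H ^ c)) = (\<Sum>c<M. \<Sum>b<M. cconst2 (Q b c) * (G ^ b * H ^ c))"
    by (rule sum.swap)
  also have "\<dots> = (\<Sum>c<L. \<Sum>b<M. cconst2 (Q b c) * (G ^ b * H ^ c))"
    by (rule sum.mono_neutral_right) (auto simp: M_def Q_def)
  also have "\<dots> = (\<Sum>c<L. T c * H ^ c)"
  proof (intro sum.cong refl)
    fix c assume "c \<in> {..<L}"
    then show "(\<Sum>b<M. cconst2 (Q b c) * (G ^ b * H ^ c)) = T c * H ^ c"
      using r(2)[of c] by (simp add: Q_def sum_distrib_right mult.assoc)
  qed
  finally have "(\<Sum>b<M. \<Sum>c<M. cconst2 (Q b c) * (G ^ b * H ^ c)) = 0" using z by simp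
  then have "Q b l = 0" if "b < M" for b
    using alg_indepD[OF ind, of Q M b l] Qk that l by (simp add: M_def)
  then have "r l b = 0" if "b < M" for b using that l by (simp add: Q_def)
  then show ?thesis using r(2)[OF l] by simp
qed

lemma alg_indep_span_coeff:
  assumes ind: "alg_indep G H" and r: "\<And>b. r b \<in> k"
    and z: "(\<Sum>b<N. cconst2 (r b) * G ^ b) = 0" and b: "b < N"
  shows "r b = 0"
proof -
  define Q where "Q b c = (if c = 0 then r b else 0)" for b and c :: nat
  have Qk: "Q b c \<in> k" for b c using r zero_k by (simp add: Q_def)
  have "(\<Sum>c<N. cconst2 (Q b c) * (G ^ b * H ^ c)) = cconst2 (r b) * G ^ b" for b
  proof -
    have "(\<Sum>c<N. cconst2 (Q b c) * (G ^ b * H ^ c)) = (\<Sum>c\<in>{0}. cconst2 (Q b c) * (G ^ b * H ^ c))"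
      by (rule sum.mono_neutral_right) (use b in \<open>auto simp: Q_def\<close>)
    then show ?thesis by (simp add: Q_def)
  qed
  then have "(\<Sum>b<N. \<Sum>c<N. cconst2 (Q b c) * (G ^ b * H ^ c)) = 0" using z by simp
  then have "Q b 0 = 0" using b by (intro alg_indepD[OF ind Qk]) auto
  then show ?thesis by (simp add: Q_def)
qed

text \<open>The terms of \<open>F\<close> in its second variable alone are moved into \<open>H\<close> by this shear. They may have
  large degree, as \<open>H\<close> may cancel them in \<open>P\<close>.\<close>

lemma alg_indep_shear:
  assumes ind: "alg_indep G H" and \<phi>: "\<phi> \<in> poly_span G"
  shows "alg_indep G (H + \<phi>)"
  unfolding alg_indep_def
proof (intro allI impI)
  fix Q :: "nat \<Rightarrow> nat \<Rightarrow> 'w" and N b c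
  assume Q: "\<forall>b c. Q b c \<in> k" and z: "(\<Sum>b<N. \<Sum>c<N. cconst2 (Q b c) * (G ^ b * (H + \<phi>) ^ c)) = 0"
    and b: "b < N" and c: "c < N"
  define A where "A c = (\<Sum>b<N. cconst2 (Q b c) * G ^ b)" for c
  have As: "A c \<in> poly_span G" for c unfolding A_def using Q by (intro poly_spanI) auto
  have zA: "(\<Sum>c<N. A c * (H + \<phi>) ^ c) = 0"
  proof -
    have "(\<Sum>c<N. A c * (H + \<phi>) ^ c) = (\<Sum>c<N. \<Sum>b<N. cconst2 (Q b c) * (G ^ b * (H + \<phi>) ^ c))"
      by (simp add: A_def sum_distrib_right mult.assoc)
    also have "\<dots> = (\<Sum>b<N. \<Sum>c<N. cconst2 (Q b c) * (G ^ b * (H + \<phi>) ^ c))" by (rule sum.swap)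
    finally show ?thesis using z by simp
  qed
  have A0: "A c = 0" if "c < N" for c
  proof (rule ccontr)
    assume "A c \<noteq> 0"
    define c0 where "c0 = Max {c. c < N \<and> A c \<noteq> 0}"
    have "c0 \<in> {c. c < N \<and> A c \<noteq> 0}" unfolding c0_def
      by (rule Max_in) (use that \<open>A c \<noteq> 0\<close> in auto)
    then have c0: "c0 < N" "A c0 \<noteq> 0" by auto
    have above: "A c = 0" if "c < N" "c0 < c" for c
    proof (rule ccontr)
      assume "A c \<noteq> 0"
      then have "c \<le> c0" unfolding c0_def using that by (intro Max_ge) auto
      then show False using that by simp
    qed
    \<comment> \<open>The coefficient of \<open>H ^ l\<close> after binomial expansion. At the top
      power \<open>c0\<close> it is \<open>A c0\<close> itself, because the substitution is
      triangular with unit diagonal.\<close>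
    define T where "T l = (\<Sum>c\<in>{l..c0}. of_nat (c choose l) * (A c * \<phi> ^ (c - l)))" for l
    have Ts: "T l \<in> poly_span G" for l
      unfolding T_def by (intro poly_span_sum poly_span_of_nat poly_span_mult_power As \<phi>)
    have "(\<Sum>c<N. A c * (H + \<phi>) ^ c) = (\<Sum>c\<le>c0. A c * (H + \<phi>) ^ c)"
      by (rule sum.mono_neutral_right) (use c0 above in auto)
    also have "\<dots> = (\<Sum>c\<le>c0. \<Sum>l\<le>c0. if l \<le> c then of_nat (c choose l) * (A c * \<phi> ^ (c - l)) * H ^ l else 0)"
    proof (intro sum.cong refl)
      fix c assume c: "c \<in> {..c0}"
      have "A c * (H + \<phi>) ^ c = (\<Sum>l\<le>c. of_nat (c choose l) * (A c * \<phi> ^ (c - l)) * H ^ l)"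
        unfolding binomial_ring sum_distrib_left by (intro sum.cong refl) (simp add: algebra_simps)
      also have "\<dots> = (\<Sum>l\<le>c0. if l \<le> c then of_nat (c choose l) * (A c * \<phi> ^ (c - l)) * H ^ l else 0)"
        by (rule sum.mono_neutral_cong_left) (use c in auto)
      finally show "A c * (H + \<phi>) ^ c = \<dots>" .
    qed
    also have "\<dots> = (\<Sum>l\<le>c0. \<Sum>c\<le>c0. if l \<le> c then of_nat (c choose l) * (A c * \<phi> ^ (c - l)) * H ^ l else 0)"
      by (rule sum.swap)
    also have "\<dots> = (\<Sum>l\<le>c0. T l * H ^ l)"
      unfolding T_def sum_distrib_right by (intro sum.cong refl sum.mono_neutral_cong_right) auto
    finally have "(\<Sum>l<Suc c0. T l * H ^ l) = 0" using zA by (simp add: lessThan_Suc_atMost)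
    then have "T c0 = 0" using alg_indep_span[OF ind, of "Suc c0" T c0] Ts by blast
    then show False using c0(2) by (simp add: T_def)
  qed
  show "Q b c = 0"
    using alg_indep_span_coeff[OF ind, of "\<lambda>b. Q b c" N b] A0[OF c] Q b by (simp add: A_def)
qed

text \<open>A constant \<open>G\<close> would satisfy a relation of degree 1, so a nonconstant
  monomial occurs; the support is finite and has a greatest element.\<close>

lemma alg_indep_leading_monomial:
  assumes ind: "alg_indep G H" and G: "G \<in> kbipoly"
  shows "\<exists>a b. lead_bound G a b \<and> bicoeff G a b \<noteq> 0 \<and> a + b > 0"
proof -
  have nc: "\<exists>a b. bicoeff G a b \<noteq> 0 \<and> a + b > 0"
  proof (rule ccontr)
    assume H: "\<not> ?thesis"
    \<comment> \<open>The relation \<open>G\<close> minus its constant term, with \<open>e\<close>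
      in the role of the coefficient 1.\<close>
    define r where "r b = (if b = 0 then - bicoeff G 0 0 else e)" for b :: nat
    have rk: "r b \<in> k" for b using G by (simp add: r_def kbipoly_def minus_k e_in)
    have "(\<Sum>b<2. cconst2 (r b) * G ^ b) = 0"
    proof (rule bicoeff_eqI)
      fix a b
      have "bicoeff G a b = (if a = 0 \<and> b = 0 then bicoeff G 0 0 else 0)" using H by auto
      moreover have "e * bicoeff G a b = bicoeff G a b" using G by (intro e_mult) (simp add: kbipoly_def)
      ultimately show "bicoeff (\<Sum>b<2. cconst2 (r b) * G ^ b) a b = bicoeff 0 a b"
        by (simp add: numeral_2_eq_2 r_def bicoeff_const)
    qed
    then have "r 1 = 0" using alg_indep_span_coeff[OF ind, of r 2 1] rk by simp
    then show False using e_nz by (simp add: r_def)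
  qed
  define D where "D = degree G"
  have Da: "a \<le> D" if "bicoeff G a b \<noteq> 0" for a b
    using that unfolding D_def bicoeff_def by (intro le_degree) auto
  define E where "E = Max (degree ` poly.coeff G ` {..D})"
  have Db: "b \<le> E" if "bicoeff G a b \<noteq> 0" for a b
  proof -
    have "b \<le> degree (poly.coeff G a)" using that unfolding bicoeff_def by (intro le_degree)
    also have "\<dots> \<le> E" unfolding E_def using Da[OF that] by (intro Max_ge) auto
    finally show ?thesis .
  qed
  \<comment> \<open>The graded lexicographic order as a number: \<open>D\<close> bounds the first
    exponent, so the weight \<open>D + 1\<close> lets the total degree decide first.\<close>
  define m where "m = (\<lambda>(a, b). (a + b) * (D + 1) + a)"
  define P where "P = (\<lambda>(a, b). bicoeff G a b \<noteq> 0)"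
  obtain a1 b1 where ab1: "bicoeff G a1 b1 \<noteq> 0" "a1 + b1 > 0" using nc by blast
  have "\<forall>x. P x \<longrightarrow> m x < Suc ((D + E) * (D + 1) + D)"
  proof (intro allI impI)
    fix x assume "P x"
    then obtain a b where x: "x = (a, b)" "bicoeff G a b \<noteq> 0" by (auto simp: P_def)
    have "a + b \<le> D + E" "a \<le> D" using Da[OF x(2)] Db[OF x(2)] by auto
    then have "(a + b) * (D + 1) + a \<le> (D + E) * (D + 1) + D"
      using mult_le_mono1[of "a + b" "D + E" "D + 1"] by linarith
    then show "m x < Suc ((D + E) * (D + 1) + D)" by (simp add: m_def x)
  qed
  moreover have "P (a1, b1)" using ab1 by (simp add: P_def)
  ultimately obtain x where x: "P x" "\<And>y. P y \<Longrightarrow> m y \<le> m x"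
    using ex_has_greatest_nat[of P "(a1, b1)" m] by blast
  obtain a b where xab: "x = (a, b)" by (cases x)
  have ab: "bicoeff G a b \<noteq> 0" using x(1) by (simp add: P_def xab)
  have mx: "(a' + b') * (D + 1) + a' \<le> (a + b) * (D + 1) + a" if "bicoeff G a' b' \<noteq> 0" for a' b'
    using x(2)[of "(a', b')"] that by (simp add: P_def m_def xab)
  have le: "a' + b' \<le> a + b" if "bicoeff G a' b' \<noteq> 0" for a' b'
  proof (rule ccontr)
    assume "\<not> ?thesis"
    then have "(a + b + 1) * (D + 1) \<le> (a' + b') * (D + 1)" by (intro mult_le_mono1) simp
    then have "(a + b) * (D + 1) + (D + 1) \<le> (a' + b') * (D + 1)" by (simp add: algebra_simps)
    then show False using mx[OF that] Da[OF ab] by linarith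
  qed
  have "lead_bound G a b" unfolding lead_bound_def
  proof (intro allI impI)
    fix a' b' assume nz: "bicoeff G a' b' \<noteq> 0"
    show "a' + b' < a + b \<or> a' + b' = a + b \<and> a' \<le> a"
    proof (cases "a' + b' = a + b")
      case True then show ?thesis using mx[OF nz] by simp
    next
      case False then show ?thesis using le[OF nz] by simp
    qed
  qed
  moreover have "a + b > 0" using le[OF ab1(1)] ab1(2) by linarith
  ultimately show ?thesis using ab by blast
qed

text \<open>The highest power \<open>J\<close> of \<open>G\<close> that occurs contributes the
  monomial \<open>(J * a, J * b)\<close>, which neither lower powers nor the constant can reach,
  with a coefficient that is nonzero because \<open>k\<close> is a field. So no cancellation hides
  the degrees of \<open>G\<close> and F in the composition.\<close>

lemma composition_degree_bound:
  assumes lb: "lead_bound G a b" "bicoeff G a b \<noteq> 0" "a + b > 0" and G: "G \<in> kbipoly"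
    and c: "\<And>j. c j \<in> k" and j: "j \<le> n" "j > 0" "c j \<noteq> 0"
    and deg: "\<And>a' b'. bicoeff ((\<Sum>j\<le>n. cconst2 (c j) * G ^ j) + cconst2 x) a' b' \<noteq> 0 \<Longrightarrow> i + a' + b' \<le> d"
  shows "i + j * (a + b) \<le> d"
proof -
  define J where "J = Max {j. j \<le> n \<and> c j \<noteq> 0}"
  have "J \<in> {j. j \<le> n \<and> c j \<noteq> 0}" unfolding J_def by (rule Max_in) (use j in auto)
  then have J: "J \<le> n" "c J \<noteq> 0" by auto
  have Jmax: "l \<le> J" if "l \<le> n" "c l \<noteq> 0" for l unfolding J_def using that by (intro Max_ge) auto
  have "j \<le> J" using Jmax j by blast
  have gk: "bicoeff G a b \<in> k" using G by (simp add: kbipoly_def)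
  have nz: "J * a \<noteq> 0 \<or> J * b \<noteq> 0" using \<open>j \<le> J\<close> j(2) lb(3) by auto
  have "bicoeff ((\<Sum>j\<le>n. cconst2 (c j) * G ^ j) + cconst2 x) (J * a) (J * b)
      = (\<Sum>l\<le>n. c l * bicoeff (G ^ l) (J * a) (J * b))"
    using nz by (auto simp: bicoeff_sum bicoeff_const)
  also have "\<dots> = (\<Sum>l\<in>{J}. c l * bicoeff (G ^ l) (J * a) (J * b))"
  proof (rule sum.mono_neutral_right)
    show "\<forall>l\<in>{..n} - {J}. c l * bicoeff (G ^ l) (J * a) (J * b) = 0"
    proof
      fix l assume l: "l \<in> {..n} - {J}"
      show "c l * bicoeff (G ^ l) (J * a) (J * b) = 0"
      proof (rule ccontr)
        assume ne: "c l * bicoeff (G ^ l) (J * a) (J * b) \<noteq> 0"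
        then have "c l \<noteq> 0" by auto
        then have "l < J" using Jmax[of l] l by simp
        then have "l * (a + b) < J * (a + b)" using lb(3) by simp
        moreover have "bicoeff (G ^ l) (J * a) (J * b) \<noteq> 0" using ne by auto
        then have "J * a + J * b \<le> l * a + l * b"
          using lead_bound_power[OF lb(1), of l] unfolding lead_bound_def by fastforce
        ultimately show False by (simp add: distrib_left)
      qed
    qed
  qed (use J in auto)
  also have "\<dots> = c J * bicoeff G a b ^ J" using lead_bound_power[OF lb(1), of J] by simp
  also have "\<dots> \<noteq> 0"
  proof -
    have "J > 0" using \<open>j \<le> J\<close> j(2) by simp
    then show ?thesis
      using mult_zero_k[OF c power_k[OF gk, of J], of J] power_nz_k[OF gk lb(2), of J] J(2) by blast
  qed
  finally have "i + J * a + J * b \<le> d" by (rule deg)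
  moreover have "j * (a + b) \<le> J * (a + b)" using \<open>j \<le> J\<close> by simp
  ultimately show ?thesis by (simp add: distrib_left)
qed

text \<open>\<open>deg\<close> and \<open>deg0\<close> state the total degree of P through its
  coefficients at x^i. For \<open>i > 0\<close> the composition with \<open>G\<close> controls the
  mixed exponents, and a mixed term also bounds \<open>G\<close> itself. At \<open>i = 0\<close>
  only the sum of \<open>H\<close> and the part of F in its second variable is bounded, which is why
  these two are kept together as \<open>Ht\<close>.\<close>

theorem expander_bound:
  assumes c: "\<And>i j. c i j \<in> k" and supp: "\<And>i j. c i j \<noteq> 0 \<Longrightarrow> i \<le> n \<and> j \<le> n \<and> i + j < chr"
    and mixed: "i0 > 0" "j0 > 0" "c i0 j0 \<noteq> 0"
    and G: "G \<in> kbipoly" and H: "H \<in> kbipoly" and ind: "alg_indep G H"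
    and deg: "\<And>i a b. i > 0 \<Longrightarrow> bicoeff ((\<Sum>j\<le>n. cconst2 (c i j) * G ^ j) + cconst2 (Jc i)) a b \<noteq> 0 \<Longrightarrow> i + a + b \<le> d"
    and deg0: "\<And>a b. bicoeff ((\<Sum>j\<le>n. cconst2 (c 0 j) * G ^ j) + H + cconst2 (Jc 0)) a b \<noteq> 0 \<Longrightarrow> a + b \<le> d"
    and X: "X \<subseteq> k" and Y: "Y \<subseteq> k" and Z: "Z \<subseteq> k" and S: "S \<subseteq> k"
    and J: "\<And>x. x \<in> X \<Longrightarrow> J x \<in> k"
    and img: "\<And>x y z. x \<in> X \<Longrightarrow> y \<in> Y \<Longrightarrow> z \<in> Z \<Longrightarrow>
      (\<Sum>i\<le>n. \<Sum>j\<le>n. c i j * (x ^ i * bieval G y z ^ j)) + bieval H y z + J x \<in> S"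
    and M: "M = fibre_degree d"
  shows "real (card X) * (real (card Y) * real (card Z) - 8 * real d * real M * real q) * (real q - real (card S))
    \<le> 2 * real d * (real M)\<^sup>2 * (real q ^ 3 * sqrt (real q))"
proof -
  obtain a b where lb: "lead_bound G a b" "bicoeff G a b \<noteq> 0" "a + b > 0"
    using alg_indep_leading_monomial[OF ind G] by blast
  have bnd: "i + j * (a + b) \<le> d" if "i > 0" "j > 0" "c i j \<noteq> 0" for i j
    by (rule composition_degree_bound[OF lb G, of "c i" j n "Jc i" i d]) (use that supp c deg in auto)
  have cd: "i \<le> d" "j \<le> d" if "i > 0" "j > 0" "c i j \<noteq> 0" for i j
  proof -
    have "j * 1 \<le> j * (a + b)" using lb(3) by (intro mult_le_mono2) linarith
    then show "i \<le> d" "j \<le> d" using bnd[OF that] by linarith+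
  qed
  have "a + b \<le> j0 * (a + b)" using mult_le_mono1[of 1 j0 "a + b"] mixed(2) by simp
  then have abd: "a + b \<le> d" using bnd[OF mixed] by linarith
  have tG: "tdeg_le G d" unfolding tdeg_le_def
  proof (intro allI impI)
    fix a' b' assume "bicoeff G a' b' \<noteq> 0"
    then have "a' + b' \<le> a + b" using lb(1) unfolding lead_bound_def by fastforce
    then show "a' + b' \<le> d" using abd by simp
  qed
  define \<phi> where "\<phi> = (\<Sum>j=1..n. cconst2 (c 0 j) * G ^ j)"
  have \<phi>s: "\<phi> \<in> poly_span G" unfolding \<phi>_def by (intro poly_span_sum poly_span_monomial c)
  define Ht where "Ht = H + \<phi>"
  have split0: "{..n} = insert 0 {1..n}" by auto
  have tH: "tdeg_le Ht d" unfolding tdeg_le_def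
  proof (intro allI impI)
    fix a' b' assume nz: "bicoeff Ht a' b' \<noteq> 0"
    show "a' + b' \<le> d"
    proof (cases "a' = 0 \<and> b' = 0")
      case False
      have "(\<Sum>j\<le>n. cconst2 (c 0 j) * G ^ j) + H + cconst2 (Jc 0) = Ht + cconst2 (c 0 0) + cconst2 (Jc 0)"
        unfolding split0 Ht_def \<phi>_def by (simp add: algebra_simps)
      then have eq: "bicoeff ((\<Sum>j\<le>n. cconst2 (c 0 j) * G ^ j) + H + cconst2 (Jc 0)) a' b' = bicoeff Ht a' b'"
        using False by (simp only: bicoeff_simps bicoeff_const) auto
      show ?thesis using deg0[of a' b'] nz unfolding eq by blast
    qed simp
  qed
  have Hk: "Ht \<in> kbipoly" unfolding Ht_def \<phi>_def
    by (intro kbipoly_add H kbipoly_sum kbipoly_mult' kbipoly_const c)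
  have indt: "alg_indep G Ht" unfolding Ht_def by (rule alg_indep_shear[OF ind \<phi>s])
  define B where "B = (\<lambda>(y, z). (bieval G y z, bieval Ht y z)) ` (Y \<times> Z)"
  have cB: "card Y * card Z \<le> 8 * d * M * q + M\<^sup>2 * card B"
    unfolding B_def by (rule card_image_pair_ge[OF tG G tH Hk M _ Y Z]) (use alg_indepD[OF indt] in blast)
  \<comment> \<open>The incidence bound asks for an exponent bound below \<open>chr\<close>, the
    final constant for one that is at most \<open>d\<close>; the mixed terms satisfy both.\<close>
  define D where "D = min d (chr - 1)"
  have D: "D < chr" "D \<le> d" using chr_props(1) by (auto simp: D_def)
  have cD: "i \<in> {1..D} \<and> j \<in> {1..D}" if "i > 0" "j > 0" "c i j \<noteq> 0" for i j
    using cd[OF that] supp[OF that(3)] that by (auto simp: D_def)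
  \<comment> \<open>Collects the terms of F in its first variable alone and its constant
    term.\<close>
  define J' where "J' x = J x + c 0 0 + (\<Sum>i=1..n. c i 0 * x ^ i)" for x
  have bip: "bipoly D c x u = (\<Sum>i=1..n. \<Sum>j=1..n. c i j * (x ^ i * u ^ j))" for x u
  proof -
    have "bipoly D c x u = (\<Sum>(i, j)\<in>{1..D} \<times> {1..D}. c i j * (x ^ i * u ^ j))"
      unfolding bipoly_def sum_distrib_right sum.cartesian_product[symmetric]
      by (intro sum.cong refl) (simp add: algebra_simps)
    also have "\<dots> = (\<Sum>(i, j)\<in>{1..n} \<times> {1..n}. c i j * (x ^ i * u ^ j))"
    proof (rule sum.mono_neutral_cong)
      show "(case p of (i, j) \<Rightarrow> c i j * (x ^ i * u ^ j)) = 0" if p: "p \<in> {1..n} \<times> {1..n} - {1..D} \<times> {1..D}" for p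
      proof -
        obtain i j where ij: "p = (i, j)" by (cases p)
        then have "i > 0" "j > 0" "\<not> (i \<in> {1..D} \<and> j \<in> {1..D})" using p by auto
        then have "c i j = 0" using cD[of i j] by blast
        then show ?thesis by (simp add: ij)
      qed
      show "(case p of (i, j) \<Rightarrow> c i j * (x ^ i * u ^ j)) = 0" if p: "p \<in> {1..D} \<times> {1..D} - {1..n} \<times> {1..n}" for p
      proof -
        obtain i j where ij: "p = (i, j)" by (cases p)
        then have "\<not> (i \<le> n \<and> j \<le> n)" using p by auto
        then have "c i j = 0" using supp[of i j] by blast
        then show ?thesis by (simp add: ij)
      qed
    qed auto
    finally show ?thesis by (simp add: sum.cartesian_product)
  qed
  have val: "(\<Sum>i\<le>n. \<Sum>j\<le>n. c i j * (x ^ i * bieval G y z ^ j)) + bieval H y z + J x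
      = bipoly D c x (bieval G y z) + bieval Ht y z + J' x" for x y z
  proof -
    have "(\<Sum>i\<le>n. \<Sum>j\<le>n. c i j * (x ^ i * u ^ j)) = c 0 0 + (\<Sum>j=1..n. c 0 j * u ^ j)
      + ((\<Sum>i=1..n. c i 0 * x ^ i) + (\<Sum>i=1..n. \<Sum>j=1..n. c i j * (x ^ i * u ^ j)))" for u
      unfolding split0 by (simp add: sum.distrib)
    moreover have "bieval Ht y z = bieval H y z + (\<Sum>j=1..n. c 0 j * bieval G y z ^ j)"
      by (simp add: Ht_def \<phi>_def bieval_sum)
    ultimately show ?thesis by (simp add: J'_def bip)
  qed
  have inc: "real (card X) * real (card B) * real (card (k - S)) \<le> 2 * real D * (real q ^ 3 * sqrt (real q))"
  proof (rule bipoly_incidence_bound[where J = J' and c = c])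
    show "i0 \<in> {1..D}" "j0 \<in> {1..D}" using cD[OF mixed] by auto
    show "c i0 j0 \<noteq> 0" by fact
    show "B \<subseteq> k \<times> k" unfolding B_def using bieval_in_k G Hk by auto
    show "J' x \<in> k" if "x \<in> X" for x unfolding J'_def using J[OF that] c by (intro add_k sum_k mult_k') auto
    fix x u v assume x: "x \<in> X" and uv: "(u, v) \<in> B"
    obtain y z where yz: "y \<in> Y" "z \<in> Z" "u = bieval G y z" "v = bieval Ht y z" using uv by (auto simp: B_def)
    then show "bipoly D c x u + v + J' x \<notin> k - S" using img[OF x yz(1,2)] by (simp only: val) simp
  qed (use c D X in auto)
  have W: "real (card (k - S)) = real q - real (card S)"
  proof -
    have "card S \<le> q" unfolding q_def using S finite_k by (rule card_mono[rotated])
    then show ?thesis using S finite_k by (simp add: card_Diff_subset finite_subset q_def of_nat_diff)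
  qed
  have cB': "real (card Y) * real (card Z) - 8 * real d * real M * real q \<le> (real M)\<^sup>2 * real (card B)"
  proof -
    have "real (card Y * card Z) \<le> real (8 * d * M * q + M\<^sup>2 * card B)" using cB by (simp only: of_nat_le_iff)
    then show ?thesis by simp
  qed
  have Wnn: "real q - real (card S) \<ge> 0" unfolding W[symmetric] by simp
  have "real (card X) * (real (card Y) * real (card Z) - 8 * real d * real M * real q) * (real q - real (card S))
    \<le> real (card X) * ((real M)\<^sup>2 * real (card B)) * (real q - real (card S))"
    by (intro mult_right_mono mult_left_mono cB' Wnn) auto
  also have "\<dots> = (real M)\<^sup>2 * (real (card X) * real (card B) * real (card (k - S)))" by (simp add: W algebra_simps)
  also have "\<dots> \<le> (real M)\<^sup>2 * (2 * real D * (real q ^ 3 * sqrt (real q)))" using inc by (intro mult_left_mono) auto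
  also have "\<dots> \<le> (real M)\<^sup>2 * (2 * real d * (real q ^ 3 * sqrt (real q)))"
    using D(2) by (intro mult_left_mono mult_right_mono) auto
  finally show ?thesis by (simp add: algebra_simps)
qed

end

section \<open>Finite fields as ideals of a product of rings\<close>

text \<open>The product of all commutative rings with elements of type \<open>'a\<close>. The factor \<open>int\<close> only ensures
  \<open>0 \<noteq> 1\<close>, which would fail for a type with a single element.\<close>

lemma cring_nonempty: "\<exists>p. p \<in> {p :: ('a ring \<Rightarrow> 'a) \<times> int. \<forall>S. if cring S then fst p S \<in> carrier S else fst p S = undefined}"
  by (rule exI[of _ "(\<lambda>S. if cring S then \<zero>\<^bsub>S\<^esub> else undefined, 0)"])
    (auto simp: cring.cring_simprules)

typedef 'a ring_product = "{p :: ('a ring \<Rightarrow> 'a) \<times> int. \<forall>S. if cring S then fst p S \<in> carrier S else fst p S = undefined}"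
  by (rule cring_nonempty)

setup_lifting type_definition_ring_product

instantiation ring_product :: (type) comm_ring_1
begin

lift_definition zero_ring_product :: "'a ring_product"
  is "(\<lambda>S. if cring S then \<zero>\<^bsub>S\<^esub> else undefined, 0)"
  by (simp add: cring.cring_simprules)

lift_definition one_ring_product :: "'a ring_product"
  is "(\<lambda>S. if cring S then \<one>\<^bsub>S\<^esub> else undefined, 1)"
  by (simp add: cring.cring_simprules)

lift_definition plus_ring_product :: "'a ring_product \<Rightarrow> 'a ring_product \<Rightarrow> 'a ring_product"
  is "\<lambda>p q. (\<lambda>S. if cring S then fst p S \<oplus>\<^bsub>S\<^esub> fst q S else undefined, snd p + snd q)"
  by (simp add: cring.cring_simprules)

lift_definition times_ring_product :: "'a ring_product \<Rightarrow> 'a ring_product \<Rightarrow> 'a ring_product"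
  is "\<lambda>p q. (\<lambda>S. if cring S then fst p S \<otimes>\<^bsub>S\<^esub> fst q S else undefined, snd p * snd q)"
  by (simp add: cring.cring_simprules)

lift_definition uminus_ring_product :: "'a ring_product \<Rightarrow> 'a ring_product"
  is "\<lambda>p. (\<lambda>S. if cring S then \<ominus>\<^bsub>S\<^esub> fst p S else undefined, - snd p)"
  by (simp add: cring.cring_simprules)

definition minus_ring_product :: "'a ring_product \<Rightarrow> 'a ring_product \<Rightarrow> 'a ring_product"
  where "minus_ring_product p q = p + - q"

instance
proof
  fix a b c :: "'a ring_product"
  show "a * b * c = a * (b * c)"
    by transfer (auto simp: fun_eq_iff cring.cring_simprules(11) cring.cring_simprules(5))
  show "a * b = b * a"
    by transfer (auto simp: fun_eq_iff cring.cring_simprules(14))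
  show "1 * a = a"
    by transfer (auto simp: fun_eq_iff prod_eq_iff cring.cring_simprules(12))
  show "(a + b) * c = a * c + b * c"
    by transfer (auto simp: fun_eq_iff cring.cring_simprules(13) distrib_right)
  show "a + b + c = a + (b + c)"
    by transfer (auto simp: fun_eq_iff cring.cring_simprules(7) cring.cring_simprules(1))
  show "a + b = b + a"
    by transfer (auto simp: fun_eq_iff cring.cring_simprules(10))
  show "0 + a = a"
    by transfer (auto simp: fun_eq_iff prod_eq_iff cring.cring_simprules(8))
  show "- a + a = 0"
    by transfer (auto simp: fun_eq_iff cring.cring_simprules(9))
  show "a - b = a + - b" by (rule minus_ring_product_def)
  show "(0 :: 'a ring_product) \<noteq> 1" by transfer simp
qed

end

lift_definition ring_embed :: "'a ring \<Rightarrow> 'a \<Rightarrow> 'a ring_product"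
  is "\<lambda>R x. (\<lambda>S. if cring S then if S = R \<and> x \<in> carrier R then x else \<zero>\<^bsub>S\<^esub> else undefined, 0)"
  by (simp add: cring.cring_simprules)

lift_definition ring_component :: "'a ring \<Rightarrow> 'a ring_product \<Rightarrow> 'a" is "\<lambda>R p. fst p R" .

lemma ring_component_closed: "cring R \<Longrightarrow> ring_component R w \<in> carrier R"
  by transfer metis

lemma ring_embed_add:
  assumes "cring R" "x \<in> carrier R" "y \<in> carrier R"
  shows "ring_embed R (x \<oplus>\<^bsub>R\<^esub> y) = ring_embed R x + ring_embed R y"
  using assms by transfer (auto simp: fun_eq_iff cring.cring_simprules)

text \<open>An embedded element is 0 outside the factor \<open>R\<close>, so only that component of
  \<open>w\<close> matters; hence the image of the carrier is an ideal.\<close>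

lemma ring_embed_mult:
  assumes "cring R" "x \<in> carrier R"
  shows "w * ring_embed R x = ring_embed R (ring_component R w \<otimes>\<^bsub>R\<^esub> x)"
  using assms
  by transfer (auto simp: fun_eq_iff cring.cring_simprules(27) cring.cring_simprules(5))

lemma ring_component_embed: "cring R \<Longrightarrow> x \<in> carrier R \<Longrightarrow> ring_component R (ring_embed R x) = x"
  by transfer simp

text \<open>The unit is left out because \<open>ring_embed R\<close> takes it to \<open>e\<close>,
  in general different from 1.\<close>

definition nonunital_hom :: "('c, 'm) ring_scheme \<Rightarrow> ('c \<Rightarrow> 'b::comm_ring_1) \<Rightarrow> bool"
  where "nonunital_hom A \<phi> \<longleftrightarrow> cring A \<and>
    (\<forall>x\<in>carrier A. \<forall>y\<in>carrier A. \<phi> (x \<oplus>\<^bsub>A\<^esub> y) = \<phi> x + \<phi> y \<and> \<phi> (x \<otimes>\<^bsub>A\<^esub> y) = \<phi> x * \<phi> y)"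

lemma nonunital_hom_zero:
  assumes "nonunital_hom A \<phi>" shows "\<phi> \<zero>\<^bsub>A\<^esub> = 0"
proof -
  interpret cring A using assms by (simp add: nonunital_hom_def)
  have "\<phi> (\<zero>\<^bsub>A\<^esub> \<oplus>\<^bsub>A\<^esub> \<zero>\<^bsub>A\<^esub>) = \<phi> \<zero>\<^bsub>A\<^esub> + \<phi> \<zero>\<^bsub>A\<^esub>" using assms unfolding nonunital_hom_def by blast
  then show ?thesis by simp
qed

lemma nonunital_hom_finsum:
  assumes "nonunital_hom A \<phi>" "finite I" "\<And>i. i \<in> I \<Longrightarrow> f i \<in> carrier A"
  shows "\<phi> (finsum A f I) = (\<Sum>i\<in>I. \<phi> (f i))"
proof -
  interpret cring A using assms by (simp add: nonunital_hom_def)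
  show ?thesis using assms(2,3)
  proof (induction I rule: finite_induct)
    case empty
    then show ?case using nonunital_hom_zero[OF assms(1)] by simp
  next
    case (insert i I)
    have "f \<in> I \<rightarrow> carrier A" "f i \<in> carrier A" using insert.prems by auto
    moreover have "finsum A f I \<in> carrier A" using calculation(1) by (rule finsum_closed)
    ultimately show ?case using insert assms(1) by (simp add: finsum_insert nonunital_hom_def)
  qed
qed

lemma nonunital_hom_mult_pow:
  assumes "nonunital_hom A \<phi>" "a \<in> carrier A" "s \<in> carrier A"
  shows "\<phi> (a \<otimes>\<^bsub>A\<^esub> s [^]\<^bsub>A\<^esub> (i::nat)) = \<phi> a * \<phi> s ^ i"
proof -
  interpret cring A using assms by (simp add: nonunital_hom_def)
  show ?thesis
  proof (induction i)
    case 0 then show ?case using assms by simp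
  next
    case (Suc i)
    have "a \<otimes>\<^bsub>A\<^esub> s [^]\<^bsub>A\<^esub> Suc i = (a \<otimes>\<^bsub>A\<^esub> s [^]\<^bsub>A\<^esub> i) \<otimes>\<^bsub>A\<^esub> s" using assms by (simp add: m_assoc)
    moreover have "a \<otimes>\<^bsub>A\<^esub> s [^]\<^bsub>A\<^esub> i \<in> carrier A" using assms by simp
    ultimately have "\<phi> (a \<otimes>\<^bsub>A\<^esub> s [^]\<^bsub>A\<^esub> Suc i) = \<phi> (a \<otimes>\<^bsub>A\<^esub> s [^]\<^bsub>A\<^esub> i) * \<phi> s"
      using assms unfolding nonunital_hom_def by metis
    then show ?case using Suc by (simp add: mult.assoc mult.commute)
  qed
qed

section \<open>Transfer of polynomials over a ring record to polynomials over a type\<close>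

definition poly_map :: "('c, 'm) ring_scheme \<Rightarrow> ('c \<Rightarrow> 'b::comm_ring_1) \<Rightarrow> (nat \<Rightarrow> 'c) \<Rightarrow> 'b poly"
  where "poly_map A \<phi> p = Abs_poly (\<lambda>i. \<phi> (coeff (UP A) p i))"

lemma coeff_poly_map:
  assumes "nonunital_hom A \<phi>" "p \<in> carrier (UP A)"
  shows "poly.coeff (poly_map A \<phi> p) i = \<phi> (coeff (UP A) p i)"
proof -
  interpret UP_cring A "UP A" using assms by (simp add: nonunital_hom_def UP_cring_def)
  have "poly.coeff (Abs_poly (\<lambda>i. \<phi> (coeff (UP A) p i))) = (\<lambda>i. \<phi> (coeff (UP A) p i))"
    by (rule coeff_Abs_poly[of "deg A p"])
      (use assms(2) nonunital_hom_zero[OF assms(1)] deg_aboveD in auto)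
  then show ?thesis by (simp add: poly_map_def)
qed

lemma nonunital_hom_poly_map:
  assumes "nonunital_hom A \<phi>" shows "nonunital_hom (UP A) (poly_map A \<phi>)"
proof -
  interpret UP_cring A "UP A" using assms by (simp add: nonunital_hom_def UP_cring_def)
  show ?thesis unfolding nonunital_hom_def
  proof (intro conjI ballI)
    show "cring (UP A)" by (rule UP_cring)
    fix p r assume pr: "p \<in> carrier (UP A)" "r \<in> carrier (UP A)"
    have hom: "\<phi> (x \<oplus>\<^bsub>A\<^esub> y) = \<phi> x + \<phi> y" "\<phi> (x \<otimes>\<^bsub>A\<^esub> y) = \<phi> x * \<phi> y"
      if "x \<in> carrier A" "y \<in> carrier A" for x y using assms that unfolding nonunital_hom_def by auto
    note cp = coeff_poly_map[OF assms]
    show "poly_map A \<phi> (p \<oplus>\<^bsub>UP A\<^esub> r) = poly_map A \<phi> p + poly_map A \<phi> r"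
      using pr by (intro poly_eqI) (simp add: cp hom)
    show "poly_map A \<phi> (p \<otimes>\<^bsub>UP A\<^esub> r) = poly_map A \<phi> p * poly_map A \<phi> r"
    proof (rule poly_eqI)
      fix n
      have "poly.coeff (poly_map A \<phi> (p \<otimes>\<^bsub>UP A\<^esub> r)) n
          = \<phi> (finsum A (\<lambda>i. coeff (UP A) p i \<otimes>\<^bsub>A\<^esub> coeff (UP A) r (n - i)) {..n})"
        using pr by (simp add: cp)
      also have "\<dots> = (\<Sum>i\<le>n. \<phi> (coeff (UP A) p i \<otimes>\<^bsub>A\<^esub> coeff (UP A) r (n - i)))"
        using pr by (intro nonunital_hom_finsum[OF assms]) auto
      also have "\<dots> = poly.coeff (poly_map A \<phi> p * poly_map A \<phi> r) n"
        using pr by (simp add: Polynomial.coeff_mult cp hom)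
      finally show "poly.coeff (poly_map A \<phi> (p \<otimes>\<^bsub>UP A\<^esub> r)) n = poly.coeff (poly_map A \<phi> p * poly_map A \<phi> r) n" .
    qed
  qed
qed

lemma poly_map_monom:
  assumes "nonunital_hom A \<phi>" "a \<in> carrier A"
  shows "poly_map A \<phi> (monom (UP A) a n) = Polynomial.monom (\<phi> a) n"
proof -
  interpret UP_cring A "UP A" using assms by (simp add: nonunital_hom_def UP_cring_def)
  show ?thesis
    by (rule poly_eqI) (use assms in \<open>simp add: coeff_poly_map[OF assms(1)] nonunital_hom_zero[OF assms(1)]\<close>)
qed

lemma poly_map_inj:
  assumes "nonunital_hom A \<phi>" "inj_on \<phi> (carrier A)" shows "inj_on (poly_map A \<phi>) (carrier (UP A))"
proof (rule inj_onI)
  interpret UP_cring A "UP A" using assms by (simp add: nonunital_hom_def UP_cring_def)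
  fix p r assume pr: "p \<in> carrier (UP A)" "r \<in> carrier (UP A)" "poly_map A \<phi> p = poly_map A \<phi> r"
  have "coeff (UP A) p i = coeff (UP A) r i" for i
  proof -
    have "\<phi> (coeff (UP A) p i) = \<phi> (coeff (UP A) r i)"
      using pr coeff_poly_map[OF assms(1)] by metis
    then show ?thesis using pr by (intro inj_onD[OF assms(2)]) auto
  qed
  then show "p = r" using pr by (intro up_eqI) auto
qed

lemma eval_closed:
  assumes "cring A" "cring S" "\<And>a. a \<in> carrier A \<Longrightarrow> h a \<in> carrier S" "s \<in> carrier S" "p \<in> carrier (UP A)"
  shows "eval A S h s p \<in> carrier S"
proof -
  interpret UP_cring A "UP A" using assms by (simp add: UP_cring_def)
  interpret S: cring S by fact
  show ?thesis unfolding eval_def using assms by (auto intro!: S.finsum_closed)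
qed

lemma nonunital_hom_eval:
  assumes A: "cring A" and \<Psi>: "nonunital_hom S \<Psi>" and h: "\<And>a. a \<in> carrier A \<Longrightarrow> h a \<in> carrier S"
    and h0: "\<Psi> (h \<zero>\<^bsub>A\<^esub>) = 0" and s: "s \<in> carrier S" and p: "p \<in> carrier (UP A)" and n: "deg A p \<le> n"
  shows "\<Psi> (eval A S h s p) = (\<Sum>i\<le>n. \<Psi> (h (coeff (UP A) p i)) * \<Psi> s ^ i)"
proof -
  interpret UP_cring A "UP A" using A by (simp add: UP_cring_def)
  interpret S: cring S using \<Psi> by (simp add: nonunital_hom_def)
  have "\<Psi> (eval A S h s p) = \<Psi> (finsum S (\<lambda>i. h (coeff (UP A) p i) \<otimes>\<^bsub>S\<^esub> s [^]\<^bsub>S\<^esub> i) {..deg A p})"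
    using p by (simp add: eval_def)
  also have "\<dots> = (\<Sum>i\<le>deg A p. \<Psi> (h (coeff (UP A) p i) \<otimes>\<^bsub>S\<^esub> s [^]\<^bsub>S\<^esub> i))"
    using h s p by (intro nonunital_hom_finsum[OF \<Psi>]) auto
  also have "\<dots> = (\<Sum>i\<le>deg A p. \<Psi> (h (coeff (UP A) p i)) * \<Psi> s ^ i)"
    using h s p by (intro sum.cong refl nonunital_hom_mult_pow[OF \<Psi>]) auto
  also have "\<dots> = (\<Sum>i\<le>n. \<Psi> (h (coeff (UP A) p i)) * \<Psi> s ^ i)"
    by (rule sum.mono_neutral_left) (use n p h0 deg_aboveD in auto)
  finally show ?thesis .
qed

text \<open>One bound for both variables, so that double sums run over a square and further bounds
  can be merged by taking maxima.\<close>

definition deg2_le :: "('c, 'm) ring_scheme \<Rightarrow> (nat \<Rightarrow> nat \<Rightarrow> 'c) \<Rightarrow> nat \<Rightarrow> bool"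
  where "deg2_le A F n \<longleftrightarrow> deg (UP A) F \<le> n \<and> (\<forall>i. deg A (coeff (Poly2 A) F i) \<le> n)"

lemma deg2_le_exists:
  assumes A: "cring A" and F: "F \<in> carrier (Poly2 A)" shows "\<exists>n. \<forall>n'\<ge>n. deg2_le A F n'"
proof -
  interpret UP_cring A "UP A" using A by (simp add: UP_cring_def)
  interpret U2: UP_cring "UP A" "UP (UP A)" by (simp add: UP_cring_def UP_cring)
  define N where "N = deg (UP A) F + (\<Sum>i\<le>deg (UP A) F. deg A (coeff (Poly2 A) F i))"
  have "deg A (coeff (Poly2 A) F i) \<le> N" for i
  proof (cases "i \<le> deg (UP A) F")
    case True
    then show ?thesis using member_le_sum[of i "{..deg (UP A) F}" "\<lambda>i. deg A (coeff (Poly2 A) F i)"] by (simp add: N_def)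
  next
    case False
    then have "coeff (Poly2 A) F i = \<zero>\<^bsub>UP A\<^esub>" using U2.deg_aboveD[OF _ F] by simp
    then show ?thesis by simp
  qed
  then have "deg2_le A F n'" if "N \<le> n'" for n'
    using that unfolding deg2_le_def by (auto simp: N_def intro: order_trans[OF _ that])
  then show ?thesis by blast
qed

lemma nonunital_hom_eval2:
  assumes A: "cring A" and \<Psi>: "nonunital_hom S \<Psi>" and h: "\<And>a. a \<in> carrier A \<Longrightarrow> h a \<in> carrier S"
    and h0: "\<Psi> (h \<zero>\<^bsub>A\<^esub>) = 0" and s: "s \<in> carrier S" and t: "t \<in> carrier S"
    and F: "F \<in> carrier (Poly2 A)" and n: "deg2_le A F n"
  shows "\<Psi> (eval2 A S h s t F)
    = (\<Sum>i\<le>n. \<Sum>j\<le>n. \<Psi> (h (coeff (UP A) (coeff (Poly2 A) F i) j)) * (\<Psi> s ^ i * \<Psi> t ^ j))"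
proof -
  interpret UP_cring A "UP A" using A by (simp add: UP_cring_def)
  interpret U2: UP_cring "UP A" "UP (UP A)" by (simp add: UP_cring_def UP_cring)
  have S: "cring S" using \<Psi> by (simp add: nonunital_hom_def)
  have ev: "\<Psi> (eval A S h t p) = (\<Sum>j\<le>n. \<Psi> (h (coeff (UP A) p j)) * \<Psi> t ^ j)"
    if "p \<in> carrier (UP A)" "deg A p \<le> n" for p
    by (rule nonunital_hom_eval[where h = h, OF A \<Psi> h h0 t that])
  have z: "\<Psi> (eval A S h t \<zero>\<^bsub>UP A\<^esub>) = 0"
    by (subst ev) (simp_all add: h0)
  have "\<Psi> (eval2 A S h s t F) = (\<Sum>i\<le>n. \<Psi> (eval A S h t (coeff (Poly2 A) F i)) * \<Psi> s ^ i)"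
    unfolding eval2_def
    by (rule nonunital_hom_eval[where h = "eval A S h t", OF UP_cring \<Psi> _ z s F])
      (use n eval_closed[where h = h, OF A S h t] in \<open>auto simp: deg2_le_def\<close>)
  also have "\<dots> = (\<Sum>i\<le>n. (\<Sum>j\<le>n. \<Psi> (h (coeff (UP A) (coeff (Poly2 A) F i) j)) * \<Psi> t ^ j) * \<Psi> s ^ i)"
    using n F by (intro sum.cong refl arg_cong2[where f = "(*)"] ev) (auto simp: deg2_le_def)
  also have "\<dots> = (\<Sum>i\<le>n. \<Sum>j\<le>n. \<Psi> (h (coeff (UP A) (coeff (Poly2 A) F i) j)) * (\<Psi> s ^ i * \<Psi> t ^ j))"
    unfolding sum_distrib_right by (intro sum.cong refl) (simp add: algebra_simps)
  finally show ?thesis .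
qed

lemma ring_embed_hom:
  assumes "cring R" shows "nonunital_hom R (ring_embed R)"
  unfolding nonunital_hom_def using assms
  by (simp add: ring_embed_add ring_embed_mult ring_component_embed)

lemma ring_embed_inj: "cring R \<Longrightarrow> inj_on (ring_embed R) (carrier R)"
  by (metis inj_onI ring_component_embed)

lemma ring_embed_field_ideal:
  assumes R: "field R" and fin: "finite (carrier R)"
  shows "field_ideal (ring_embed R ` carrier R) (ring_embed R \<one>\<^bsub>R\<^esub>)"
proof -
  interpret field R by fact
  have cr: "cring R" by (rule is_cring)
  note hom = ring_embed_hom[OF cr]
  show ?thesis
  proof
    show "finite (ring_embed R ` carrier R)" using fin by simp
    show "ring_embed R \<one>\<^bsub>R\<^esub> \<in> ring_embed R ` carrier R" by simp
    show "ring_embed R \<one>\<^bsub>R\<^esub> \<noteq> 0"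
    proof
      assume "ring_embed R \<one>\<^bsub>R\<^esub> = 0"
      then have "ring_embed R \<one>\<^bsub>R\<^esub> = ring_embed R \<zero>\<^bsub>R\<^esub>" by (simp add: nonunital_hom_zero[OF hom])
      then show False using inj_onD[OF ring_embed_inj[OF cr]] by fastforce
    qed
    fix a assume a: "a \<in> ring_embed R ` carrier R"
    then obtain x where x: "x \<in> carrier R" "a = ring_embed R x" by blast
    show "a + b \<in> ring_embed R ` carrier R" if "b \<in> ring_embed R ` carrier R" for b
      using that x ring_embed_add[OF cr, symmetric] by fastforce
    show "w * a \<in> ring_embed R ` carrier R" for w
      using x ring_embed_mult[OF cr x(1)] ring_component_closed[OF cr] by auto
    show "ring_embed R \<one>\<^bsub>R\<^esub> * a = a"
      using x by (simp add: ring_embed_mult[OF cr] ring_component_embed[OF cr])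
    show "\<exists>b. a * b = ring_embed R \<one>\<^bsub>R\<^esub>" if "a \<noteq> 0"
    proof -
      have "x \<noteq> \<zero>\<^bsub>R\<^esub>" using that x nonunital_hom_zero[OF hom] by auto
      then have xu: "x \<in> Units R" using x(1) field_Units by blast
      have "a * ring_embed R (inv\<^bsub>R\<^esub> x) = ring_embed R (x \<otimes>\<^bsub>R\<^esub> inv\<^bsub>R\<^esub> x)"
        using x xu by (simp add: ring_embed_mult[OF cr] ring_component_embed[OF cr])
      then show ?thesis using xu by auto
    qed
  qed
qed

text \<open>Links the two notions of characteristic: the additive order of 1 divides every
  \<open>n\<close> that annihilates its image. For \<open>n = chr\<close> it turns the degree
  condition on F into exponents below \<open>chr\<close>.\<close>

lemma ring_characteristic_le:
  assumes R: "field R" and n: "n > 0" "of_nat n * ring_embed R \<one>\<^bsub>R\<^esub> = 0"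
  shows "ring_characteristic R \<le> n"
proof -
  interpret field R by fact
  have cr: "cring R" by (rule is_cring)
  have gr: "group (add_monoid R)" by (rule add.is_group)
  have cl: "\<one>\<^bsub>R\<^esub> [^]\<^bsub>add_monoid R\<^esub> m \<in> carrier R" for m :: nat
    using monoid.nat_pow_closed[OF group.is_monoid[OF gr], of "\<one>\<^bsub>R\<^esub>" m] by simp
  have emb: "ring_embed R (\<one>\<^bsub>R\<^esub> [^]\<^bsub>add_monoid R\<^esub> m) = of_nat m * ring_embed R \<one>\<^bsub>R\<^esub>" for m :: nat
  proof (induction m)
    case 0
    then show ?case
      using monoid.nat_pow_0[OF group.is_monoid[OF gr], of "\<one>\<^bsub>R\<^esub>"]
      by (simp add: nonunital_hom_zero[OF ring_embed_hom[OF cr]])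
  next
    case (Suc m)
    have "\<one>\<^bsub>R\<^esub> [^]\<^bsub>add_monoid R\<^esub> Suc m = (\<one>\<^bsub>R\<^esub> [^]\<^bsub>add_monoid R\<^esub> m) \<oplus>\<^bsub>R\<^esub> \<one>\<^bsub>R\<^esub>"
      using monoid.nat_pow_Suc[OF group.is_monoid[OF gr], of "\<one>\<^bsub>R\<^esub>" m] by simp
    then show ?case using Suc cl[of m] by (simp add: ring_embed_add[OF cr] algebra_simps)
  qed
  have "ring_embed R (\<one>\<^bsub>R\<^esub> [^]\<^bsub>add_monoid R\<^esub> n) = ring_embed R \<zero>\<^bsub>R\<^esub>"
    using emb n(2) by (simp add: nonunital_hom_zero[OF ring_embed_hom[OF cr]])
  then have "\<one>\<^bsub>R\<^esub> [^]\<^bsub>add_monoid R\<^esub> n = \<one>\<^bsub>add_monoid R\<^esub>"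
    using inj_onD[OF ring_embed_inj[OF cr]] cl by simp
  then have "group.ord (add_monoid R) \<one>\<^bsub>R\<^esub> dvd n"
    using group.pow_eq_id[OF gr, of "\<one>\<^bsub>R\<^esub>" n] by simp
  then show ?thesis unfolding ring_characteristic_def using n(1) by (rule dvd_imp_le)
qed

lemma UP_carrierI:
  assumes "\<And>i. f i \<in> carrier A" "\<And>i. i > n \<Longrightarrow> f i = \<zero>\<^bsub>A\<^esub>"
  shows "f \<in> carrier (UP A)"
proof -
  have "bound \<zero>\<^bsub>A\<^esub> n f" using assms(2) by (rule bound.intro)
  then have "f \<in> up A" using assms(1) by (intro mem_upI) auto
  then show ?thesis by (simp add: UP_def)
qed

lemma coeff_const_monom_power:
  fixes A B g :: "'b::comm_ring_1"
  shows "poly.coeff ([:A:] * (Polynomial.monom B 1 ^ i * [:g:] ^ j)) m = (if m = i then A * B ^ i * g ^ j else 0)"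
  by (simp add: monom_power poly_const_pow mult.commute mult.left_commute)

definition emb1 :: "'a ring \<Rightarrow> (nat \<Rightarrow> 'a) \<Rightarrow> 'a ring_product poly"
  where "emb1 R = poly_map R (ring_embed R)"

definition emb2 :: "'a ring \<Rightarrow> (nat \<Rightarrow> nat \<Rightarrow> 'a) \<Rightarrow> 'a ring_product poly poly"
  where "emb2 R = poly_map (UP R) (emb1 R)"

definition emb3 :: "'a ring \<Rightarrow> (nat \<Rightarrow> nat \<Rightarrow> nat \<Rightarrow> 'a) \<Rightarrow> 'a ring_product poly poly poly"
  where "emb3 R = poly_map (Poly2 R) (emb2 R)"

lemma finite_tricoeff:
  fixes p :: "'b::comm_ring_1 poly poly poly"
  shows "finite {(i, a, b). bicoeff (poly.coeff p i) a b \<noteq> 0}"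
proof (rule finite_subset)
  show "{(i, a, b). bicoeff (poly.coeff p i) a b \<noteq> 0}
    \<subseteq> (SIGMA i:{..degree p}. SIGMA a:{..degree (poly.coeff p i)}. {..degree (poly.coeff (poly.coeff p i) a)})"
  proof clarify
    fix i a b assume nz: "bicoeff (poly.coeff p i) a b \<noteq> 0"
    then have "poly.coeff p i \<noteq> 0" "poly.coeff (poly.coeff p i) a \<noteq> 0" "poly.coeff (poly.coeff (poly.coeff p i) a) b \<noteq> 0"
      by (auto simp: bicoeff_def)
    then show "i \<in> {..degree p} \<and> (a, b) \<in> (SIGMA a:{..degree (poly.coeff p i)}. {..degree (poly.coeff (poly.coeff p i) a)})"
      by (auto intro: le_degree)
  qed
qed auto

section \<open>The given field and its polynomials inside the product ring\<close>

context
  fixes R :: "'a ring"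
  assumes R: "field R" and fin: "finite (carrier R)"
begin

interpretation R: field R by (rule R)
interpretation U1: UP_cring R "UP R" by (simp add: UP_cring_def R.is_cring)
interpretation U2: UP_cring "UP R" "UP (UP R)" by (simp add: UP_cring_def U1.UP_cring)
interpretation U3: UP_cring "UP (UP R)" "UP (UP (UP R))" by (simp add: UP_cring_def U2.UP_cring)
interpretation FI: field_ideal "ring_embed R ` carrier R" "ring_embed R \<one>\<^bsub>R\<^esub>"
  by (rule ring_embed_field_ideal[OF R fin])

abbreviation (input) "\<iota> \<equiv> ring_embed R"
abbreviation (input) "kk \<equiv> ring_embed R ` carrier R"

lemma hom0: "nonunital_hom R \<iota>" by (rule ring_embed_hom[OF R.is_cring])
lemma hom1: "nonunital_hom (UP R) (emb1 R)" unfolding emb1_def by (rule nonunital_hom_poly_map[OF hom0])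
lemma hom2: "nonunital_hom (Poly2 R) (emb2 R)" unfolding emb2_def by (rule nonunital_hom_poly_map[OF hom1])
lemma hom3: "nonunital_hom (Poly3 R) (emb3 R)" unfolding emb3_def by (rule nonunital_hom_poly_map[OF hom2])

lemma inj2: "inj_on (emb2 R) (carrier (Poly2 R))"
  unfolding emb2_def emb1_def
  by (intro poly_map_inj nonunital_hom_poly_map hom0 ring_embed_inj R.is_cring)

lemma iota_zero: "\<iota> \<zero>\<^bsub>R\<^esub> = 0" by (rule nonunital_hom_zero[OF hom0])

lemma iota_eq_zero: "x \<in> carrier R \<Longrightarrow> \<iota> x = 0 \<longleftrightarrow> x = \<zero>\<^bsub>R\<^esub>"
  using inj_onD[OF ring_embed_inj[OF R.is_cring], of x "\<zero>\<^bsub>R\<^esub>"] iota_zero by auto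

lemma coeff_emb1: "p \<in> carrier (UP R) \<Longrightarrow> poly.coeff (emb1 R p) j = \<iota> (coeff (UP R) p j)"
  by (simp add: emb1_def coeff_poly_map[OF hom0])

lemma coeff_emb2: "p \<in> carrier (Poly2 R) \<Longrightarrow> poly.coeff (emb2 R p) i = emb1 R (coeff (Poly2 R) p i)"
  by (simp add: emb2_def coeff_poly_map[OF hom1])

lemma emb1_monom: "a \<in> carrier R \<Longrightarrow> emb1 R (monom (UP R) a n) = Polynomial.monom (\<iota> a) n"
  by (simp add: emb1_def poly_map_monom[OF hom0])

lemma emb2_monom: "p \<in> carrier (UP R) \<Longrightarrow> emb2 R (monom (Poly2 R) p n) = Polynomial.monom (emb1 R p) n"
  by (simp add: emb2_def poly_map_monom[OF hom1])

lemma bicoeff_emb2: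
  assumes "p \<in> carrier (Poly2 R)"
  shows "bicoeff (emb2 R p) i j = \<iota> (coeff (UP R) (coeff (Poly2 R) p i) j)"
  using assms by (simp add: bicoeff_def coeff_emb2 coeff_emb1)

lemma coeff_emb3: "p \<in> carrier (Poly3 R) \<Longrightarrow> poly.coeff (emb3 R p) i = emb2 R (coeff (Poly3 R) p i)"
  by (simp add: emb3_def coeff_poly_map[OF hom2])

lemma emb2_kbipoly: "p \<in> carrier (Poly2 R) \<Longrightarrow> emb2 R p \<in> FI.kbipoly"
  by (simp add: FI.kbipoly_def bicoeff_emb2)

lemma const2_closed: "a \<in> carrier R \<Longrightarrow> const2 R a \<in> carrier (Poly2 R)"
  and fst_var2_closed: "fst_var2 R \<in> carrier (Poly2 R)"
  and snd_var2_closed: "snd_var2 R \<in> carrier (Poly2 R)"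
  and lift_yz_closed: "p \<in> carrier (Poly2 R) \<Longrightarrow> lift_yz R p \<in> carrier (Poly3 R)"
  and x_var3_closed: "x_var3 R \<in> carrier (Poly3 R)"
  by (simp_all add: const2_def fst_var2_def snd_var2_def lift_yz_def x_var3_def)

lemma const3_closed: "a \<in> carrier R \<Longrightarrow> const3 R a \<in> carrier (Poly3 R)"
  by (simp add: const3_def lift_yz_closed const2_closed)

lemma emb2_const2: "a \<in> carrier R \<Longrightarrow> emb2 R (const2 R a) = cconst2 (\<iota> a)"
  by (simp add: const2_def emb2_monom emb1_monom monom_0)

lemma emb1_one: "emb1 R \<one>\<^bsub>UP R\<^esub> = [:\<iota> \<one>\<^bsub>R\<^esub>:]"
  using poly_map_monom[OF hom0, of "\<one>\<^bsub>R\<^esub>" 0] U1.monom_one by (simp add: emb1_def monom_0)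

lemma emb2_one: "emb2 R \<one>\<^bsub>Poly2 R\<^esub> = cconst2 (\<iota> \<one>\<^bsub>R\<^esub>)"
  using poly_map_monom[OF hom1, of "\<one>\<^bsub>UP R\<^esub>" 0] U2.monom_one by (simp add: emb2_def monom_0 emb1_one)

lemma emb2_fst_var2: "emb2 R (fst_var2 R) = Polynomial.monom [:\<iota> \<one>\<^bsub>R\<^esub>:] 1"
  by (simp add: fst_var2_def emb2_monom emb1_one)

lemma emb2_snd_var2: "emb2 R (snd_var2 R) = [:Polynomial.monom (\<iota> \<one>\<^bsub>R\<^esub>) 1:]"
  by (simp add: snd_var2_def emb2_monom emb1_monom monom_0)

lemma emb3_lift_yz: "p \<in> carrier (Poly2 R) \<Longrightarrow> emb3 R (lift_yz R p) = [:emb2 R p:]"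
  by (simp add: lift_yz_def emb3_def poly_map_monom[OF hom2] monom_0)

lemma emb3_const3: "a \<in> carrier R \<Longrightarrow> emb3 R (const3 R a) = [:cconst2 (\<iota> a):]"
  by (simp add: const3_def emb3_lift_yz const2_closed emb2_const2)

lemma emb3_x_var3: "emb3 R (x_var3 R) = Polynomial.monom (cconst2 (\<iota> \<one>\<^bsub>R\<^esub>)) 1"
  by (simp add: x_var3_def emb3_def poly_map_monom[OF hom2] emb2_one)

text \<open>A variable is mapped to a monomial with coefficient \<open>e\<close> instead of 1; the
  resulting powers of \<open>e\<close> are absorbed by any coefficient from the field.\<close>

lemma iota_e: "x \<in> carrier R \<Longrightarrow> \<iota> x * \<iota> \<one>\<^bsub>R\<^esub> ^ i = \<iota> x"
proof (induction i)
  case (Suc i)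
  have "\<iota> x * \<iota> \<one>\<^bsub>R\<^esub> ^ Suc i = \<iota> \<one>\<^bsub>R\<^esub> * (\<iota> x * \<iota> \<one>\<^bsub>R\<^esub> ^ i)" by (simp add: algebra_simps)
  then show ?case using Suc FI.e_mult[of "\<iota> x"] by simp
qed simp

lemma deg2_le_zero:
  assumes n: "deg2_le R p n" and p: "p \<in> carrier (Poly2 R)" and ij: "i > n \<or> j > n"
  shows "coeff (UP R) (coeff (Poly2 R) p i) j = \<zero>\<^bsub>R\<^esub>"
proof (cases "i > n")
  case True
  then have "coeff (Poly2 R) p i = \<zero>\<^bsub>UP R\<^esub>" using n p by (intro U2.deg_aboveD) (auto simp: deg2_le_def)
  then show ?thesis by simp
next
  case False
  then have "deg R (coeff (Poly2 R) p i) < j" using n ij unfolding deg2_le_def by (meson le_less_trans)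
  then show ?thesis using p by (intro U1.deg_aboveD) auto
qed

lemma bieval_emb2:
  assumes p: "p \<in> carrier (Poly2 R)" and y: "y \<in> carrier R" and z: "z \<in> carrier R"
  shows "bieval (emb2 R p) (\<iota> y) (\<iota> z) = \<iota> (eval2 R R (\<lambda>a. a) y z p)"
proof -
  obtain n where n: "deg2_le R p n" using deg2_le_exists[OF R.is_cring p] by blast
  note cz = deg2_le_zero[OF n p]
  have bz: "bicoeff (emb2 R p) i j = 0" if "i > n \<or> j > n" for i j
    using that by (simp add: bicoeff_emb2[OF p] iota_zero cz)
  have "poly.coeff (emb2 R p) i = 0" if "i > n" for i
    using bz[of i] that by (intro poly_eqI) (simp add: bicoeff_def)
  then have "bieval (emb2 R p) (\<iota> y) (\<iota> z) = (\<Sum>i\<le>n. poly (poly.coeff (emb2 R p) i) (\<iota> z) * \<iota> y ^ i)"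
    by (rule bieval_altdef)
  also have "\<dots> = (\<Sum>i\<le>n. (\<Sum>j\<le>n. bicoeff (emb2 R p) i j * \<iota> z ^ j) * \<iota> y ^ i)"
  proof (intro sum.cong refl arg_cong2[where f = "(*)"])
    fix i
    have "degree (poly.coeff (emb2 R p) i) \<le> n" using bz[of i] by (intro degree_le) (simp add: bicoeff_def)
    then show "poly (poly.coeff (emb2 R p) i) (\<iota> z) = (\<Sum>j\<le>n. bicoeff (emb2 R p) i j * \<iota> z ^ j)"
      unfolding poly_altdef bicoeff_def by (intro sum.mono_neutral_left) (auto simp: coeff_eq_0)
  qed
  also have "\<dots> = (\<Sum>i\<le>n. \<Sum>j\<le>n. \<iota> (coeff (UP R) (coeff (Poly2 R) p i) j) * (\<iota> y ^ i * \<iota> z ^ j))"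
    unfolding sum_distrib_right bicoeff_emb2[OF p] by (intro sum.cong refl) (simp add: algebra_simps)
  also have "\<dots> = \<iota> (eval2 R R (\<lambda>a. a) y z p)"
    by (rule nonunital_hom_eval2[where h = "\<lambda>a. a", symmetric, OF R.is_cring hom0 _ _ y z p n]) (auto simp: iota_zero)
  finally show ?thesis .
qed

lemma eval2_closed:
  assumes "p \<in> carrier (Poly2 R)" "y \<in> carrier R" "z \<in> carrier R"
  shows "eval2 R R (\<lambda>a. a) y z p \<in> carrier R"
  unfolding eval2_def
  by (rule eval_closed[where h = "eval R R (\<lambda>a. a) z", OF U1.UP_cring R.is_cring])
    (use assms eval_closed[where h = "\<lambda>a. a", OF R.is_cring R.is_cring] in auto)

lemma eval3_closed:
  assumes "P \<in> carrier (Poly3 R)" "x \<in> carrier R" "y \<in> carrier R" "z \<in> carrier R"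
  shows "eval3 R R (\<lambda>a. a) x y z P \<in> carrier R"
  unfolding eval3_def
  by (rule eval_closed[where h = "eval2 R R (\<lambda>a. a) y z", OF U2.UP_cring R.is_cring]) (use assms eval2_closed in auto)

lemma iota_eval3:
  assumes P: "P \<in> carrier (Poly3 R)" and xyz: "x \<in> carrier R" "y \<in> carrier R" "z \<in> carrier R"
    and n: "deg (Poly2 R) P \<le> n"
  shows "\<iota> (eval3 R R (\<lambda>a. a) x y z P) = (\<Sum>m\<le>n. bieval (poly.coeff (emb3 R P) m) (\<iota> y) (\<iota> z) * \<iota> x ^ m)"
proof -
  have z0: "\<zero>\<^bsub>Poly2 R\<^esub> \<in> carrier (Poly2 R)" by simp
  have "\<iota> (eval2 R R (\<lambda>a. a) y z \<zero>\<^bsub>Poly2 R\<^esub>) = 0"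
    using bieval_emb2[OF z0 xyz(2,3)] by (simp add: nonunital_hom_zero[OF hom2])
  then have "\<iota> (eval3 R R (\<lambda>a. a) x y z P) = (\<Sum>m\<le>n. \<iota> (eval2 R R (\<lambda>a. a) y z (coeff (Poly3 R) P m)) * \<iota> x ^ m)"
    unfolding eval3_def
    by (intro nonunital_hom_eval[where h = "eval2 R R (\<lambda>a. a) y z", OF U2.UP_cring hom0])
      (use P xyz n eval2_closed in auto)
  also have "\<dots> = (\<Sum>m\<le>n. bieval (poly.coeff (emb3 R P) m) (\<iota> y) (\<iota> z) * \<iota> x ^ m)"
    using P xyz by (intro sum.cong refl) (simp add: coeff_emb3 bieval_emb2)
  finally show ?thesis .
qed

text \<open>By contraposition, a non-diagonal F has a nonzero mixed coefficient, the starting point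
  of the estimate.\<close>

lemma diagonal2I:
  assumes F: "F \<in> carrier (Poly2 R)"
    and mixed: "\<And>i j. i > 0 \<Longrightarrow> j > 0 \<Longrightarrow> coeff (UP R) (coeff (Poly2 R) F i) j = \<zero>\<^bsub>R\<^esub>"
  shows "diagonal2 R F"
proof -
  obtain n where n: "deg2_le R F n" using deg2_le_exists[OF R.is_cring F] by blast
  note cz = deg2_le_zero[OF n F]
  define f where "f i = coeff (UP R) (coeff (Poly2 R) F i) 0" for i
  \<comment> \<open>The constant term of F already belongs to \<open>f\<close> and must not be
    counted twice.\<close>
  define g where "g j = (if j = 0 then \<zero>\<^bsub>R\<^esub> else coeff (UP R) (coeff (Poly2 R) F 0) j)" for j
  have ci: "f i \<in> carrier R" "g i \<in> carrier R" for i using F by (auto simp: f_def g_def)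
  have fc: "f \<in> carrier (UP R)" by (rule UP_carrierI[of _ _ n]) (simp_all add: ci, simp add: f_def cz)
  have gc: "g \<in> carrier (UP R)" by (rule UP_carrierI[of _ _ n]) (simp_all add: ci, simp add: g_def cz)
  have fco: "coeff (UP R) f i = f i" and gco: "coeff (UP R) g i = g i" for i
    using fc gc by (simp_all add: UP_def)
  have degf: "deg R f \<le> n" using fc cz by (intro U1.deg_aboveI) (auto simp: fco f_def)
  have degg: "deg R g \<le> n" using gc cz by (intro U1.deg_aboveI) (auto simp: gco g_def)
  define E1 where "E1 = eval R (Poly2 R) (const2 R) (fst_var2 R) f"
  define E2 where "E2 = eval R (Poly2 R) (const2 R) (snd_var2 R) g"
  have Ec: "E1 \<in> carrier (Poly2 R)" "E2 \<in> carrier (Poly2 R)"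
    unfolding E1_def E2_def
    by (rule eval_closed[where h = "const2 R", OF R.is_cring U2.UP_cring const2_closed fst_var2_closed fc], simp)
      (rule eval_closed[where h = "const2 R", OF R.is_cring U2.UP_cring const2_closed snd_var2_closed gc], simp)
  have e1: "emb2 R E1 = (\<Sum>i\<le>n. cconst2 (\<iota> (f i)) * Polynomial.monom [:\<iota> \<one>\<^bsub>R\<^esub>:] 1 ^ i)"
  proof -
    have "emb2 R E1 = (\<Sum>i\<le>n. emb2 R (const2 R (coeff (UP R) f i)) * emb2 R (fst_var2 R) ^ i)"
      unfolding E1_def
      by (rule nonunital_hom_eval[where h = "const2 R", OF R.is_cring hom2 const2_closed _ fst_var2_closed fc degf])
        (auto simp: emb2_const2 iota_zero)
    then show ?thesis using F by (simp add: emb2_const2 emb2_fst_var2 fco f_def)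
  qed
  have e2: "emb2 R E2 = (\<Sum>i\<le>n. cconst2 (\<iota> (g i)) * [:Polynomial.monom (\<iota> \<one>\<^bsub>R\<^esub>) 1:] ^ i)"
  proof -
    have "emb2 R E2 = (\<Sum>i\<le>n. emb2 R (const2 R (coeff (UP R) g i)) * emb2 R (snd_var2 R) ^ i)"
      unfolding E2_def
      by (rule nonunital_hom_eval[where h = "const2 R", OF R.is_cring hom2 const2_closed _ snd_var2_closed gc degg])
        (auto simp: emb2_const2 iota_zero)
    then show ?thesis using F by (simp add: emb2_const2 emb2_snd_var2 gco g_def)
  qed
  have b1: "bicoeff (cconst2 (\<iota> (f i)) * Polynomial.monom [:\<iota> \<one>\<^bsub>R\<^esub>:] 1 ^ i) a b
      = (if a = i \<and> b = 0 then \<iota> (f i) else 0)" for i a b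
    using iota_e[OF ci(1), of i i] by (auto simp: bicoeff_def monom_power poly_const_pow coeff_pCons split: nat.split)
  have b2: "bicoeff (cconst2 (\<iota> (g i)) * [:Polynomial.monom (\<iota> \<one>\<^bsub>R\<^esub>) 1:] ^ i) a b
      = (if a = 0 \<and> b = i then \<iota> (g i) else 0)" for i a b
    using iota_e[OF ci(2), of i i] by (auto simp: bicoeff_def monom_power poly_const_pow coeff_pCons split: nat.split)
  have "emb2 R F = emb2 R (E1 \<oplus>\<^bsub>Poly2 R\<^esub> E2)"
  proof (rule bicoeff_eqI)
    fix a b
    have "bicoeff (emb2 R (E1 \<oplus>\<^bsub>Poly2 R\<^esub> E2)) a b = bicoeff (emb2 R E1) a b + bicoeff (emb2 R E2) a b"
      using hom2 Ec by (simp add: nonunital_hom_def)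
    also have "\<dots> = (\<Sum>i\<le>n. if a = i \<and> b = 0 then \<iota> (f i) else 0) + (\<Sum>i\<le>n. if a = 0 \<and> b = i then \<iota> (g i) else 0)"
      unfolding e1 e2 bicoeff_sum b1 b2 ..
    also have "\<dots> = (if b = 0 \<and> a \<le> n then \<iota> (f a) else 0) + (if a = 0 \<and> b \<le> n then \<iota> (g b) else 0)"
      by (cases "b = 0"; cases "a = 0") (simp_all add: sum.delta sum.delta')
    also have "\<dots> = bicoeff (emb2 R F) a b"
      unfolding bicoeff_emb2[OF F] f_def g_def
      using mixed[of a b] cz[of a b] by (cases "a = 0"; cases "b = 0") (auto simp: iota_zero not_le)
    finally show "bicoeff (emb2 R F) a b = bicoeff (emb2 R (E1 \<oplus>\<^bsub>Poly2 R\<^esub> E2)) a b" by simp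
  qed
  then have "F = E1 \<oplus>\<^bsub>Poly2 R\<^esub> E2" using F Ec by (intro inj_onD[OF inj2]) auto
  then show ?thesis unfolding diagonal2_def E1_def E2_def using fc gc by blast
qed

text \<open>A relation with coefficients in the ideal is lifted coefficientwise to a polynomial over
  \<open>R\<close>; as \<open>emb2\<close> is injective, it is already a relation there.\<close>

lemma alg_independent2_emb2:
  assumes G: "G \<in> carrier (Poly2 R)" and H: "H \<in> carrier (Poly2 R)" and ind: "alg_independent2 R G H"
  shows "FI.alg_indep (emb2 R G) (emb2 R H)"
  unfolding FI.alg_indep_def
proof (intro allI impI)
  fix Q :: "nat \<Rightarrow> nat \<Rightarrow> 'a ring_product" and N b c
  assume Q: "\<forall>b c. Q b c \<in> kk" and z: "(\<Sum>b<N. \<Sum>c<N. cconst2 (Q b c) * (emb2 R G ^ b * emb2 R H ^ c)) = 0"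
    and b: "b < N" and c: "c < N"
  have "\<exists>x\<in>carrier R. \<iota> x = Q b c" for b c using Q by (metis imageE)
  then obtain q where q: "\<And>b c. q b c \<in> carrier R" "\<And>b c. \<iota> (q b c) = Q b c" by metis
  define p where "p b c = (if b < N \<and> c < N then q b c else \<zero>\<^bsub>R\<^esub>)" for b c
  have pb: "p b \<in> carrier (UP R)" for b
    by (rule UP_carrierI[of _ _ N]) (use q(1) in \<open>simp_all add: p_def\<close>)
  have pc: "p \<in> carrier (Poly2 R)"
  proof -
    have "p b = \<zero>\<^bsub>UP R\<^esub>" if "b > N" for b using that by (auto simp: p_def UP_def)
    then show ?thesis by (intro UP_carrierI[of _ _ N] pb)
  qed
  have pco: "coeff (UP R) (coeff (Poly2 R) p b) c = p b c" for b c
    using pc pb[of b] by (simp add: UP_def)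
  obtain n0 where n0: "\<forall>n'\<ge>n0. deg2_le R p n'" using deg2_le_exists[OF R.is_cring pc] by blast
  define n where "n = max n0 N"
  have n: "deg2_le R p n" "N \<le> n" using n0 by (auto simp: n_def)
  have "emb2 R (eval2 R (Poly2 R) (const2 R) G H p)
      = (\<Sum>i\<le>n. \<Sum>j\<le>n. emb2 R (const2 R (coeff (UP R) (coeff (Poly2 R) p i) j)) * (emb2 R G ^ i * emb2 R H ^ j))"
    by (rule nonunital_hom_eval2[where h = "const2 R", OF R.is_cring hom2 const2_closed _ G H pc n(1)])
      (auto simp: emb2_const2 iota_zero)
  also have "\<dots> = (\<Sum>i\<le>n. \<Sum>j\<le>n. cconst2 (\<iota> (p i j)) * (emb2 R G ^ i * emb2 R H ^ j))"
    using pb q(1) by (intro sum.cong refl) (simp add: pco emb2_const2 p_def)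
  also have "\<dots> = (\<Sum>i<N. \<Sum>j\<le>n. cconst2 (\<iota> (p i j)) * (emb2 R G ^ i * emb2 R H ^ j))"
    using n(2) by (intro sum.mono_neutral_right) (auto simp: p_def iota_zero)
  also have "\<dots> = (\<Sum>i<N. \<Sum>j<N. cconst2 (\<iota> (p i j)) * (emb2 R G ^ i * emb2 R H ^ j))"
    using n(2) by (intro sum.cong refl sum.mono_neutral_right) (auto simp: p_def iota_zero)
  also have "\<dots> = 0" using z by (simp add: p_def q(2))
  finally have "emb2 R (eval2 R (Poly2 R) (const2 R) G H p) = emb2 R \<zero>\<^bsub>Poly2 R\<^esub>"
    by (simp add: nonunital_hom_zero[OF hom2])
  moreover have "eval2 R (Poly2 R) (const2 R) G H p \<in> carrier (Poly2 R)"
    unfolding eval2_def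
    by (rule eval_closed[where h = "eval R (Poly2 R) (const2 R) H", OF U1.UP_cring U2.UP_cring _ G pc])
      (rule eval_closed[where h = "const2 R", OF R.is_cring U2.UP_cring const2_closed H])
  ultimately have "eval2 R (Poly2 R) (const2 R) G H p = \<zero>\<^bsub>Poly2 R\<^esub>"
    by (intro inj_onD[OF inj2]) auto
  then have "p = \<zero>\<^bsub>Poly2 R\<^esub>" using ind pc unfolding alg_independent2_def by blast
  then have "p b c = \<zero>\<^bsub>R\<^esub>" using pco[of b c] by simp
  then have "q b c = \<zero>\<^bsub>R\<^esub>" using b c by (simp add: p_def)
  then show "Q b c = 0" using q(2)[of b c] iota_zero by simp
qed

lemma expander_bound_ring:
  assumes P: "P \<in> carrier (Poly3 R)" and F: "F \<in> carrier (Poly2 R)" and G: "G \<in> carrier (Poly2 R)"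
    and H: "H \<in> carrier (Poly2 R)" and J: "J \<in> carrier (UP R)"
    and Peq: "P = eval2 R (Poly3 R) (const3 R) (x_var3 R) (lift_yz R G) F
        \<oplus>\<^bsub>Poly3 R\<^esub> lift_yz R H \<oplus>\<^bsub>Poly3 R\<^esub> eval R (Poly3 R) (const3 R) (x_var3 R) J"
    and d: "total_deg3 R P = d" and nd: "\<not> diagonal2 R F"
    and degF: "total_deg2 R F < ring_characteristic R" and ind: "alg_independent2 R G H"
    and X: "X \<subseteq> carrier R" and Y: "Y \<subseteq> carrier R" and Z: "Z \<subseteq> carrier R"
    and M: "M = fibre_degree d"
  shows "image3 R P X Y Z \<subseteq> carrier R"
    and "real (card X) * (real (card Y) * real (card Z) - 8 * real d * real M * real (order R))
        * (real (order R) - real (card (image3 R P X Y Z)))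
      \<le> 2 * real d * (real M)\<^sup>2 * (real (order R) ^ 3 * sqrt (real (order R)))"
proof -
  show imgR: "image3 R P X Y Z \<subseteq> carrier R"
    unfolding image3_def using eval3_closed[OF P] X Y Z by blast
  obtain nF where nF: "\<forall>n'\<ge>nF. deg2_le R F n'" using deg2_le_exists[OF R.is_cring F] by blast
  define n where "n = max nF (max (deg R J) (deg (Poly2 R) P))"
  have n: "deg2_le R F n" "deg R J \<le> n" "deg (Poly2 R) P \<le> n" using nF by (auto simp: n_def)
  define c where "c i j = \<iota> (coeff (UP R) (coeff (Poly2 R) F i) j)" for i j
  define Jc where "Jc i = \<iota> (coeff (UP R) J i)" for i
  have Fc: "coeff (UP R) (coeff (Poly2 R) F i) j \<in> carrier R" for i j using F by simp
  have Jcl: "coeff (UP R) J i \<in> carrier R" for i using J by simp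
  have ck: "c i j \<in> kk" "Jc i \<in> kk" for i j using Fc Jcl by (auto simp: c_def Jc_def)
  have c0: "c i j = 0" if "i > n \<or> j > n" for i j
    using deg2_le_zero[OF n(1) F that] by (simp add: c_def iota_zero)
  have J0: "Jc i = 0" if "i > n" for i
    using U1.deg_aboveD[OF _ J, of i] that n(2) by (simp add: Jc_def iota_zero)
  have supp: "i \<le> n \<and> j \<le> n \<and> i + j < FI.chr" if nz: "c i j \<noteq> 0" for i j
  proof -
    have ij: "i \<le> n" "j \<le> n" using c0[of i j] nz by linarith+
    have ne: "coeff (UP R) (coeff (Poly2 R) F i) j \<noteq> \<zero>\<^bsub>R\<^esub>" using nz by (auto simp: c_def iota_zero)
    have "finite {i + j | i j. coeff (UP R) (coeff (Poly2 R) F i) j \<noteq> \<zero>\<^bsub>R\<^esub>}"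
    proof (rule finite_subset)
      show "{i + j | i j. coeff (UP R) (coeff (Poly2 R) F i) j \<noteq> \<zero>\<^bsub>R\<^esub>} \<subseteq> {..n + n}"
      proof (rule subsetI)
        fix t assume "t \<in> {i + j | i j. coeff (UP R) (coeff (Poly2 R) F i) j \<noteq> \<zero>\<^bsub>R\<^esub>}"
        then obtain i j where t: "t = i + j" "coeff (UP R) (coeff (Poly2 R) F i) j \<noteq> \<zero>\<^bsub>R\<^esub>" by blast
        then have "\<not> (i > n \<or> j > n)" using deg2_le_zero[OF n(1) F] by blast
        then show "t \<in> {..n + n}" using t(1) by auto
      qed
    qed simp
    then have "i + j \<le> total_deg2 R F" unfolding total_deg2_def using ne by (intro Max_ge) auto
    also have "\<dots> < ring_characteristic R" by (rule degF)
    also have "\<dots> \<le> FI.chr" by (rule ring_characteristic_le[OF R FI.chr_props])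
    finally show ?thesis using ij by blast
  qed
  obtain i0 j0 where mixed: "i0 > 0" "j0 > 0" "c i0 j0 \<noteq> 0"
  proof -
    obtain i j where "i > 0" "j > 0" "coeff (UP R) (coeff (Poly2 R) F i) j \<noteq> \<zero>\<^bsub>R\<^esub>"
      using diagonal2I[OF F] nd by blast
    then show ?thesis using that[of i j] iota_eq_zero[OF Fc] by (simp add: c_def)
  qed
  define G' H' where "G' = emb2 R G" and "H' = emb2 R H"
  \<comment> \<open>The coefficient of x^m in P, in the form that \<open>expander_bound\<close> uses
    for both degrees and values.\<close>
  have emb3P: "poly.coeff (emb3 R P) m = (\<Sum>j\<le>n. cconst2 (c m j) * G' ^ j) + (if m = 0 then H' else 0) + cconst2 (Jc m)" for m
  proof -
    define E1 where "E1 = eval2 R (Poly3 R) (const3 R) (x_var3 R) (lift_yz R G) F"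
    define E3 where "E3 = eval R (Poly3 R) (const3 R) (x_var3 R) J"
    have cl3: "cring (Poly3 R)" by (rule U3.UP_cring)
    have E1c: "E1 \<in> carrier (Poly3 R)"
      unfolding E1_def eval2_def
      by (rule eval_closed[where h = "eval R (Poly3 R) (const3 R) (lift_yz R G)", OF U1.UP_cring cl3 _ x_var3_closed F])
        (rule eval_closed[where h = "const3 R", OF R.is_cring cl3 const3_closed lift_yz_closed[OF G]])
    have E3c: "E3 \<in> carrier (Poly3 R)"
      unfolding E3_def by (rule eval_closed[where h = "const3 R", OF R.is_cring cl3 const3_closed x_var3_closed J])
    have z3: "emb3 R (const3 R \<zero>\<^bsub>R\<^esub>) = 0" by (simp add: emb3_const3 iota_zero)
    have e1: "emb3 R E1 = (\<Sum>i\<le>n. \<Sum>j\<le>n. [:cconst2 (c i j):] * (Polynomial.monom (cconst2 (\<iota> \<one>\<^bsub>R\<^esub>)) 1 ^ i * [:G':] ^ j))"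
    proof -
      have "emb3 R E1 = (\<Sum>i\<le>n. \<Sum>j\<le>n. emb3 R (const3 R (coeff (UP R) (coeff (Poly2 R) F i) j)) * (emb3 R (x_var3 R) ^ i * emb3 R (lift_yz R G) ^ j))"
        unfolding E1_def
        by (rule nonunital_hom_eval2[where h = "const3 R", OF R.is_cring hom3 const3_closed z3 x_var3_closed lift_yz_closed[OF G] F n(1)])
      then show ?thesis by (simp only: emb3_const3[OF Fc] emb3_x_var3 emb3_lift_yz[OF G] c_def G'_def)
    qed
    \<comment> \<open>The factor \<open>[:0:] ^ 0\<close> is 1; it gives the summands the shape of
      \<open>coeff_const_monom_power\<close>.\<close>
    have e3: "emb3 R E3 = (\<Sum>i\<le>n. [:cconst2 (Jc i):] * (Polynomial.monom (cconst2 (\<iota> \<one>\<^bsub>R\<^esub>)) 1 ^ i * [:0:] ^ 0))"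
    proof -
      have "emb3 R E3 = (\<Sum>i\<le>n. emb3 R (const3 R (coeff (UP R) J i)) * emb3 R (x_var3 R) ^ i)"
        unfolding E3_def
        by (rule nonunital_hom_eval[where h = "const3 R", OF R.is_cring hom3 const3_closed z3 x_var3_closed J n(2)])
      then show ?thesis by (simp only: emb3_const3[OF Jcl] emb3_x_var3 Jc_def power_0 mult_1_right)
    qed
    have abs: "cconst2 (\<iota> x) * cconst2 (\<iota> \<one>\<^bsub>R\<^esub>) ^ i = cconst2 (\<iota> x)" if "x \<in> carrier R" for x i
      using iota_e[OF that, of i] by (simp add: poly_const_pow)
    have "emb3 R P = emb3 R E1 + emb3 R (lift_yz R H) + emb3 R E3"
      using hom3 E1c E3c lift_yz_closed[OF H] unfolding Peq E1_def[symmetric] E3_def[symmetric]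
      by (simp add: nonunital_hom_def)
    then have "poly.coeff (emb3 R P) m = poly.coeff (emb3 R E1) m + poly.coeff [:H':] m + poly.coeff (emb3 R E3) m"
      by (simp add: emb3_lift_yz[OF H] H'_def)
    also have "poly.coeff (emb3 R E1) m = (\<Sum>i\<le>n. if m = i then (\<Sum>j\<le>n. cconst2 (c i j) * G' ^ j) else 0)"
      unfolding e1 coeff_sum coeff_const_monom_power c_def abs[OF Fc]
      by (intro sum.cong refl) simp
    also have "\<dots> = (\<Sum>j\<le>n. cconst2 (c m j) * G' ^ j)"
      using c0 by (cases "m \<le> n") (auto simp: sum.delta)
    also have "poly.coeff (emb3 R E3) m = (\<Sum>i\<le>n. if m = i then cconst2 (Jc i) else 0)"
      unfolding e3 coeff_sum coeff_const_monom_power Jc_def abs[OF Jcl] by (simp only: power_0 mult_1_right)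
    also have "\<dots> = cconst2 (Jc m)"
      using J0 by (cases "m \<le> n") (auto simp: sum.delta)
    also have "poly.coeff [:H':] m = (if m = 0 then H' else 0)" by (simp add: coeff_pCons split: nat.split)
    finally show ?thesis .
  qed
  have degP: "i + a + b \<le> d" if nz: "bicoeff (poly.coeff (emb3 R P) i) a b \<noteq> 0" for i a b
  proof -
    have tri: "bicoeff (poly.coeff (emb3 R P) i) a b = \<iota> (coeff (UP R) (coeff (Poly2 R) (coeff (Poly3 R) P i) a) b)" for i a b
      using P by (simp add: coeff_emb3 bicoeff_emb2)
    have cc: "coeff (UP R) (coeff (Poly2 R) (coeff (Poly3 R) P i) a) b \<in> carrier R" for i a b using P by simp
    \<comment> \<open>Finiteness comes first, since \<open>Max\<close> is meaningful only for a
      finite set.\<close>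
    have "{i + j + k | i j k. coeff (UP R) (coeff (Poly2 R) (coeff (Poly3 R) P i) j) k \<noteq> \<zero>\<^bsub>R\<^esub>}
      = (\<lambda>(i, j, k). i + j + k) ` {(i, a, b). bicoeff (poly.coeff (emb3 R P) i) a b \<noteq> 0}"
      unfolding tri iota_eq_zero[OF cc] by force
    then have "finite {i + j + k | i j k. coeff (UP R) (coeff (Poly2 R) (coeff (Poly3 R) P i) j) k \<noteq> \<zero>\<^bsub>R\<^esub>}"
      using finite_tricoeff[of "emb3 R P"] by simp
    moreover have "coeff (UP R) (coeff (Poly2 R) (coeff (Poly3 R) P i) a) b \<noteq> \<zero>\<^bsub>R\<^esub>"
      using nz unfolding tri by (auto simp: iota_zero)
    ultimately show ?thesis unfolding d[symmetric] total_deg3_def by (intro Max_ge) auto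
  qed
  define Jf where "Jf x = (\<Sum>i\<le>n. Jc i * x ^ i)" for x
  have inj: "inj_on \<iota> A" if "A \<subseteq> carrier R" for A
    using ring_embed_inj[OF R.is_cring] that inj_on_subset by blast
  have qR: "FI.q = order R" unfolding FI.q_def order_def using card_image[OF inj[of "carrier R"]] by simp
  have "real (card (\<iota> ` X)) * (real (card (\<iota> ` Y)) * real (card (\<iota> ` Z)) - 8 * real d * real M * real FI.q)
      * (real FI.q - real (card (\<iota> ` image3 R P X Y Z)))
    \<le> 2 * real d * (real M)\<^sup>2 * (real FI.q ^ 3 * sqrt (real FI.q))"
  proof (rule FI.expander_bound[where c = c and n = n and G = G' and H = H' and Jc = Jc and J = Jf])
    show "c i0 j0 \<noteq> 0" "i0 > 0" "j0 > 0" by (fact mixed)+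
    show "G' \<in> FI.kbipoly" "H' \<in> FI.kbipoly" using G H by (auto simp: G'_def H'_def emb2_kbipoly)
    show "FI.alg_indep G' H'" unfolding G'_def H'_def by (rule alg_independent2_emb2[OF G H ind])
    show "i + a + b \<le> d" if "i > 0" "bicoeff ((\<Sum>j\<le>n. cconst2 (c i j) * G' ^ j) + cconst2 (Jc i)) a b \<noteq> 0" for i a b
      by (rule degP) (use that in \<open>simp only: emb3P, simp\<close>)
    show "a + b \<le> d" if "bicoeff ((\<Sum>j\<le>n. cconst2 (c 0 j) * G' ^ j) + H' + cconst2 (Jc 0)) a b \<noteq> 0" for a b
    proof -
      have "0 + a + b \<le> d" by (rule degP) (use that in \<open>simp only: emb3P, simp\<close>)
      then show ?thesis by simp
    qed
    show "Jf x \<in> kk" if "x \<in> \<iota> ` X" for x unfolding Jf_def by (intro FI.sum_k FI.mult_k' ck)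
    fix x y z assume "x \<in> \<iota> ` X" "y \<in> \<iota> ` Y" "z \<in> \<iota> ` Z"
    then obtain x' y' z' where x: "x' \<in> X" "x = \<iota> x'" and y: "y' \<in> Y" "y = \<iota> y'" and z: "z' \<in> Z" "z = \<iota> z'" by blast
    have cx: "x' \<in> carrier R" "y' \<in> carrier R" "z' \<in> carrier R" using x y z X Y Z by auto
    have "\<iota> (eval3 R R (\<lambda>a. a) x' y' z' P) = (\<Sum>m\<le>n. bieval (poly.coeff (emb3 R P) m) y z * x ^ m)"
      using iota_eval3[OF P cx n(3)] by (simp only: x y z)
    also have "\<dots> = (\<Sum>m\<le>n. ((\<Sum>j\<le>n. c m j * bieval G' y z ^ j) + (if m = 0 then bieval H' y z else 0) + Jc m) * x ^ m)"
      unfolding emb3P by (intro sum.cong refl) (simp add: bieval_sum)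
    also have "\<dots> = (\<Sum>m\<le>n. \<Sum>j\<le>n. c m j * (x ^ m * bieval G' y z ^ j)) + (\<Sum>m\<le>n. if m = 0 then bieval H' y z else 0) + Jf x"
      unfolding Jf_def sum.distrib[symmetric]
    proof (intro sum.cong refl)
      fix m
      have "(\<Sum>j\<le>n. c m j * bieval G' y z ^ j) * x ^ m = (\<Sum>j\<le>n. c m j * (x ^ m * bieval G' y z ^ j))"
        unfolding sum_distrib_right by (intro sum.cong refl) (simp add: algebra_simps)
      then show "((\<Sum>j\<le>n. c m j * bieval G' y z ^ j) + (if m = 0 then bieval H' y z else 0) + Jc m) * x ^ m
        = (\<Sum>j\<le>n. c m j * (x ^ m * bieval G' y z ^ j)) + (if m = 0 then bieval H' y z else 0) + Jc m * x ^ m"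
        by (simp add: distrib_right)
    qed
    also have "(\<Sum>m\<le>n. if m = 0 then bieval H' y z else 0) = bieval H' y z" by simp
    finally have "\<iota> (eval3 R R (\<lambda>a. a) x' y' z' P) = (\<Sum>m\<le>n. \<Sum>j\<le>n. c m j * (x ^ m * bieval G' y z ^ j)) + bieval H' y z + Jf x" .
    moreover have "eval3 R R (\<lambda>a. a) x' y' z' P \<in> image3 R P X Y Z" unfolding image3_def using x y z by blast
    ultimately show "(\<Sum>i\<le>n. \<Sum>j\<le>n. c i j * (x ^ i * bieval G' y z ^ j)) + bieval H' y z + Jf x \<in> \<iota> ` image3 R P X Y Z"
      by (metis imageI)
  qed (use ck supp X Y Z imgR M in auto)
  then show "real (card X) * (real (card Y) * real (card Z) - 8 * real d * real M * real (order R))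
        * (real (order R) - real (card (image3 R P X Y Z)))
      \<le> 2 * real d * (real M)\<^sup>2 * (real (order R) ^ 3 * sqrt (real (order R)))"
    by (simp only: qR card_image[OF inj[OF X]] card_image[OF inj[OF Y]] card_image[OF inj[OF Z]] card_image[OF inj[OF imgR]])
qed

end

text \<open>For large q the term \<open>K1 * q\<close> is at most half of the lower bound for
  \<open>y * z\<close>, and the exponent 7/2 - 8/3 - 3 \<epsilon> = 5/6 - 3 \<epsilon> is below 1 -
  3 \<epsilon>. For the remaining q the trivial bound q - s \<le> q is enough.\<close>

lemma expander_asymptotics:
  fixes c \<epsilon> K1 K2 :: real
  assumes c: "c > 0" and K: "K1 \<ge> 0" "K2 \<ge> 0" and \<epsilon>: "\<epsilon> > 0"
  shows "\<exists>C>0. \<forall>q s x y z :: real. q \<ge> 1 \<longrightarrow> 0 \<le> s \<longrightarrow> s \<le> q \<longrightarrow>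
    x \<ge> c * q powr (8 / 9 + \<epsilon>) \<longrightarrow> y \<ge> c * q powr (8 / 9 + \<epsilon>) \<longrightarrow> z \<ge> c * q powr (8 / 9 + \<epsilon>) \<longrightarrow>
    x * (y * z - K1 * q) * (q - s) \<le> K2 * (q ^ 3 * sqrt q) \<longrightarrow> \<bar>s - q\<bar> \<le> C * q powr (1 - 3 * \<epsilon>)"
proof -
  \<comment> \<open>With N = q^(8/9+\<epsilon>) one has N * N = q * q^(7/9+2 \<epsilon>), so this
    threshold for the second factor makes \<open>2 * K1 * q\<close> at most
    \<open>c\<^sup>2 * (N * N)\<close>.\<close>
  define T where "T = 2 * K1 / c\<^sup>2"
  \<comment> \<open>The first summand serves large q. Below the threshold q^(7/9) is at most
    \<open>T\<close>, so the second summand bounds q^(3 \<epsilon>); the 1 makes \<open>C\<close>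
    positive.\<close>
  define C where "C = 2 * K2 / c ^ 3 + (T powr (9 / 7)) powr (3 * \<epsilon>) + 1"
  have C: "C > 0" using c K by (simp add: C_def add_nonneg_pos)
  have "\<bar>s - q\<bar> \<le> C * q powr (1 - 3 * \<epsilon>)"
    if q: "q \<ge> 1" and s: "0 \<le> s" "s \<le> q"
      and x: "x \<ge> c * q powr (8 / 9 + \<epsilon>)" and y: "y \<ge> c * q powr (8 / 9 + \<epsilon>)" and z: "z \<ge> c * q powr (8 / 9 + \<epsilon>)"
      and main: "x * (y * z - K1 * q) * (q - s) \<le> K2 * (q ^ 3 * sqrt q)" for q s x y z :: real
  proof (cases "q powr (7 / 9 + 2 * \<epsilon>) \<ge> T")
    case True
    define N where "N = q powr (8 / 9 + \<epsilon>)"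
    have Npos: "N > 0" using q by (simp add: N_def)
    have NN: "N * N = q * q powr (7 / 9 + 2 * \<epsilon>)"
    proof -
      have "N * N = q powr (1 + (7 / 9 + 2 * \<epsilon>))" unfolding N_def powr_add[symmetric] by (simp add: algebra_simps)
      also have "\<dots> = q powr 1 * q powr (7 / 9 + 2 * \<epsilon>)" by (rule powr_add)
      finally show ?thesis using q by simp
    qed
    have "c\<^sup>2 * T = 2 * K1" using c by (simp add: T_def)
    then have "2 * (K1 * q) = c\<^sup>2 * (q * T)" by (simp add: algebra_simps)
    also have "\<dots> \<le> c\<^sup>2 * (q * q powr (7 / 9 + 2 * \<epsilon>))" using True q by (intro mult_left_mono) auto
    finally have K1q: "2 * (K1 * q) \<le> c\<^sup>2 * (N * N)" by (simp add: NN)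
    have cN: "0 < c * N" "c * N \<le> x" "c * N \<le> y" "c * N \<le> z" using x y z c Npos by (simp_all add: N_def)
    have "(c * N) * (c * N) \<le> y * z" by (rule mult_mono) (use cN in linarith)+
    then have "c\<^sup>2 * (N * N) \<le> y * z" by (simp add: power2_eq_square algebra_simps)
    then have yz: "c\<^sup>2 * (N * N) / 2 \<le> y * z - K1 * q" using K1q by linarith
    have "(c * N) * (c\<^sup>2 * (N * N) / 2) \<le> x * (y * z - K1 * q)"
    proof (rule mult_mono)
      show "c * N \<le> x" "0 \<le> x" using cN by linarith+
    qed (use yz c Npos in auto)
    then have "(c * N) * (c\<^sup>2 * (N * N) / 2) * (q - s) \<le> x * (y * z - K1 * q) * (q - s)"
      using s by (intro mult_right_mono) auto
    also have "\<dots> \<le> K2 * (q ^ 3 * sqrt q)" by (rule main)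
    finally have 1: "(c ^ 3 / 2) * (N ^ 3 * (q - s)) \<le> K2 * (q ^ 3 * sqrt q)"
      by (simp add: power2_eq_square power3_eq_cube algebra_simps)
    have N3: "N ^ 3 = q powr (8 / 3 + 3 * \<epsilon>)"
    proof -
      have "N ^ 3 = q powr ((8 / 9 + \<epsilon>) + (8 / 9 + \<epsilon>) + (8 / 9 + \<epsilon>))"
        unfolding powr_add by (simp add: N_def power3_eq_cube powr_add)
      then show ?thesis by (simp add: algebra_simps)
    qed
    have Q: "q ^ 3 * sqrt q = q powr (7 / 2)"
    proof -
      have "q ^ 3 = q powr 3" using q by (simp add: powr_numeral)
      moreover have "sqrt q = q powr (1 / 2)" using q by (simp add: powr_half_sqrt)
      ultimately have "q ^ 3 * sqrt q = q powr (3 + 1 / 2)" by (simp only: powr_add)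
      then show ?thesis by simp
    qed
    have "q - s \<le> (2 * K2 / c ^ 3) * q powr (7 / 2 - (8 / 3 + 3 * \<epsilon>))"
    proof -
      have "q powr (7 / 2) = q powr (8 / 3 + 3 * \<epsilon>) * q powr (7 / 2 - (8 / 3 + 3 * \<epsilon>))"
        by (simp add: powr_add[symmetric])
      then have "N ^ 3 * ((c ^ 3 / 2) * (q - s)) \<le> N ^ 3 * (K2 * q powr (7 / 2 - (8 / 3 + 3 * \<epsilon>)))"
        using 1 unfolding Q N3 by (simp add: algebra_simps)
      then have "(c ^ 3 / 2) * (q - s) \<le> K2 * q powr (7 / 2 - (8 / 3 + 3 * \<epsilon>))"
        using Npos by (simp add: mult_le_cancel_left_pos)
      then show ?thesis using c by (simp add: field_simps)
    qed
    also have "\<dots> \<le> (2 * K2 / c ^ 3) * q powr (1 - 3 * \<epsilon>)"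
      using q c K by (intro mult_left_mono powr_mono) auto
    also have "\<dots> \<le> C * q powr (1 - 3 * \<epsilon>)" by (intro mult_right_mono) (auto simp: C_def)
    finally show ?thesis using s by simp
  next
    case False
    have "q powr (7 / 9) \<le> q powr (7 / 9 + 2 * \<epsilon>)" using q \<epsilon> by (intro powr_mono) auto
    then have "q powr (7 / 9) \<le> T" using False by simp
    then have "(q powr (7 / 9)) powr (9 / 7) \<le> T powr (9 / 7)" by (intro powr_mono2) auto
    then have "q \<le> T powr (9 / 7)" using q by (simp add: powr_powr)
    then have "q powr (3 * \<epsilon>) \<le> (T powr (9 / 7)) powr (3 * \<epsilon>)" using q \<epsilon> by (intro powr_mono2) auto
    also have "\<dots> \<le> C" using c K by (simp add: C_def)
    finally have "q powr (3 * \<epsilon>) * q powr (1 - 3 * \<epsilon>) \<le> C * q powr (1 - 3 * \<epsilon>)" by (intro mult_right_mono) auto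
    moreover have "q powr (3 * \<epsilon>) * q powr (1 - 3 * \<epsilon>) = q" using q by (simp add: powr_add[symmetric])
    ultimately show ?thesis using s by simp
  qed
  then show ?thesis using C by blast
qed

theorem corollary1p5:
  fixes \<epsilon> c :: real and d :: nat
  assumes "\<epsilon> > 0" and "c > 0"
  shows "\<exists>C > 0. \<forall>(R :: 'a ring) P F G H J X Y Z.
    field R \<and> finite (carrier R) \<and>
    P \<in> carrier (Poly3 R) \<and>
    F \<in> carrier (Poly2 R) \<and> G \<in> carrier (Poly2 R) \<and> H \<in> carrier (Poly2 R) \<and>
    J \<in> carrier (UP R) \<and>
    P = eval2 R (Poly3 R) (const3 R) (x_var3 R) (lift_yz R G) F
        \<oplus>\<^bsub>Poly3 R\<^esub> lift_yz R H
        \<oplus>\<^bsub>Poly3 R\<^esub> eval R (Poly3 R) (const3 R) (x_var3 R) J \<and>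
    total_deg3 R P = d \<and>
    \<not> diagonal2 R F \<and> symmetric2 R F \<and> total_deg2 R F < ring_characteristic R \<and>
    alg_independent2 R G H \<and>
    X \<subseteq> carrier R \<and> Y \<subseteq> carrier R \<and> Z \<subseteq> carrier R \<and>
    real (card X) \<ge> c * real (order R) powr (8 / 9 + \<epsilon>) \<and>
    real (card Y) \<ge> c * real (order R) powr (8 / 9 + \<epsilon>) \<and>
    real (card Z) \<ge> c * real (order R) powr (8 / 9 + \<epsilon>)
    \<longrightarrow> \<bar>real (card (image3 R P X Y Z)) - real (order R)\<bar>
          \<le> C * real (order R) powr (1 - 3 * \<epsilon>)"
proof -
  define M where "M = fibre_degree d"
  obtain C where C: "C > 0" and bound: "\<forall>q s x y z :: real. q \<ge> 1 \<longrightarrow> 0 \<le> s \<longrightarrow> s \<le> q \<longrightarrow>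
    x \<ge> c * q powr (8 / 9 + \<epsilon>) \<longrightarrow> y \<ge> c * q powr (8 / 9 + \<epsilon>) \<longrightarrow> z \<ge> c * q powr (8 / 9 + \<epsilon>) \<longrightarrow>
    x * (y * z - 8 * real d * real M * q) * (q - s) \<le> 2 * real d * (real M)\<^sup>2 * (q ^ 3 * sqrt q)
      \<longrightarrow> \<bar>s - q\<bar> \<le> C * q powr (1 - 3 * \<epsilon>)"
    using expander_asymptotics[OF assms(2) _ _ assms(1), of "8 * real d * real M" "2 * real d * (real M)\<^sup>2"] by auto
  show ?thesis
  proof (intro exI[of _ C] conjI C allI impI, elim conjE)
    fix R :: "'a ring" and P F G H J X Y Z
    assume R: "field R" and fin: "finite (carrier R)"
      and hyps: "P \<in> carrier (Poly3 R)" "F \<in> carrier (Poly2 R)" "G \<in> carrier (Poly2 R)" "H \<in> carrier (Poly2 R)"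
        "J \<in> carrier (UP R)"
        "P = eval2 R (Poly3 R) (const3 R) (x_var3 R) (lift_yz R G) F
          \<oplus>\<^bsub>Poly3 R\<^esub> lift_yz R H \<oplus>\<^bsub>Poly3 R\<^esub> eval R (Poly3 R) (const3 R) (x_var3 R) J"
        "total_deg3 R P = d" "\<not> diagonal2 R F" "total_deg2 R F < ring_characteristic R" "alg_independent2 R G H"
        "X \<subseteq> carrier R" "Y \<subseteq> carrier R" "Z \<subseteq> carrier R"
      and sizes: "real (card X) \<ge> c * real (order R) powr (8 / 9 + \<epsilon>)"
        "real (card Y) \<ge> c * real (order R) powr (8 / 9 + \<epsilon>)"
        "real (card Z) \<ge> c * real (order R) powr (8 / 9 + \<epsilon>)"
    note eb = expander_bound_ring[OF R fin hyps M_def]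
    have "card (image3 R P X Y Z) \<le> order R" unfolding order_def using eb(1) fin by (rule card_mono[rotated])
    moreover have "order R \<ge> 1"
    proof -
      interpret field R by fact
      have "carrier R \<noteq> {}" by blast
      then show ?thesis unfolding order_def using fin by (simp add: Suc_le_eq card_gt_0_iff)
    qed
    ultimately show "\<bar>real (card (image3 R P X Y Z)) - real (order R)\<bar> \<le> C * real (order R) powr (1 - 3 * \<epsilon>)"
      using bound sizes eb(2) by simp
  qed
qed

end
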